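(* Let $n\geq 2$, let $h\in\mathfrak{D}_{1}$, let $V$ be a nonempty open subset of $\mathbb{R}^n$ and let $\nu>n-1$. Let \[ R_{n,\nu}=\bigcap_{\gamma>0}\left\{ \omega\in\mathbb{R}^n \:\Bigl|\: |q\cdot\omega|<\frac{\gamma}{{\|q\|_{1}}^\nu} \text{ for some }q\in\mathbb{Z}^n\setminus\{0\} \right\}. \] Then \[ \sum_{q\geq 1} h(q^{-(\nu+1)/n})=\infty \ \Longrightarrow\ \mathcal{H}^{\mathrm{Id}^{n-1}h}(R_{n,\nu}\cap V)=\infty, \qquad \sum_{q\geq 1} h(q^{-(\nu+1)/n})<\infty \ \Longrightarrow\ \mathcal{H}^{\mathrm{Id}^{n-1}h}(R_{n,\nu}\cap V)=0. \] Moreover, \[ R_{n,\nu}\in\mathrm{G}^{\mathrm{Id}^{n-1}h}(V) \quad\Longleftrightarrow\quad \sum_{q\geq1} h(q^{-(\nu+1)/n})=\infty, \] where $\mathrm{Id}^{n-1}h$ denotes the function $r\mapsto r^{n-1}h(r)$.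
   Context: $\cdot$ is the standard inner product and $\|\cdot\|_{1}$ the $\ell^1$-norm on $\mathbb{R}^n$. For a gauge $g$ (nondecreasing, $g(0)=\lim_{0^+}g=0$), $\mathcal{H}^g$ is the Hausdorff $g$-measure: $\mathcal{H}^g(F)=\lim_{\delta\downarrow0}\inf\{\sum_p g(\mathrm{diam}\,U_{p}) : F\subseteq\bigcup_p U_{p},\ \mathrm{diam}\,U_{p}<\delta\}$. For an integer $e\geq 1$, $\mathfrak{D}_{e}$ is the set of all functions $g$ which vanish at zero, are continuous and nondecreasing on $[0,\varepsilon]$ and are such that $r\mapsto g(r)/r^e$ is positive and nonincreasing on $(0,\varepsilon]$, for some $\varepsilon>0$; for $g,h\in\mathfrak{D}_{e}$, $g\prec h$ means $g/h$ monotonically tends to infinity at zero. Net measures on $\mathbb{R}^n$: fix an integer $c\geq 2$; a $c$-adic cube is a set $c^{-j}(\kappa+[0,1)^n)$, $j\in\mathbb{Z}$, $\kappa\in\mathbb{Z}^n$. For $g\in\mathfrak{D}_{n}$, $\varepsilon_{g}$ is the supremum of the $\varepsilon\in(0,1]$ such that $g$ is nondecreasing on $[0,\varepsilon]$ and $r\mapsto g(r)/r^n$ is nonincreasing on $(0,\varepsilon]$; for $F\subseteq\mathbb{R}^n$, $\mathcal{M}^g_{\infty}(F)=\inf\sum_{p}g(\mathrm{diam}\,\lambda_{p})$ over all covers of $F$ by sequences $(\lambda_{p})$ of sets each empty or a $c$-adic cube of diameter less than $\varepsilon_{g}$. For $g\in\mathfrak{D}_{n}$ and $V\subseteq\mathbb{R}^n$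 nonempty open, $\mathrm{G}^g(V)$ is the collection of all $G_{\delta}$-subsets $F$ of $\mathbb{R}^n$ such that $\mathcal{M}^{\overline{g}}_{\infty}(F\cap U)=\mathcal{M}^{\overline{g}}_{\infty}(U)$ for every $\overline{g}\in\mathfrak{D}_{n}$ with $\overline{g}\prec g$ and every open $U\subseteq V$ (independent of $c$ and of the norm). *)

theory Defs
  imports "HOL-Analysis.Analysis"
begin

section \<open>Gauge functions\<close>

text \<open>Gauges are functions \<^typ>\<open>real \<Rightarrow> real\<close> whose behaviour is constrained only near \<open>0\<^sup>+\<close>.\<close>

definition gauges :: "nat \<Rightarrow> (real \<Rightarrow> real) set" where
  "gauges e = {g. g 0 = 0 \<and>
     (\<exists>\<epsilon>>0. continuous_on {0..\<epsilon>} g \<and> mono_on {0..\<epsilon>} g \<and>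
        (\<forall>r\<in>{0<..\<epsilon>}. 0 < g r / r ^ e) \<and> antimono_on {0<..\<epsilon>} (\<lambda>r. g r / r ^ e))}"

definition gauge_prec :: "(real \<Rightarrow> real) \<Rightarrow> (real \<Rightarrow> real) \<Rightarrow> bool" (infix "\<prec>\<^sub>0" 50) where
  "g \<prec>\<^sub>0 h \<longleftrightarrow> filterlim (\<lambda>r. g r / h r) at_top (at_right 0) \<and>
     (\<exists>\<epsilon>>0. antimono_on {0<..\<epsilon>} (\<lambda>r. g r / h r))"

definition Id_times :: "nat \<Rightarrow> (real \<Rightarrow> real) \<Rightarrow> real \<Rightarrow> real" where
  "Id_times k h = (\<lambda>r. r ^ k * h r)"

lemma Id_times_in_gauges:
  assumes "h \<in> gauges e"
  shows "Id_times k h \<in> gauges (k + e)"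
proof -
  obtain \<epsilon> where h0: "h 0 = 0" and \<epsilon>: "\<epsilon> > 0" "continuous_on {0..\<epsilon>} h" "mono_on {0..\<epsilon>} h"
    "\<forall>r\<in>{0<..\<epsilon>}. 0 < h r / r ^ e" "antimono_on {0<..\<epsilon>} (\<lambda>r. h r / r ^ e)"
    using assms unfolding gauges_def by blast
  have nonneg: "0 \<le> h r" if "r \<in> {0..\<epsilon>}" for r
    using monotone_onD[OF \<epsilon>(3), of 0 r] that h0 by auto
  have eq: "Id_times k h r / r ^ (k + e) = h r / r ^ e" if "r \<in> {0<..\<epsilon>}" for r
    using that by (simp add: Id_times_def power_add)
  have "continuous_on {0..\<epsilon>} (Id_times k h)"
    unfolding Id_times_def by (intro continuous_intros \<epsilon>)
  moreover have "mono_on {0..\<epsilon>} (Id_times k h)"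
    unfolding Id_times_def
    by (intro monotone_onI mult_mono power_mono monotone_onD[OF \<epsilon>(3)]) (auto intro: nonneg)
  moreover have "\<forall>r\<in>{0<..\<epsilon>}. 0 < Id_times k h r / r ^ (k + e)"
    using eq \<epsilon>(4) by simp
  moreover have "antimono_on {0<..\<epsilon>} (\<lambda>r. Id_times k h r / r ^ (k + e))"
    using eq \<epsilon>(5) by (auto simp: monotone_on_def)
  ultimately show ?thesis
    unfolding gauges_def using \<epsilon>(1) h0 by (auto simp: Id_times_def)
qed

section \<open>Hausdorff measures\<close>

text \<open>\<^const>\<open>diameter\<close> is meaningful only for bounded sets, so boundedness is part of having
  diameter less than \<open>\<delta>\<close>. For a gauge \<open>g\<close>, negative values (which \<open>ennreal\<close> would
  truncate to zero) cannot occur once \<open>\<delta>\<close> is small.\<close>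

definition hausdorff_premeasure ::
    "(real \<Rightarrow> real) \<Rightarrow> real \<Rightarrow> 'a::metric_space set \<Rightarrow> ennreal" where
  "hausdorff_premeasure g \<delta> F = Inf {(\<Sum>p. ennreal (g (diameter (U p)))) | U :: nat \<Rightarrow> 'a set.
     F \<subseteq> (\<Union>p. U p) \<and> (\<forall>p. bounded (U p) \<and> diameter (U p) < \<delta>)}"

definition hausdorff_measure :: "(real \<Rightarrow> real) \<Rightarrow> 'a::metric_space set \<Rightarrow> ennreal" where
  "hausdorff_measure g F = Lim (at_right 0) (\<lambda>\<delta>. hausdorff_premeasure g \<delta> F)"

text \<open>The limit defining the Hausdorff measure always exists.\<close>

lemma hausdorff_premeasure_antimono:
  assumes "\<delta> \<le> \<delta>'"
  shows "hausdorff_premeasure g \<delta>' F \<le> hausdorff_premeasure g \<delta> F"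
  unfolding hausdorff_premeasure_def
  using assms by (intro Inf_superset_mono) (force intro: less_le_trans)

lemma tendsto_hausdorff_premeasure:
  "((\<lambda>\<delta>. hausdorff_premeasure g \<delta> F) \<longlongrightarrow> (SUP \<delta>\<in>{0<..}. hausdorff_premeasure g \<delta> F)) (at_right 0)"
proof (rule order_tendstoI)
  fix a assume "a < (SUP \<delta>\<in>{0<..}. hausdorff_premeasure g \<delta> F)"
  then obtain d :: real where d: "d > 0" "a < hausdorff_premeasure g d F"
    by (auto simp: less_SUP_iff)
  then show "\<forall>\<^sub>F \<delta> in at_right 0. a < hausdorff_premeasure g \<delta> F"
    unfolding eventually_at_right_field
    by (meson hausdorff_premeasure_antimono less_imp_le order_less_le_trans)
next
  fix a assume a: "(SUP \<delta>\<in>{0<..}. hausdorff_premeasure g \<delta> F) < a"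
  have "hausdorff_premeasure g \<delta> F < a" if "\<delta> > 0" for \<delta> :: real
    using a that by (meson SUP_upper greaterThan_iff order_le_less_trans)
  then show "\<forall>\<^sub>F \<delta> in at_right 0. hausdorff_premeasure g \<delta> F < a"
    by (auto simp: eventually_at_right_field intro: exI[of _ 1])
qed

lemma hausdorff_measure_eq_SUP:
  "hausdorff_measure g F = (SUP \<delta>\<in>{0<..}. hausdorff_premeasure g \<delta> F)"
  unfolding hausdorff_measure_def
  by (rule tendsto_Lim[OF _ tendsto_hausdorff_premeasure]) simp

section \<open>Net measures and large intersection classes\<close>

definition adic_cube :: "nat \<Rightarrow> int \<Rightarrow> int ^ 'n \<Rightarrow> (real ^ 'n) set" where
  "adic_cube c j \<kappa> = (\<lambda>x. (real c powi (- j)) *\<^sub>R ((\<chi> i. of_int (\<kappa> $ i)) + x)) `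
     {x. \<forall>i. 0 \<le> x $ i \<and> x $ i < 1}"

definition adic_cubes :: "nat \<Rightarrow> (real ^ 'n) set set" where
  "adic_cubes c = {adic_cube c j \<kappa> | j \<kappa>. True}"

definition gauge_threshold :: "nat \<Rightarrow> (real \<Rightarrow> real) \<Rightarrow> real" where
  "gauge_threshold n g = Sup {\<epsilon>. 0 < \<epsilon> \<and> \<epsilon> \<le> 1 \<and> mono_on {0..\<epsilon>} g \<and>
     antimono_on {0<..\<epsilon>} (\<lambda>r. g r / r ^ n)}"

definition net_measure :: "nat \<Rightarrow> (real \<Rightarrow> real) \<Rightarrow> (real ^ 'n) set \<Rightarrow> ennreal" where
  "net_measure c g F = Inf {(\<Sum>p. ennreal (g (diameter (\<Lambda> p)))) | \<Lambda> :: nat \<Rightarrow> (real ^ 'n) set.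
     F \<subseteq> (\<Union>p. \<Lambda> p) \<and>
     (\<forall>p. \<Lambda> p = {} \<or>
       (\<Lambda> p \<in> adic_cubes c \<and> diameter (\<Lambda> p) < gauge_threshold CARD('n) g))}"

definition large_intersection_class ::
    "nat \<Rightarrow> (real \<Rightarrow> real) \<Rightarrow> (real ^ 'n) set \<Rightarrow> (real ^ 'n) set set" where
  "large_intersection_class c g V = {F. gdelta_in euclidean F \<and>
     (\<forall>g'\<in>gauges CARD('n). g' \<prec>\<^sub>0 g \<longrightarrow>
        (\<forall>U. open U \<and> U \<subseteq> V \<longrightarrow> net_measure c g' (F \<inter> U) = net_measure c g' U))}"

section \<open>Vectors close to a rational hyperplane\<close>

definition of_int_vec :: "int ^ 'n \<Rightarrow> real ^ 'n" where
  "of_int_vec q = (\<chi> i. of_int (q $ i))"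

definition l1_norm :: "real ^ 'n \<Rightarrow> real" where
  "l1_norm x = (\<Sum>i\<in>UNIV. \<bar>x $ i\<bar>)"

definition R_set :: "real \<Rightarrow> (real ^ 'n) set" where
  "R_set \<nu> = (\<Inter>\<gamma>\<in>{0<..}. {\<omega>. \<exists>q::int ^ 'n. q \<noteq> 0 \<and>
     \<bar>of_int_vec q \<bullet> \<omega>\<bar> < \<gamma> / l1_norm (of_int_vec q) powr \<nu>})"

text \<open>The sum over \<open>q \<ge> 1\<close> is indexed by \<open>q = Suc k\<close>. At most finitely many terms are truncated to
  zero by \<open>ennreal\<close> when \<open>h\<close> is a gauge, so this does not affect finiteness of the sum.\<close>

definition approx_sum :: "nat \<Rightarrow> real \<Rightarrow> (real \<Rightarrow> real) \<Rightarrow> ennreal" where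
  "approx_sum n \<nu> h = (\<Sum>k. ennreal (h (real (Suc k) powr (- ((\<nu> + 1) / real n)))))"

end

theory Submission
  imports Defs
begin

text \<open>
  In the divergence case the argument is a finite mass distribution on the tree of \<open>c\<close>-adic cubes.
  Dirichlet's theorem shows that at the scale \<open>N\<^sup>-\<^sup>n\<close> most cubes of a given cube are crossed, near
  their centres, by a hyperplane orthogonal to an integer vector \<open>q\<close> of size at most \<open>N\<close>. In each such
  cube, mass is spread over the small cubes, of side about \<open>N\<^sup>-\<^sup>\<nu>\<^sup>-\<^sup>1\<close>, which meet the hyperplane. Letting \<open>N\<close>
  run through the powers of a large constant and discarding the cubes which meet the pieces of an
  earlier scale loses only a small proportion of the cubes, because a hyperplane meets few of
  them; hence no quasi-independence estimate is required. A scale contributes a proportion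
  comparable to \<open>N\<^sup>n h(N\<^sup>-\<^sup>\<nu>\<^sup>-\<^sup>1)\<close> of the mass, so divergence of the sum makes the masses as spread out as
  required by the gauge. The mass of any cube can thus be redistributed, without loss, on
  cubes where the inequality has a solution with a prescribed \<open>\<gamma>\<close>; iterating and using compactness bounds the cost of
  every cover of \<open>R\<close> from below. In the convergence case the natural cover of \<open>R\<close> shows that the
  Hausdorff measure vanishes; this remains true for a slightly larger gauge, for which the net
  measure of \<open>R\<close> is therefore zero, so \<open>R\<close> does not have large intersection.
\<close>

section \<open>Indexed adic cubes\<close>

text \<open>Weights on cubes bound the cost of every cover from below as soon as no cube carries
  more weight than it costs itself, as in the easy half of max-flow min-cut; the divergence case
  consists in building such weights. The weight of a piece is forced: a leaf of side
  \<open>r\<close> gets \<open>r ^ (n - 1) * h r\<close>. With \<open>N = c ^ (a * t)\<close> there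
  are, up to constants, \<open>N ^ (n * n)\<close> cells per unit volume, each with
  \<open>N powr ((\<nu> + 1 - n) * (n - 1))\<close> leaves, and multiplying the three quantities
  leaves exactly \<open>N ^ n * h (N powr (- (\<nu> + 1)))\<close>. The obstacle is that the
  normalised weight of a cube is bounded only by a multiple of its volume plus a small multiple of
  the gauge. The volume term is harmless at great depth: divergence and \<open>\<nu> + 1 > n\<close>
  together force \<open>h r / r\<close> to infinity at zero. Mass is therefore first spread evenly
  down to a deep level, and only there moved onto hyperplanes.\<close>

definition cube :: "nat \<Rightarrow> nat \<times> (int ^ 'n) \<Rightarrow> (real ^ 'n) set" where
  "cube c p = {x. \<forall>i. \<lfloor>real c ^ fst p * x $ i\<rfloor> = snd p $ i}"

lemma mem_cube: "x \<in> cube c (j, \<kappa>) \<longleftrightarrow> (\<forall>i. \<lfloor>real c ^ j * x $ i\<rfloor> = \<kappa> $ i)"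
  by (simp add: cube_def)

lemma mem_cube_iff:
  assumes "c > 0"
  shows "x \<in> cube c (j, \<kappa>) \<longleftrightarrow>
    (\<forall>i. real_of_int (\<kappa> $ i) / real c ^ j \<le> x $ i \<and> x $ i < (real_of_int (\<kappa> $ i) + 1) / real c ^ j)"
proof -
  have "real c ^ j > 0" using assms by simp
  then show ?thesis
    unfolding mem_cube floor_eq_iff by (auto simp: field_simps)
qed

definition index :: "nat \<Rightarrow> nat \<Rightarrow> real ^ 'n \<Rightarrow> int ^ 'n" where
  "index c j x = (\<chi> i. \<lfloor>real c ^ j * x $ i\<rfloor>)"

lemma mem_cube_index: "x \<in> cube c p \<longleftrightarrow> snd p = index c (fst p) x"
  by (cases p) (auto simp: mem_cube index_def vec_eq_iff)

lemma cube_nonempty: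
  assumes "c > 0"
  shows "(\<chi> i. real_of_int (\<kappa> $ i) / real c ^ j) \<in> cube c (j, \<kappa>)"
  using assms by (simp add: mem_cube)

lemma cube_ne: "c > 0 \<Longrightarrow> cube c p \<noteq> {}"
  using cube_nonempty[of c "snd p" "fst p"] by (cases p) auto

text \<open>The index at level \<open>j\<close> is the integer quotient of the index at the finer
  level \<open>j'\<close> by \<open>c ^ (j' - j)\<close>. This identity is what makes the cubes a
  tree: two cubes with a common point are nested.\<close>

lemma index_coarsen:
  assumes "c > 0" "j \<le> j'" "index c j' x = index c j' y"
  shows "index c j x = index c j y"
proof -
  have *: "\<lfloor>real c ^ j * x $ i\<rfloor> = \<lfloor>real c ^ j' * x $ i\<rfloor> div int (c ^ (j' - j))" for x :: "real ^ 'n" and i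
  proof -
    have "real c ^ j * x $ i = (real c ^ j' * x $ i) / real (c ^ (j' - j))"
      using assms(1,2) power_add[of "real c" j "j' - j"] by (simp add: field_simps)
    then show ?thesis
      by (metis floor_divide_real_eq_div of_nat_0_le_iff of_int_of_nat_eq)
  qed
  have "\<lfloor>real c ^ j' * x $ i\<rfloor> = \<lfloor>real c ^ j' * y $ i\<rfloor>" for i
    using assms(3) by (auto simp: index_def vec_eq_iff)
  then show ?thesis unfolding index_def vec_eq_iff vec_lambda_beta * by simp
qed

lemma cube_nested:
  assumes "c > 0" "fst p \<le> fst p'" "x \<in> cube c p" "x \<in> cube c p'"
  shows "cube c p' \<subseteq> cube c p"
proof
  fix y assume "y \<in> cube c p'"
  then have "index c (fst p') y = index c (fst p') x"
    using assms(4) by (auto simp: mem_cube_index)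
  then have "index c (fst p) y = index c (fst p) x"
    by (rule index_coarsen[OF assms(1,2)])
  then show "y \<in> cube c p" using assms(3) by (auto simp: mem_cube_index)
qed

lemma cube_eqI: "fst p = fst p' \<Longrightarrow> x \<in> cube c p \<Longrightarrow> x \<in> cube c p' \<Longrightarrow> p = p'"
  by (auto simp: mem_cube_index prod_eq_iff)

lemma cbox_closed_cube:
  assumes "c > 0"
  shows "closure (cube c (j, \<kappa>)) \<subseteq> cbox (\<chi> i. real_of_int (\<kappa> $ i) / real c ^ j)
     (\<chi> i. (real_of_int (\<kappa> $ i) + 1) / real c ^ j)"
proof (rule closure_minimal)
  show "cube c (j, \<kappa>) \<subseteq> cbox (\<chi> i. real_of_int (\<kappa> $ i) / real c ^ j)
     (\<chi> i. (real_of_int (\<kappa> $ i) + 1) / real c ^ j)"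
    unfolding mem_box_cart subset_iff mem_cube_iff[OF assms] by (auto simp: less_imp_le)
qed (rule closed_cbox)

lemma closure_cube_le:
  assumes "c > 0" "x \<in> closure (cube c (j, \<kappa>))"
  shows "real_of_int (\<kappa> $ i) / real c ^ j \<le> x $ i" "x $ i \<le> (real_of_int (\<kappa> $ i) + 1) / real c ^ j"
  using cbox_closed_cube[OF assms(1), of j \<kappa>] assms(2) by (auto simp: mem_box_cart)

lemma bounded_cube:
  assumes "c > 0"
  shows "bounded (cube c p)"
proof -
  have "bounded (closure (cube c (fst p, snd p)))"
    by (rule bounded_subset[OF bounded_cbox cbox_closed_cube[OF assms]])
  then show ?thesis using bounded_subset closure_subset by (metis prod.collapse)
qed

lemma norm_vec_const: "norm ((\<chi> i. a) :: real ^ 'n) = sqrt (real CARD('n)) * \<bar>a\<bar>"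
  by (simp add: norm_vec_def L2_set_def real_sqrt_mult)

lemma diameter_cube:
  fixes p :: "nat \<times> (int ^ 'n)"
  assumes "c > 0"
  shows "diameter (cube c p) = sqrt (real CARD('n)) / real c ^ fst p"
proof (rule antisym)
  obtain j \<kappa> where p: "p = (j, \<kappa>)" by (cases p)
  let ?s = "1 / real c ^ j"
  have s: "?s > 0" using assms by simp
  show "diameter (cube c p) \<le> sqrt (real CARD('n)) / real c ^ fst p"
  proof (rule diameter_le)
    fix x y assume "x \<in> cube c p" "y \<in> cube c p"
    then have "\<bar>(x - y) $ i\<bar> \<le> ?s" for i
      using mem_cube_iff[OF assms, of x j \<kappa>] mem_cube_iff[OF assms, of y j \<kappa>] p
      by (auto simp: add_divide_distrib abs_le_iff)
        (smt (verit))+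
    then have "norm (x - y) \<le> norm ((\<chi> i. ?s) :: real ^ 'n)"
      using s by (intro norm_le_componentwise_cart) (auto simp: real_norm_def)
    then show "norm (x - y) \<le> sqrt (real CARD('n)) / real c ^ fst p"
      using s p unfolding norm_vec_const by simp
  qed (use s p in auto)
  show "sqrt (real CARD('n)) / real c ^ fst p \<le> diameter (cube c p)"
  \<comment> \<open>The half-open cube misses its far corner, so the diagonal is approached by the
    points at a fraction \<open>z < 1\<close> of it.\<close>
  proof (rule field_le_mult_one_interval)
    fix z :: real assume z: "0 < z" "z < 1"
    define x where "x = (\<chi> i. real_of_int (\<kappa> $ i) / real c ^ j)"
    define y where "y = x + (\<chi> i. z * ?s)"
    have "x \<in> cube c p" using cube_nonempty[OF assms] p x_def by auto
    moreover have "y \<in> cube c p"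
    proof -
      have "real c ^ j * y $ i = real_of_int (\<kappa> $ i) + z" for i
        unfolding y_def x_def using s by (simp add: field_simps)
      then show ?thesis using z by (simp add: p mem_cube floor_eq_iff)
    qed
    ultimately have "dist y x \<le> diameter (cube c p)"
      by (intro diameter_bounded_bound bounded_cube assms)
    then show "z * (sqrt (real CARD('n)) / real c ^ fst p) \<le> diameter (cube c p)"
      using z s unfolding y_def dist_norm by (simp add: norm_vec_const p mult.commute)
  qed
qed

text \<open>Diameters decrease strictly with the level when \<open>c \<ge> 2\<close>, so a cube, as
  a set, determines its level.\<close>

lemma cube_subset_level:
  fixes p :: "nat \<times> (int ^ 'n)"
  assumes "c \<ge> 2" "cube c p' \<subseteq> cube c p"
  shows "fst p \<le> fst p'"
proof -
  have "sqrt (real CARD('n)) / real c ^ fst p' \<le> sqrt (real CARD('n)) / real c ^ fst p"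
    using diameter_subset[OF assms(2)] bounded_cube[of c p] assms(1) by (simp add: diameter_cube)
  then have "real c ^ fst p \<le> real c ^ fst p'"
    using assms(1) by (simp add: field_simps)
  then show ?thesis using assms(1) by simp
qed

section \<open>Counting the subcubes of a cube\<close>

lemma card_vec_box:
  assumes "\<And>i. finite (S i)"
  shows "card {v :: int ^ 'n. \<forall>i. v $ i \<in> S i} = (\<Prod>i\<in>UNIV. card (S i))"
    and "finite {v :: int ^ 'n. \<forall>i. v $ i \<in> S i}"
proof -
  have b: "bij_betw vec_nth {v :: int ^ 'n. \<forall>i. v $ i \<in> S i} (PiE UNIV S)"
    by (rule bij_betw_byWitness[where f' = vec_lambda]) auto
  show "card {v :: int ^ 'n. \<forall>i. v $ i \<in> S i} = (\<Prod>i\<in>UNIV. card (S i))"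
    using bij_betw_same_card[OF b] by (simp add: card_PiE)
  show "finite {v :: int ^ 'n. \<forall>i. v $ i \<in> S i}"
    using bij_betw_finite[OF b] assms by (simp add: finite_PiE)
qed

definition subcubes :: "nat \<Rightarrow> nat \<times> (int ^ 'n) \<Rightarrow> nat \<Rightarrow> (nat \<times> (int ^ 'n)) set" where
  "subcubes c p j = {p'. fst p' = j \<and> cube c p' \<subseteq> cube c p}"

lemma subcubes_eq:
  fixes \<kappa> :: "int ^ 'n"
  assumes "c > 0" "j \<le> j'"
  shows "subcubes c (j, \<kappa>) j' =
    Pair j' ` {v. \<forall>i. v $ i \<in> {\<kappa> $ i * int c ^ (j' - j) ..< (\<kappa> $ i + 1) * int c ^ (j' - j)}}"
proof -
  have "cube c (j', v) \<subseteq> cube c (j, \<kappa>) \<longleftrightarrow>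
     (\<forall>i. v $ i \<in> {\<kappa> $ i * int c ^ (j' - j) ..< (\<kappa> $ i + 1) * int c ^ (j' - j)})" for v :: "int ^ 'n"
  proof -
    define x where "x = (\<chi> i. real_of_int (v $ i) / real c ^ j')"
    have x: "x \<in> cube c (j', v)" unfolding x_def by (rule cube_nonempty[OF assms(1)])
    \<comment> \<open>By nesting, the lower corner of the fine cube decides the inclusion, which
      thereby becomes a range condition on each coordinate of the index.\<close>
    have "cube c (j', v) \<subseteq> cube c (j, \<kappa>) \<longleftrightarrow> x \<in> cube c (j, \<kappa>)"
      using x cube_nested[of c "(j, \<kappa>)" "(j', v)" x] assms by auto
    also have "\<dots> \<longleftrightarrow> (\<forall>i. v $ i \<in> {\<kappa> $ i * int c ^ (j' - j) ..< (\<kappa> $ i + 1) * int c ^ (j' - j)})"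
    proof -
      have c: "real c ^ j' = real c ^ j * real c ^ (j' - j)"
        using assms(2) by (simp flip: power_add)
      have cp: "real c ^ j > 0" "real c ^ (j' - j) > 0" using assms(1) by auto
      have "real c ^ j * (real_of_int (v $ i) / real c ^ j') = real_of_int (v $ i) / real c ^ (j' - j)" for i
        unfolding c using cp by (simp add: field_simps)
      moreover have "\<lfloor>real_of_int (v $ i) / real c ^ (j' - j)\<rfloor> = \<kappa> $ i \<longleftrightarrow>
        v $ i \<in> {\<kappa> $ i * int c ^ (j' - j) ..< (\<kappa> $ i + 1) * int c ^ (j' - j)}" for i
      proof -
        have "real_of_int (\<kappa> $ i) * real c ^ (j' - j) \<le> real_of_int (v $ i) \<longleftrightarrow> \<kappa> $ i * int c ^ (j' - j) \<le> v $ i"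
          by (metis of_int_le_iff of_int_mult of_int_of_nat_eq of_int_power)
        moreover have "real_of_int (v $ i) < (real_of_int (\<kappa> $ i) + 1) * real c ^ (j' - j) \<longleftrightarrow> v $ i < (\<kappa> $ i + 1) * int c ^ (j' - j)"
          by (metis (mono_tags, opaque_lifting) of_int_less_iff of_int_mult of_int_of_nat_eq of_int_power of_int_add of_int_1)
        ultimately show ?thesis
          unfolding floor_eq_iff using cp by (auto simp: pos_le_divide_eq pos_divide_less_eq)
      qed
      ultimately show ?thesis by (simp add: mem_cube x_def)
    qed
    finally show ?thesis .
  qed
  then show ?thesis by (auto simp: subcubes_def image_iff)
qed

lemma
  fixes p :: "nat \<times> (int ^ 'n)"
  assumes "c > 0" "fst p \<le> j'"
  shows finite_subcubes: "finite (subcubes c p j')"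
    and card_subcubes: "card (subcubes c p j') = c ^ ((j' - fst p) * CARD('n))"
proof -
  obtain j \<kappa> where p: "p = (j, \<kappa>)" by (cases p)
  have *: "card {\<kappa> $ i * int c ^ (j' - j) ..< (\<kappa> $ i + 1) * int c ^ (j' - j)} = c ^ (j' - j)" for i
    by (simp add: algebra_simps flip: of_nat_power)
  show "finite (subcubes c p j')"
    unfolding p using assms p
    by (subst subcubes_eq) (auto intro!: finite_imageI card_vec_box(2) simp del: atLeastLessThan_iff)
  have "card (subcubes c p j') = card {v :: int ^ 'n. \<forall>i. v $ i \<in> {\<kappa> $ i * int c ^ (j' - j) ..< (\<kappa> $ i + 1) * int c ^ (j' - j)}}"
    unfolding p using assms p by (subst subcubes_eq) (auto intro!: card_image simp: inj_on_def)
  also have "\<dots> = (\<Prod>i\<in>(UNIV :: 'n set). c ^ (j' - j))"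
    by (subst card_vec_box) (auto simp del: card_atLeastLessThan_int simp: *)
  finally show "card (subcubes c p j') = c ^ ((j' - fst p) * CARD('n))"
    by (simp add: p power_mult)
qed

lemma subcubes_UN:
  assumes "c > 0" "fst p \<le> j'"
  shows "(\<Union>p'\<in>subcubes c p j'. cube c p') = cube c p"
proof
  show "cube c p \<subseteq> (\<Union>p'\<in>subcubes c p j'. cube c p')"
  proof
    fix x assume x: "x \<in> cube c p"
    have "x \<in> cube c (j', index c j' x)" by (simp add: mem_cube_index)
    moreover have "(j', index c j' x) \<in> subcubes c p j'"
      using cube_nested[OF assms(1), of p "(j', index c j' x)" x] assms(2) x calculation
      by (auto simp: subcubes_def)
    ultimately show "x \<in> (\<Union>p'\<in>subcubes c p j'. cube c p')" by blast
  qed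
qed (auto simp: subcubes_def)

section \<open>Indexed cubes and the adic cubes of the net measure\<close>

lemma adic_cube_nat:
  assumes "c > 0"
  shows "adic_cube c (int j) \<kappa> = cube c (j, \<kappa>)"
proof -
  have c: "real c ^ j > 0" using assms by simp
  have pw: "real c powi (- int j) = 1 / real c ^ j"
    by (simp add: power_int_minus field_simps)
  show ?thesis
  proof (intro set_eqI iffI)
    fix y assume "y \<in> adic_cube c (int j) \<kappa>"
    then obtain x where x: "y = (real c powi (- int j)) *\<^sub>R ((\<chi> i. of_int (\<kappa> $ i)) + x)"
      "\<And>i. 0 \<le> x $ i \<and> x $ i < 1"
      unfolding adic_cube_def by blast
    show "y \<in> cube c (j, \<kappa>)"
      unfolding mem_cube_iff[OF assms] x(1) pw using x(2) c
      by (auto simp: field_simps)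
  next
    fix y assume y: "y \<in> cube c (j, \<kappa>)"
    define x where "x = real c ^ j *\<^sub>R y - (\<chi> i. of_int (\<kappa> $ i))"
    have "y = (real c powi (- int j)) *\<^sub>R ((\<chi> i. of_int (\<kappa> $ i)) + x)"
      unfolding x_def pw using c assms by simp
    moreover have "0 \<le> x $ i \<and> x $ i < 1" for i
      using y unfolding mem_cube floor_eq_iff x_def by (auto simp: algebra_simps)
    ultimately show "y \<in> adic_cube c (int j) \<kappa>"
      unfolding adic_cube_def by blast
  qed
qed

lemma cube_adic: "c > 0 \<Longrightarrow> cube c p \<in> adic_cubes c"
  by (metis (mono_tags, lifting) adic_cube_nat adic_cubes_def mem_Collect_eq prod.collapse)

text \<open>At a negative level the side is at least \<open>c\<close>, and the segment from the
  lower corner to the centre already has length at least 1. Net covers use diameters below a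
  threshold which is at most 1, so natural levels suffice.\<close>

lemma small_adic_cube:
  assumes "c \<ge> 2" "\<Lambda> \<in> adic_cubes c" "diameter \<Lambda> < 1"
  shows "\<exists>p. \<Lambda> = (cube c p :: (real ^ 'n) set)"
proof -
  obtain j \<kappa> where \<Lambda>: "\<Lambda> = adic_cube c j (\<kappa> :: int ^ 'n)" using assms(2) by (auto simp: adic_cubes_def)
  show ?thesis
  proof (cases "j \<ge> 0")
    case True
    then show ?thesis using \<Lambda> adic_cube_nat[of c "nat j" \<kappa>] assms(1) by auto
  next
    case False
    define s where "s = real c powi (- j)"
    have s: "s \<ge> 2"
    proof -
      have "s = real c ^ nat (- j)" using False by (simp add: s_def power_int_def)
      also have "\<dots> \<ge> real c ^ 1" using False assms(1) by (intro power_increasing) auto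
      finally show ?thesis using assms(1) by simp
    qed
    define f where "f = (\<lambda>x :: real ^ 'n. s *\<^sub>R ((\<chi> i. of_int (\<kappa> $ i)) + x))"
    have 1: "f 0 \<in> \<Lambda>" "f (\<chi> i. 1/2) \<in> \<Lambda>"
      unfolding \<Lambda> adic_cube_def f_def s_def by (auto intro!: imageI)
    have "bounded \<Lambda>"
    proof -
      have "bounded {x :: real ^ 'n. \<forall>i. 0 \<le> x $ i \<and> x $ i < 1}"
        by (rule bounded_subset[OF bounded_cbox[of 0 1]]) (auto simp: mem_box_cart less_imp_le)
      then have "bounded ((\<lambda>x. s *\<^sub>R x) ` ((\<lambda>x. (\<chi> i. of_int (\<kappa> $ i)) + x) ` {x :: real ^ 'n. \<forall>i. 0 \<le> x $ i \<and> x $ i < 1}))"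
        by (intro bounded_scaling bounded_translation)
      then show ?thesis
        unfolding \<Lambda> adic_cube_def s_def image_image .
    qed
    then have "dist (f (\<chi> i. 1/2)) (f 0) \<le> diameter \<Lambda>"
      using 1 by (intro diameter_bounded_bound)
    moreover have "dist (f (\<chi> i. 1/2)) (f 0) = s * (sqrt (real CARD('n)) / 2)"
      using s unfolding f_def dist_norm by (simp add: norm_vec_const flip: scaleR_diff_right)
    moreover have "1 \<le> s * (sqrt (real CARD('n)) / 2)"
      using s mult_mono[of 2 s "1/2" "sqrt (real CARD('n)) / 2"]
      by (simp add: Suc_leI)
    ultimately show ?thesis using assms(3) by linarith
  qed
qed

section \<open>Flows on the tree of cubes\<close>

definition disjoint_cubes :: "nat \<Rightarrow> (nat \<times> (int ^ 'n)) set \<Rightarrow> bool" where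
  "disjoint_cubes c P \<longleftrightarrow> (\<forall>p\<in>P. \<forall>p'\<in>P. p \<noteq> p' \<longrightarrow> cube c p \<inter> cube c p' = {})"

text \<open>A flow down the tree of cubes in which a cube of level \<open>j\<close> has capacity
  \<open>G j\<close>, stopped at the finite antichain \<open>P\<close>. When \<open>G j\<close> is
  the cost of a cube of level \<open>j\<close>, the last condition says that no covering cube holds
  more mass than it costs. \<open>J\<close> is the first level at which capacities are
  tested.\<close>

definition flow :: "nat \<Rightarrow> (nat \<Rightarrow> real) \<Rightarrow> nat \<Rightarrow> (nat \<times> (int ^ 'n)) set \<Rightarrow> (nat \<times> (int ^ 'n) \<Rightarrow> real) \<Rightarrow> bool"
  where "flow c G J P w \<longleftrightarrow> finite P \<and> (\<forall>p\<in>P. 0 \<le> w p \<and> J \<le> fst p) \<and> disjoint_cubes c P \<and>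
    (\<forall>\<Lambda>. J \<le> fst \<Lambda> \<longrightarrow> sum w {p\<in>P. cube c p \<subseteq> cube c \<Lambda>} \<le> G (fst \<Lambda>))"

text \<open>Each cube can send its full capacity into \<open>A\<close>. The result is again a flow,
  so splittings for different sets can be iterated, which gives access to countable intersections.
  The conditions on closures and levels make the iterates nested compact sets whose cubes
  shrink.\<close>

definition splittable :: "nat \<Rightarrow> (nat \<Rightarrow> real) \<Rightarrow> nat \<Rightarrow> (real ^ 'n) set \<Rightarrow> bool" where
  "splittable c G J A \<longleftrightarrow> (\<forall>q. J \<le> fst q \<longrightarrow> (\<exists>P w. flow c G (fst q) P w \<and> sum w P = G (fst q) \<and>
     (\<forall>p\<in>P. fst q < fst p \<and> closure (cube c p) \<subseteq> cube c q \<and> cube c p \<subseteq> A)))"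

lemma flow_cap:
  assumes "flow c G J P w" "J \<le> fst \<Lambda>"
  shows "sum w {p\<in>P. cube c p \<subseteq> cube c \<Lambda>} \<le> G (fst \<Lambda>)"
  using assms unfolding flow_def by blast

lemma flow_le:
  assumes "flow c G J P w" "p \<in> P"
  shows "w p \<le> G (fst p)"
proof -
  have "w p = sum w {p}" by simp
  also have "\<dots> \<le> sum w {p'\<in>P. cube c p' \<subseteq> cube c p}"
    using assms by (intro sum_mono2) (auto simp: flow_def)
  also have "\<dots> \<le> G (fst p)"
    by (rule flow_cap[OF assms(1)]) (use assms in \<open>auto simp: flow_def\<close>)
  finally show ?thesis .
qed

lemma flow_scale:
  assumes "flow c G J P w" "0 \<le> s" "s \<le> 1"
  shows "flow c G J P (\<lambda>p. s * w p)"
  unfolding flow_def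
proof (intro conjI allI impI ballI)
  fix \<Lambda> :: "nat \<times> (int ^ 'a)" assume \<Lambda>: "J \<le> fst \<Lambda>"
  let ?S = "sum w {p\<in>P. cube c p \<subseteq> cube c \<Lambda>}"
  have "0 \<le> ?S" using assms(1) by (intro sum_nonneg) (auto simp: flow_def)
  then have "s * ?S \<le> ?S" using assms(3) mult_right_mono[of s 1 ?S] by simp
  then show "sum (\<lambda>p. s * w p) {p\<in>P. cube c p \<subseteq> cube c \<Lambda>} \<le> G (fst \<Lambda>)"
    using flow_cap[OF assms(1) \<Lambda>] by (simp flip: sum_distrib_left)
qed (use assms in \<open>auto simp: flow_def\<close>)

text \<open>The capacity of \<open>\<Lambda>\<close> is checked according to its position. If
  \<open>\<Lambda>\<close> lies in a cube of \<open>P\<close>, only the children of that cube count,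
  and their flow is already capped from that level on. Otherwise every child in
  \<open>\<Lambda>\<close> has its parent in \<open>\<Lambda>\<close>, and since children carry
  exactly the mass of their parent, the old bound applies.\<close>

lemma flow_refine:
  assumes c: "c > 0" and flow: "flow c G J P w"
    and split: "\<And>q. q \<in> P \<Longrightarrow> \<exists>R v. flow c G (fst q) R v \<and> sum v R = w q \<and>
     (\<forall>p\<in>R. fst q < fst p \<and> closure (cube c p) \<subseteq> cube c q \<and> cube c p \<subseteq> A)"
  shows "\<exists>P' w'. flow c G J P' w' \<and> sum w' P' = sum w P \<and>
    (\<forall>p'\<in>P'. cube c p' \<subseteq> A \<and> (\<exists>p\<in>P. fst p < fst p' \<and> closure (cube c p') \<subseteq> cube c p))"
proof -
  have fin: "finite P" and lev: "\<And>p. p \<in> P \<Longrightarrow> J \<le> fst p" and w0: "\<And>p. p \<in> P \<Longrightarrow> 0 \<le> w p"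
    and disj: "disjoint_cubes c P"
    and fl: "\<And>\<Lambda>. J \<le> fst \<Lambda> \<Longrightarrow> sum w {p\<in>P. cube c p \<subseteq> cube c \<Lambda>} \<le> G (fst \<Lambda>)"
    using flow flow_cap[OF flow] by (auto simp: flow_def)
  obtain R v where Rv: "\<And>q. q \<in> P \<Longrightarrow> flow c G (fst q) (R q) (v q) \<and> sum (v q) (R q) = w q \<and>
     (\<forall>p\<in>R q. fst q < fst p \<and> closure (cube c p) \<subseteq> cube c q \<and> cube c p \<subseteq> A)"
    using split by metis
  have Rsub: "cube c p' \<subseteq> cube c p" if "p \<in> P" "p' \<in> R p" for p p'
    using Rv[OF that(1)] that closure_subset by blast
  have uniq: "p = q" if "p \<in> P" "q \<in> P" "p' \<in> R p" "p'' \<in> R q" "cube c p' \<inter> cube c p'' \<noteq> {}" for p q p' p''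
    using disj Rsub[OF that(1,3)] Rsub[OF that(2,4)] that unfolding disjoint_cubes_def by blast
  have uniq1: "p = q" if "p \<in> P" "q \<in> P" "p' \<in> R p" "p' \<in> R q" for p q p'
    using uniq[OF that] cube_ne[OF c, of p'] by auto
  have disjR: "\<forall>p\<in>P. \<forall>q\<in>P. p \<noteq> q \<longrightarrow> R p \<inter> R q = {}"
    using uniq1 by blast
  define P' where "P' = (\<Union>p\<in>P. R p)"
  \<comment> \<open>Cubes are nonempty and parents disjoint, so a child determines its parent and
    the weights \<open>v q\<close> glue to one function.\<close>
  define par where "par p' = (THE p. p \<in> P \<and> p' \<in> R p)" for p'
  have par: "par p' = p" if "p \<in> P" "p' \<in> R p" for p p'
    unfolding par_def using uniq1 that by blast
  define w' where "w' p' = v (par p') p'" for p'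
  have w': "w' p' = v p p'" if "p \<in> P" "p' \<in> R p" for p p'
    using par[OF that] by (simp add: w'_def)
  have finR: "finite (R p)" if "p \<in> P" for p using Rv[OF that] by (auto simp: flow_def)
  have w'0: "0 \<le> w' p'" if p': "p' \<in> P'" for p'
  proof -
    obtain p where p: "p \<in> P" "p' \<in> R p" using p' unfolding P'_def by blast
    have "0 \<le> v p p'" using Rv[OF p(1)] p by (auto simp: flow_def)
    then show ?thesis using w'[OF p] by simp
  qed
  have sumR: "sum w' (R p) = w p" if "p \<in> P" for p
    using that w' Rv[OF that] by simp
  have "disjoint_cubes c P'"
  proof -
    { fix p1 p2 assume "p1 \<in> P'" "p2 \<in> P'" and ne: "cube c p1 \<inter> cube c p2 \<noteq> {}"
      then obtain q1 q2 where q: "q1 \<in> P" "p1 \<in> R q1" "q2 \<in> P" "p2 \<in> R q2" unfolding P'_def by auto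
      then have "q1 = q2" using uniq ne by blast
      then have "p1 = p2" using Rv[OF q(1)] q ne by (auto simp: flow_def disjoint_cubes_def) }
    then show ?thesis unfolding disjoint_cubes_def by blast
  qed
  moreover have "sum w' {p'\<in>P'. cube c p' \<subseteq> cube c \<Lambda>} \<le> G (fst \<Lambda>)" if \<Lambda>: "J \<le> fst \<Lambda>" for \<Lambda>
  proof (cases "\<exists>p\<in>P. fst p \<le> fst \<Lambda> \<and> cube c \<Lambda> \<subseteq> cube c p")
    case True
    then obtain p where p: "p \<in> P" "fst p \<le> fst \<Lambda>" "cube c \<Lambda> \<subseteq> cube c p" by blast
    have eq: "{p'\<in>P'. cube c p' \<subseteq> cube c \<Lambda>} = {p'\<in>R p. cube c p' \<subseteq> cube c \<Lambda>}" (is "?L = ?R")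
    proof
      show "?L \<subseteq> ?R"
      proof
        fix p' assume p': "p' \<in> ?L"
        then obtain q where q: "q \<in> P" "p' \<in> R q" by (auto simp: P'_def)
        have "cube c p' \<subseteq> cube c q \<inter> cube c p" using Rsub[OF q] p' p by auto
        then have "q = p" using disj cube_ne[OF c, of p'] p q unfolding disjoint_cubes_def by blast
        then show "p' \<in> ?R" using p' q by auto
      qed
    qed (use p in \<open>auto simp: P'_def\<close>)
    have "sum w' ?L = sum (v p) {p'\<in>R p. cube c p' \<subseteq> cube c \<Lambda>}"
      unfolding eq using w'[OF p(1)] by simp
    also have "\<dots> \<le> G (fst \<Lambda>)"
      using Rv[OF p(1)] p(2) by (blast intro: flow_cap)
    finally show ?thesis .
  next
    case False
    have "{p'\<in>P'. cube c p' \<subseteq> cube c \<Lambda>} \<subseteq> (\<Union>p\<in>{p\<in>P. cube c p \<subseteq> cube c \<Lambda>}. R p)"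
    proof
      fix p' assume p': "p' \<in> {p'\<in>P'. cube c p' \<subseteq> cube c \<Lambda>}"
      then obtain q where q: "q \<in> P" "p' \<in> R q" by (auto simp: P'_def)
      obtain x where "x \<in> cube c p'" using cube_ne[OF c, of p'] by blast
      then have x: "x \<in> cube c q" "x \<in> cube c \<Lambda>" using Rsub[OF q] p' by auto
      have "\<not> (fst q \<le> fst \<Lambda>)" using False q cube_nested[OF c _ x] by blast
      then have "cube c q \<subseteq> cube c \<Lambda>" using cube_nested[OF c _ x(2,1)] by simp
      then show "p' \<in> (\<Union>p\<in>{p\<in>P. cube c p \<subseteq> cube c \<Lambda>}. R p)" using q by blast
    qed
    note sub = this
    have "sum w' {p'\<in>P'. cube c p' \<subseteq> cube c \<Lambda>} \<le> sum w' (\<Union>p\<in>{p\<in>P. cube c p \<subseteq> cube c \<Lambda>}. R p)"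
    proof (rule sum_mono2[OF _ sub])
      show "finite (\<Union>p\<in>{p\<in>P. cube c p \<subseteq> cube c \<Lambda>}. R p)" using fin finR by simp
      show "0 \<le> w' b" if "b \<in> (\<Union>p\<in>{p\<in>P. cube c p \<subseteq> cube c \<Lambda>}. R p) - {p'\<in>P'. cube c p' \<subseteq> cube c \<Lambda>}" for b
        using that by (intro w'0) (unfold P'_def, blast)
    qed
    also have "\<dots> = (\<Sum>p\<in>{p\<in>P. cube c p \<subseteq> cube c \<Lambda>}. sum w' (R p))"
      using fin finR disjR by (intro sum.UNION_disjoint) simp_all
    also have "\<dots> = sum w {p\<in>P. cube c p \<subseteq> cube c \<Lambda>}" by (simp add: sumR)
    also have "\<dots> \<le> G (fst \<Lambda>)" by (rule fl[OF \<Lambda>])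
    finally show ?thesis .
  qed
  moreover have "J \<le> fst p'" if p': "p' \<in> P'" for p'
  proof -
    obtain p where p: "p \<in> P" "p' \<in> R p" using p' unfolding P'_def by blast
    then have "fst p < fst p'" using Rv[OF p(1)] by blast
    then show ?thesis using lev[OF p(1)] by simp
  qed
  ultimately have "flow c G J P' w'"
    unfolding flow_def using fin finR w'0 by (intro conjI ballI allI impI) (simp_all add: P'_def)
  moreover have "sum w' P' = sum w P"
  proof -
    have "sum w' P' = (\<Sum>p\<in>P. sum w' (R p))"
      unfolding P'_def using fin finR disjR by (intro sum.UNION_disjoint) simp_all
    then show ?thesis by (simp add: sumR)
  qed
  moreover have "\<forall>p'\<in>P'. cube c p' \<subseteq> A \<and> (\<exists>p\<in>P. fst p < fst p' \<and> closure (cube c p') \<subseteq> cube c p)"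
  proof
    fix p' assume p': "p' \<in> P'"
    obtain p where p: "p \<in> P" "p' \<in> R p" using p' unfolding P'_def by blast
    then show "cube c p' \<subseteq> A \<and> (\<exists>p\<in>P. fst p < fst p' \<and> closure (cube c p') \<subseteq> cube c p)"
      using Rv[OF p(1)] by blast
  qed
  ultimately show ?thesis by blast
qed

text \<open>A splitting moves the full capacity, whereas a cube of the flow may carry less. By
  \<open>flow_le\<close> the ratio \<open>w q / G (fst q)\<close> is at most 1, and scaling a flow
  down respects capacities.\<close>

lemma flow_refine_splittable:
  assumes c: "c > 0" and G: "\<And>j. J \<le> j \<Longrightarrow> 0 < G j"
    and A: "splittable c G J A" and flow: "flow c G J P w"
  shows "\<exists>P' w'. flow c G J P' w' \<and> sum w' P' = sum w P \<and>
    (\<forall>p'\<in>P'. cube c p' \<subseteq> A \<and> (\<exists>p\<in>P. fst p < fst p' \<and> closure (cube c p') \<subseteq> cube c p))"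
proof (rule flow_refine[OF c flow])
  fix q assume q: "q \<in> P"
  then have lev: "J \<le> fst q" and w0: "0 \<le> w q" using flow by (auto simp: flow_def)
  obtain R v where Rv: "flow c G (fst q) R v" "sum v R = G (fst q)"
    "\<forall>p\<in>R. fst q < fst p \<and> closure (cube c p) \<subseteq> cube c q \<and> cube c p \<subseteq> A"
    using A lev unfolding splittable_def by blast
  have "flow c G (fst q) R (\<lambda>p. w q / G (fst q) * v p)"
    using flow_le[OF flow q] G[OF lev] w0 by (intro flow_scale[OF Rv(1)]) auto
  moreover have "sum (\<lambda>p. w q / G (fst q) * v p) R = w q"
    using sum_distrib_left[of "w q / G (fst q)" v R] Rv(2) G[OF lev] by simp
  ultimately show "\<exists>R v. flow c G (fst q) R v \<and> sum v R = w q \<and>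
     (\<forall>p\<in>R. fst q < fst p \<and> closure (cube c p) \<subseteq> cube c q \<and> cube c p \<subseteq> A)"
    using Rv(3) by blast
qed

text \<open>The compactness argument replaces the increasing sets lemma for net measures: as closures of the
  cubes of one generation lie in cubes of the previous one, a cover of the limit set swallows
  every cube of some generation.\<close>

theorem flow_cover:
  fixes P :: "(nat \<times> (int ^ 'n)) set"
  assumes c: "c \<ge> 2" and G: "\<And>j. J \<le> j \<Longrightarrow> 0 < G j"
    and A: "\<And>k :: nat. splittable c G J (A k)" and flow: "flow c G J P w"
    and cover: "(\<Inter>k. A k) \<inter> (\<Union>p\<in>P. cube c p) \<subseteq> (\<Union>i. \<Lambda> i)"
    and \<Lambda>: "\<And>i. \<Lambda> i = {} \<or> (\<exists>p. J \<le> fst p \<and> \<Lambda> i = cube c p \<and> ennreal (G (fst p)) \<le> f i)"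
  shows "ennreal (sum w P) \<le> (\<Sum>i. f i)"
proof -
  have c0: "c > 0" using c by simp
  define ok where "ok S \<longleftrightarrow> flow c G J (fst S) (snd S) \<and> sum (snd S) (fst S) = sum w P"
    for S :: "(nat \<times> (int ^ 'n)) set \<times> (nat \<times> (int ^ 'n) \<Rightarrow> real)"
  define step where "step k S S' \<longleftrightarrow> (\<forall>p'\<in>fst S'. cube c p' \<subseteq> A k \<and>
    (\<exists>p\<in>fst S. fst p < fst p' \<and> closure (cube c p') \<subseteq> cube c p))"
    for k and S S' :: "(nat \<times> (int ^ 'n)) set \<times> (nat \<times> (int ^ 'n) \<Rightarrow> real)"
  \<comment> \<open>Generation \<open>k + 1\<close> is chosen inside \<open>A k\<close>, with the
    total weight unchanged.\<close>
  have "\<exists>S. \<forall>k. (ok (S k) \<and> (k = 0 \<longrightarrow> S k = (P, w))) \<and> step k (S k) (S (Suc k))"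
  proof (rule dependent_nat_choice)
    show "\<exists>S. ok S \<and> (0 = (0::nat) \<longrightarrow> S = (P, w))" using flow by (auto simp: ok_def)
  next
    fix S and k :: nat assume "ok S \<and> (k = 0 \<longrightarrow> S = (P, w))"
    then have fl: "flow c G J (fst S) (snd S)" "sum (snd S) (fst S) = sum w P" by (auto simp: ok_def)
    from flow_refine_splittable[OF c0 G A fl(1)] obtain P' w' where
      "flow c G J P' w'" "sum w' P' = sum (snd S) (fst S)" 
      "\<forall>p'\<in>P'. cube c p' \<subseteq> A k \<and> (\<exists>p\<in>fst S. fst p < fst p' \<and> closure (cube c p') \<subseteq> cube c p)" by blast
    then show "\<exists>S'. (ok S' \<and> (Suc k = 0 \<longrightarrow> S' = (P, w))) \<and> step k S S'"
      using fl by (intro exI[of _ "(P', w')"]) (auto simp: ok_def step_def)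
  qed
  then obtain S where S: "\<And>k. ok (S k)" "S 0 = (P, w)" "\<And>k. step k (S k) (S (Suc k))" by blast
  define Pk where "Pk k = fst (S k)" for k
  have P0: "Pk 0 = P" using S(2) by (simp add: Pk_def)
  have Pkfl: "flow c G J (Pk k) (snd (S k))" and Pksum: "sum (snd (S k)) (Pk k) = sum w P" for k
    using S(1)[of k] by (auto simp: ok_def Pk_def)
  have Pkfin: "finite (Pk k)" for k using Pkfl by (auto simp: flow_def)
  have PkA: "cube c p' \<subseteq> A k" if "p' \<in> Pk (Suc k)" for p' k
    using S(3)[of k] that by (auto simp: step_def Pk_def)
  have parent: "\<exists>p\<in>Pk k. fst p < fst p' \<and> closure (cube c p') \<subseteq> cube c p" if "p' \<in> Pk (Suc k)" for p' k
    using S(3)[of k] that by (auto simp: step_def Pk_def)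
  have lev: "k \<le> fst p" if "p \<in> Pk k" for p k
    using that
  proof (induction k arbitrary: p)
    case (Suc k)
    then show ?case using parent[OF Suc.prems] by fastforce
  qed simp
  have "\<exists>k. \<forall>p\<in>Pk k. \<exists>i. cube c p \<subseteq> \<Lambda> i"
  proof (rule ccontr)
    assume contra: "\<not> ?thesis"
    \<comment> \<open>\<open>B k\<close> collects the cubes of generation \<open>k\<close> contained
      in no single element of the cover. The parent of such a cube is again one, so the sets
      \<open>K k\<close> decrease and, if none is empty, have a common point.\<close>
    define B where "B k = {p\<in>Pk k. \<not> (\<exists>i. cube c p \<subseteq> \<Lambda> i)}" for k
    define K where "K k = (\<Union>p\<in>B k. closure (cube c p))" for k
    have Bp: "\<exists>p\<in>B k. closure (cube c p') \<subseteq> cube c p" if p': "p' \<in> B (Suc k)" for p' k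
    proof -
      obtain p where p: "p \<in> Pk k" "closure (cube c p') \<subseteq> cube c p"
        using parent[of p' k] p' by (auto simp: B_def)
      have "p \<in> B k"
        using p p' closure_subset[of "cube c p'"] unfolding B_def by blast
      then show ?thesis using p by blast
    qed
    have "compact (K k)" for k
      unfolding K_def B_def using Pkfin[of k] bounded_cube[OF c0]
      by (intro compact_UN) (auto simp: compact_closure)
    moreover have "K k \<noteq> {}" for k
    proof -
      obtain p where "p \<in> B k" using contra unfolding B_def by blast
      then show ?thesis
        unfolding K_def using cube_ne[OF c0, of p] closure_subset[of "cube c p"] by blast
    qed
    moreover have "K n \<subseteq> K m" if "m \<le> n" for m n
      using that
    proof (induction n rule: dec_induct)
      case (step k)
      have "K (Suc k) \<subseteq> K k"
      proof
        fix y assume "y \<in> K (Suc k)"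
        then obtain p' where p': "p' \<in> B (Suc k)" "y \<in> closure (cube c p')" unfolding K_def by blast
        obtain p where p: "p \<in> B k" "closure (cube c p') \<subseteq> cube c p" using Bp[OF p'(1)] by blast
        then have "y \<in> closure (cube c p)" using p'(2) closure_subset[of "cube c p"] by blast
        then show "y \<in> K k" unfolding K_def using p(1) by blast
      qed
      then show ?case using step by simp
    qed simp
    ultimately obtain x where x: "\<And>k. x \<in> K k"
      using compact_nest[of K] by (metis INT_E UNIV_I all_not_in_conv)
    \<comment> \<open>A point of the closure of a cube of generation \<open>k + 1\<close> lies in
      the half-open parent; the demand on closures in \<open>splittable\<close> serves this
      step.\<close>
    have xB: "\<exists>p\<in>B k. x \<in> cube c p" for k
      using x[of "Suc k"] Bp unfolding K_def by blast
    have "x \<in> A k" for k using xB[of "Suc k"] PkA by (auto simp: B_def)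
    moreover have "x \<in> (\<Union>p\<in>P. cube c p)" using xB[of 0] P0 by (auto simp: B_def)
    ultimately obtain i where i: "x \<in> \<Lambda> i" using cover by blast
    then obtain q where q: "\<Lambda> i = cube c q" using \<Lambda>[of i] by blast
    \<comment> \<open>Levels grow at least as fast as generations, so the cube of generation
      \<open>fst q\<close> around \<open>x\<close> is no coarser than \<open>cube c q\<close> and is
      swallowed by it.\<close>
    obtain p where p: "p \<in> B (fst q)" "x \<in> cube c p" using xB by blast
    have "cube c p \<subseteq> \<Lambda> i"
      unfolding q using p i q lev[of p "fst q"] by (intro cube_nested[OF c0]) (auto simp: B_def)
    then show False using p by (auto simp: B_def)
  qed
  then obtain k \<iota> where \<iota>: "\<And>p. p \<in> Pk k \<Longrightarrow> cube c p \<subseteq> \<Lambda> (\<iota> p)" by metis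
  \<comment> \<open>The weight of this generation is grouped by the covering element which swallows
    it; each group is at most the capacity, hence the cost, of its element.\<close>
  define v where "v = snd (S k)"
  have v0: "0 \<le> v p" if "p \<in> Pk k" for p using Pkfl[of k] that by (auto simp: flow_def v_def)
  have "ennreal (sum w P) = ennreal (\<Sum>i\<in>\<iota> ` Pk k. sum v {p\<in>Pk k. \<iota> p = i})"
    using Pksum[of k] sum.image_gen[OF Pkfin, of v k \<iota>] by (simp add: v_def)
  also have "\<dots> = (\<Sum>i\<in>\<iota> ` Pk k. ennreal (sum v {p\<in>Pk k. \<iota> p = i}))"
    using v0 by (intro sum_ennreal[symmetric] sum_nonneg) auto
  also have "\<dots> \<le> (\<Sum>i\<in>\<iota> ` Pk k. f i)"
  proof (rule sum_mono)
    fix i assume "i \<in> \<iota> ` Pk k"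
    then obtain p0 where p0: "p0 \<in> Pk k" "i = \<iota> p0" by blast
    then have "\<Lambda> i \<noteq> {}" using \<iota>[OF p0(1)] cube_ne[OF c0, of p0] by blast
    then obtain q where q: "J \<le> fst q" "\<Lambda> i = cube c q" "ennreal (G (fst q)) \<le> f i" using \<Lambda>[of i] by blast
    have "sum v {p\<in>Pk k. \<iota> p = i} \<le> sum v {p\<in>Pk k. cube c p \<subseteq> cube c q}"
    proof (rule sum_mono2)
      show "{p\<in>Pk k. \<iota> p = i} \<subseteq> {p\<in>Pk k. cube c p \<subseteq> cube c q}" using \<iota> q(2) by blast
    qed (use Pkfin v0 in simp_all)
    also have "\<dots> \<le> G (fst q)" using Pkfl[of k] q(1) unfolding v_def by (rule flow_cap)
    finally show "ennreal (sum v {p\<in>Pk k. \<iota> p = i}) \<le> f i" using q(3) by (meson ennreal_leI order_trans)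
  qed
  also have "\<dots> \<le> (\<Sum>i. f i)" using Pkfin by (intro sum_le_suminf) auto
  finally show ?thesis .
qed

section \<open>Net measures of relatively large sets\<close>

declare split_paired_All [simp del] split_paired_Ex [simp del]

text \<open>The threshold is a supremum which need not be attained, so monotonicity is available
  strictly below it. Positivity is given only near zero and is carried up to the threshold by
  monotonicity.\<close>

lemma
  assumes "g \<in> gauges N"
  shows gauge_threshold_pos: "0 < gauge_threshold N g"
    and gauge_threshold_le_1: "gauge_threshold N g \<le> 1"
    and gauge_mono: "0 \<le> r \<Longrightarrow> r \<le> r' \<Longrightarrow> r' < gauge_threshold N g \<Longrightarrow> g r \<le> g r'"
    and gauge_antimono: "0 < r \<Longrightarrow> r \<le> r' \<Longrightarrow> r' < gauge_threshold N g \<Longrightarrow> g r' / r' ^ N \<le> g r / r ^ N"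
    and gauge_pos: "0 < r \<Longrightarrow> r < gauge_threshold N g \<Longrightarrow> 0 < g r"
proof -
  define S where "S = {\<epsilon>. 0 < \<epsilon> \<and> \<epsilon> \<le> 1 \<and> mono_on {0..\<epsilon>} g \<and> antimono_on {0<..\<epsilon>} (\<lambda>r. g r / r ^ N)}"
  have thr: "gauge_threshold N g = Sup S" by (simp add: gauge_threshold_def S_def)
  obtain \<epsilon> where \<epsilon>: "\<epsilon> > 0" "mono_on {0..\<epsilon>} g" "\<forall>r\<in>{0<..\<epsilon>}. 0 < g r / r ^ N"
    "antimono_on {0<..\<epsilon>} (\<lambda>r. g r / r ^ N)"
    using assms unfolding gauges_def by blast
  have mem: "min \<epsilon> 1 \<in> S"
    unfolding S_def using \<epsilon>(1)
    by (auto intro: monotone_on_subset[OF \<epsilon>(2)] monotone_on_subset[OF \<epsilon>(4)])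
  have bdd: "bdd_above S" by (intro bdd_aboveI[of _ 1]) (auto simp: S_def)
  have "min \<epsilon> 1 \<le> Sup S" by (rule cSup_upper[OF mem bdd])
  then show pos: "0 < gauge_threshold N g" unfolding thr using \<epsilon>(1) by linarith
  show "gauge_threshold N g \<le> 1" unfolding thr using mem by (intro cSup_least) (auto simp: S_def)
  have ex: "\<exists>d\<in>S. r' < d" if "r' < gauge_threshold N g" for r'
    using that less_cSup_iff[OF _ bdd, of r'] mem unfolding thr by blast
  show mono: "g r \<le> g r'" if r: "0 \<le> r" "r \<le> r'" "r' < gauge_threshold N g" for r r'
  proof -
    obtain d where "d \<in> S" "r' < d" using ex[OF r(3)] by blast
    then show ?thesis using r(1,2) monotone_onD[of "{0..d}" "(\<le>)" "(\<le>)" g r r']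
      by (auto simp: S_def)
  qed
  show "g r' / r' ^ N \<le> g r / r ^ N" if r: "0 < r" "r \<le> r'" "r' < gauge_threshold N g" for r r'
  proof -
    obtain d where "d \<in> S" "r' < d" using ex[OF r(3)] by blast
    then show ?thesis using r(1,2) monotone_onD[of "{0<..d}" "(\<le>)" "(\<ge>)" "\<lambda>r. g r / r ^ N" r r']
      by (auto simp: S_def)
  qed
  show "0 < g r" if "0 < r" "r < gauge_threshold N g" for r
  proof -
    have "0 < g (min r \<epsilon>) / (min r \<epsilon>) ^ N" using \<epsilon> that by auto
    then have "0 < g (min r \<epsilon>)" using \<epsilon>(1) that(1) by (auto simp: zero_less_divide_iff)
    also have "\<dots> \<le> g r" using that \<epsilon>(1) by (intro mono) auto
    finally show ?thesis .
  qed
qed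

lemma gauge_zero: "g \<in> gauges N \<Longrightarrow> g 0 = 0"
  by (simp add: gauges_def)

section \<open>Gauges read along the levels of the tree\<close>

definition level_gauge :: "'n itself \<Rightarrow> nat \<Rightarrow> (real \<Rightarrow> real) \<Rightarrow> nat \<Rightarrow> real" where
  "level_gauge TYPE('n) c g j = g (sqrt (real CARD('n)) / real c ^ j)"

lemma diameter_tendsto_0:
  assumes "c \<ge> 2"
  shows "(\<lambda>j. sqrt (real n) / real c ^ j) \<longlonglongrightarrow> 0"
proof -
  have "(\<lambda>j. sqrt (real n) * (1 / real c) ^ j) \<longlonglongrightarrow> sqrt (real n) * 0"
    using assms by (intro tendsto_mult tendsto_const LIMSEQ_realpow_zero) auto
  then show ?thesis by (simp add: power_one_over field_simps)
qed

lemma ex_level_diameter: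
  assumes "c \<ge> 2" "0 < \<delta>"
  shows "\<exists>J. \<forall>j. sqrt (real CARD('n :: finite)) / real c ^ j < \<delta> \<longleftrightarrow> J \<le> j"
proof -
  define P where "P j \<longleftrightarrow> sqrt (real CARD('n)) / real c ^ j < \<delta>" for j
  have "\<exists>j. P j"
    using order_tendstoD(2)[OF diameter_tendsto_0[OF assms(1)] assms(2), of "CARD('n)"]
    unfolding P_def by (auto simp: eventually_sequentially)
  then have 1: "P (LEAST j. P j)" by (rule LeastI_ex)
  have "P j'" if "P j" "j \<le> j'" for j j'
  proof -
    have "sqrt (real CARD('n)) / real c ^ j' \<le> sqrt (real CARD('n)) / real c ^ j"
      using that(2) assms(1) by (intro divide_left_mono power_increasing) auto
    then show ?thesis using that(1) unfolding P_def by linarith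
  qed
  then have "P j \<longleftrightarrow> (LEAST j. P j) \<le> j" for j
    using 1 by (meson Least_le)
  then show ?thesis unfolding P_def by blast
qed

definition level_threshold :: "'n itself \<Rightarrow> nat \<Rightarrow> (real \<Rightarrow> real) \<Rightarrow> nat" where
  "level_threshold TYPE('n) c g =
    (SOME J. \<forall>j. sqrt (real CARD('n)) / real c ^ j < gauge_threshold CARD('n) g \<longleftrightarrow> J \<le> j)"

lemma level_threshold:
  fixes g :: "real \<Rightarrow> real"
  assumes "c \<ge> 2" "g \<in> gauges CARD('n :: finite)"
  shows "sqrt (real CARD('n)) / real c ^ j < gauge_threshold CARD('n) g \<longleftrightarrow>
    level_threshold TYPE('n) c g \<le> j"
  using someI_ex[OF ex_level_diameter[OF assms(1) gauge_threshold_pos[OF assms(2)], where 'n = 'n]]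
  unfolding level_threshold_def by blast

text \<open>The last claim rephrases that \<open>g r / r ^ n\<close> is nonincreasing: capacity per
  volume does not decrease with the level. This is why mass spread evenly inside a saturated cube
  violates no capacity.\<close>

lemma
  fixes g :: "real \<Rightarrow> real"
  assumes c: "c \<ge> 2" and g: "g \<in> gauges CARD('n :: finite)" and j: "level_threshold TYPE('n) c g \<le> j"
  shows level_gauge_pos: "0 < level_gauge TYPE('n) c g j"
    and level_gauge_antimono: "j \<le> j' \<Longrightarrow> level_gauge TYPE('n) c g j' \<le> level_gauge TYPE('n) c g j"
    and level_gauge_mono: "j \<le> j' \<Longrightarrow> level_gauge TYPE('n) c g j * real c ^ (j * CARD('n)) \<le>
       level_gauge TYPE('n) c g j' * real c ^ (j' * CARD('n))"
proof -
  let ?d = "\<lambda>j. sqrt (real CARD('n)) / real c ^ j"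
  have d: "0 < ?d j" for j using c by simp
  have thr: "?d j < gauge_threshold CARD('n) g" using level_threshold[OF c g] j by blast
  show "0 < level_gauge TYPE('n) c g j"
    unfolding level_gauge_def by (rule gauge_pos[OF g d thr])
  assume jj: "j \<le> j'"
  have dd: "?d j' \<le> ?d j" using jj c by (intro divide_left_mono power_increasing) auto
  show "level_gauge TYPE('n) c g j' \<le> level_gauge TYPE('n) c g j"
    unfolding level_gauge_def by (rule gauge_mono[OF g less_imp_le[OF d] dd thr])
  have "g (?d j) / ?d j ^ CARD('n) \<le> g (?d j') / ?d j' ^ CARD('n)"
    by (rule gauge_antimono[OF g d dd thr])
  then show "level_gauge TYPE('n) c g j * real c ^ (j * CARD('n)) \<le>
       level_gauge TYPE('n) c g j' * real c ^ (j' * CARD('n))"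
    unfolding level_gauge_def by (simp add: power_divide power_mult divide_le_cancel)
qed

lemma g_diameter_cube:
  assumes "c > 0"
  shows "g (diameter (cube c (p :: nat \<times> (int ^ 'n)))) = level_gauge TYPE('n) c g (fst p)"
  by (simp add: level_gauge_def diameter_cube[OF assms])

section \<open>Lower bounds for net measures of cubes and open sets\<close>

lemma net_cover_cube:
  fixes \<Lambda> :: "(real ^ 'n) set"
  assumes c: "c \<ge> 2" and g: "g \<in> gauges CARD('n)"
    and \<Lambda>: "\<Lambda> \<in> adic_cubes c" "diameter \<Lambda> < gauge_threshold CARD('n) g"
  shows "\<exists>p. level_threshold TYPE('n) c g \<le> fst p \<and> \<Lambda> = cube c p \<and>
    ennreal (level_gauge TYPE('n) c g (fst p)) = ennreal (g (diameter \<Lambda>))"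
proof -
  obtain p where p: "\<Lambda> = cube c p"
    using small_adic_cube[OF c \<Lambda>(1)] \<Lambda>(2) gauge_threshold_le_1[OF g] by auto
  have "level_threshold TYPE('n) c g \<le> fst p"
    using \<Lambda>(2) level_threshold[OF c g] c unfolding p by (simp add: diameter_cube)
  then show ?thesis using p g_diameter_cube[of c g p] c by auto
qed

lemma splittable_mono: "splittable c G J A \<Longrightarrow> J \<le> J' \<Longrightarrow> splittable c G J' A"
  unfolding splittable_def by (meson le_trans)

text \<open>The flow to start from is the single cube \<open>p\<close> with its own cost as weight;
  it respects capacities because coarser cubes cost at least as much. \<open>flow_cover\<close> then
  bounds every cover from below by that weight.\<close>

lemma net_measure_cube_ge:
  fixes p :: "nat \<times> (int ^ 'n)"
  assumes c: "c \<ge> 2" and g: "g \<in> gauges CARD('n)"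
    and A: "\<And>k :: nat. splittable c (level_gauge TYPE('n) c g) (level_threshold TYPE('n) c g) (A k)"
    and F: "(\<Inter>k. A k) \<subseteq> F" and p: "level_threshold TYPE('n) c g \<le> fst p"
  shows "ennreal (level_gauge TYPE('n) c g (fst p)) \<le> net_measure c g (F \<inter> cube c p)"
  unfolding net_measure_def
proof (rule Inf_greatest, safe)
  fix \<Lambda> :: "nat \<Rightarrow> (real ^ 'n) set"
  assume cover: "F \<inter> cube c p \<subseteq> (\<Union>i. \<Lambda> i)" and
    \<Lambda>: "\<forall>p. \<Lambda> p = {} \<or> (\<Lambda> p \<in> adic_cubes c \<and> diameter (\<Lambda> p) < gauge_threshold CARD('n) g)"
  let ?G = "level_gauge TYPE('n) c g" and ?J = "level_threshold TYPE('n) c g"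
  have fl: "flow c ?G ?J {p} (\<lambda>_. ?G (fst p))"
    unfolding flow_def
  proof (intro conjI allI impI)
    fix q :: "nat \<times> (int ^ 'n)" assume q: "?J \<le> fst q"
    show "sum (\<lambda>_. ?G (fst p)) {p' \<in> {p}. cube c p' \<subseteq> cube c q} \<le> ?G (fst q)"
    proof (cases "cube c p \<subseteq> cube c q")
      case True
      then have "{p' \<in> {p}. cube c p' \<subseteq> cube c q} = {p}" by auto
      then show ?thesis using level_gauge_antimono[OF c g q cube_subset_level[OF c True]] by simp
    next
      case False
      then have "{p' \<in> {p}. cube c p' \<subseteq> cube c q} = {}" by auto
      then show ?thesis using less_imp_le[OF level_gauge_pos[OF c g q]] by (simp only: sum.empty)
    qed
  qed (use p level_gauge_pos[OF c g p] in \<open>auto simp: disjoint_cubes_def\<close>)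
  have "ennreal (sum (\<lambda>_. ?G (fst p)) {p}) \<le> (\<Sum>i. ennreal (g (diameter (\<Lambda> i))))"
  proof (rule flow_cover[OF c level_gauge_pos[OF c g] A fl])
    show "\<Inter> (range A) \<inter> (\<Union>p\<in>{p}. cube c p) \<subseteq> \<Union> (range \<Lambda>)" using cover F by auto
    show "\<Lambda> i = {} \<or> (\<exists>p. ?J \<le> fst p \<and> \<Lambda> i = cube c p \<and> ennreal (?G (fst p)) \<le> ennreal (g (diameter (\<Lambda> i))))" for i
      using \<Lambda> net_cover_cube[OF c g, of "\<Lambda> i"] by (metis order_refl)
  qed
  then show "ennreal (?G (fst p)) \<le> (\<Sum>i. ennreal (g (diameter (\<Lambda> i))))" by simp
qed

lemma suminf_swap_ennreal: "(\<Sum>i. \<Sum>j. a i j) = (\<Sum>j. \<Sum>i. (a i j :: ennreal))"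
  using nn_integral_suminf[of "\<lambda>i j. a i j" "count_space UNIV"]
  by (simp add: nn_integral_count_space_nat)

lemma suminf_single_ennreal: "(\<Sum>p. if p = (q::nat) then a else (0::ennreal)) = a"
  by (subst suminf_finite[of "{q}"]) auto

lemma net_measure_le:
  assumes "F \<subseteq> (\<Union>p. \<Lambda> p)"
    and "\<And>p. \<Lambda> p = {} \<or> \<Lambda> p \<in> adic_cubes c \<and> diameter (\<Lambda> p) < gauge_threshold CARD('n) g"
  shows "net_measure c g (F :: (real ^ 'n) set) \<le> (\<Sum>p. ennreal (g (diameter (\<Lambda> p))))"
  unfolding net_measure_def using assms by (intro Inf_lower CollectI exI[of _ \<Lambda>]) blast

lemma net_measure_empty: "g \<in> gauges N \<Longrightarrow> net_measure c g ({} :: (real ^ 'n) set) = 0"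
  using net_measure_le[of "{}" "\<lambda>_. {}" c g] by (simp add: diameter_def gauge_zero)

lemma open_contains_cubes:
  fixes U :: "(real ^ 'n) set"
  assumes c: "c \<ge> 2" and U: "open U" "x \<in> U"
  shows "\<exists>J. \<forall>j\<ge>J. cube c (j, index c j x) \<subseteq> U"
proof -
  have c0: "c > 0" using c by simp
  obtain e where e: "e > 0" "ball x e \<subseteq> U" using U by (auto simp: open_contains_ball)
  obtain J where J: "\<And>j. sqrt (real CARD('n)) / real c ^ j < e \<longleftrightarrow> J \<le> j"
    using ex_level_diameter[OF c e(1), where 'n = 'n] by blast
  have "cube c (j, index c j x) \<subseteq> U" if j: "J \<le> j" for j
  proof
    fix y assume y: "y \<in> cube c (j, index c j x)"
    have "x \<in> cube c (j, index c j x)" by (simp add: mem_cube_index)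
    then have "dist x y \<le> diameter (cube c (j, index c j x))"
      using y by (intro diameter_bounded_bound bounded_cube c0)
    also have "\<dots> < e" using J j by (simp add: diameter_cube[OF c0])
    finally show "y \<in> U" using e by auto
  qed
  then show ?thesis by blast
qed

text \<open>In a cover of \<open>F \<inter> U\<close>, the cubes inside a maximal cube of \<open>U\<close> are traded for that maximal cube.\<close>

lemma net_measure_open_ge:
  fixes U :: "(real ^ 'n) set"
  assumes c: "c \<ge> 2" and g: "g \<in> gauges CARD('n)" and U: "open U"
    and F: "\<And>p :: nat \<times> (int ^ 'n). level_threshold TYPE('n) c g \<le> fst p \<Longrightarrow> cube c p \<subseteq> U \<Longrightarrow>
       ennreal (level_gauge TYPE('n) c g (fst p)) \<le> net_measure c g (F \<inter> cube c p)"
  shows "net_measure c g U \<le> net_measure c g (F \<inter> U)"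
proof -
  let ?G = "level_gauge TYPE('n) c g" and ?J = "level_threshold TYPE('n) c g"
  have c0: "c > 0" using c by simp
  \<comment> \<open>\<open>mx x\<close> is the largest cube of admissible level around
    \<open>x\<close> inside \<open>U\<close>. By \<open>mx_eq\<close> these maximal cubes partition
    \<open>U\<close>.\<close>
  define lv where "lv x = (LEAST j. ?J \<le> j \<and> cube c (j, index c j x) \<subseteq> U)" for x
  define mx where "mx x = (lv x, index c (lv x) x)" for x
  have lv: "?J \<le> lv x" "cube c (mx x) \<subseteq> U" if x: "x \<in> U" for x
  proof -
    obtain J' where J': "\<And>j. J' \<le> j \<Longrightarrow> cube c (j, index c j x) \<subseteq> U"
      using open_contains_cubes[OF c U x] by blast
    define j where "j = max ?J J'"
    have "?J \<le> j \<and> cube c (j, index c j x) \<subseteq> U" using J'[of j] by (simp add: j_def)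
    then have "?J \<le> lv x \<and> cube c (lv x, index c (lv x) x) \<subseteq> U"
      unfolding lv_def by (rule LeastI)
    then show "?J \<le> lv x" "cube c (mx x) \<subseteq> U" by (auto simp: mx_def)
  qed
  have in_mx: "x \<in> cube c (mx x)" for x by (simp add: mem_cube_index mx_def)
  have mx_eq: "mx y = mx x" if x: "x \<in> U" and y: "y \<in> cube c (mx x)" for x y
  proof -
    have yU: "y \<in> U" using lv(2)[OF x] y by blast
    have iy: "index c (lv x) y = index c (lv x) x" using y by (auto simp: mem_cube_index mx_def)
    have le: "lv y \<le> lv x"
      unfolding lv_def[of y] using lv[OF x] iy by (intro Least_le) (simp add: mx_def)
    have iy': "index c (lv y) y = index c (lv y) x"
      by (rule index_coarsen[OF c0 le iy])
    have "lv x \<le> lv y"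
      unfolding lv_def[of x] using lv[OF yU] iy' by (intro Least_le) (simp add: mx_def)
    then show ?thesis using le iy by (simp add: mx_def)
  qed
  show ?thesis
    unfolding net_measure_def[of c g "F \<inter> U"]
  proof (rule Inf_greatest, safe)
    fix \<Lambda> :: "nat \<Rightarrow> (real ^ 'n) set"
    assume cover: "F \<inter> U \<subseteq> (\<Union>i. \<Lambda> i)" and
      \<Lambda>: "\<forall>p. \<Lambda> p = {} \<or> (\<Lambda> p \<in> adic_cubes c \<and> diameter (\<Lambda> p) < gauge_threshold CARD('n) g)"
    define f where "f i = ennreal (g (diameter (\<Lambda> i)))" for i
    have \<Lambda>c: "\<exists>p. ?J \<le> fst p \<and> \<Lambda> i = cube c p \<and> ennreal (?G (fst p)) = f i" if "\<Lambda> i \<noteq> {}" for i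
      using \<Lambda> that net_cover_cube[OF c g, of "\<Lambda> i"] by (auto simp: f_def)
    \<comment> \<open>Elements of the cover inside a maximal cube satisfy \<open>inn\<close>, and
      \<open>q\<close> names that cube; all others are kept as they are. \<open>big p\<close> says
      that a kept element already contains \<open>p\<close>.\<close>
    define inn where "inn i \<longleftrightarrow> \<Lambda> i \<noteq> {} \<and> (\<exists>x\<in>U. \<Lambda> i \<subseteq> cube c (mx x))" for i
    define q where "q i = mx (SOME y. y \<in> \<Lambda> i)" for i
    have q: "q i = mx x" if "inn i" "x \<in> U" "\<Lambda> i \<subseteq> cube c (mx x)" for i x
    proof -
      have "(SOME y. y \<in> \<Lambda> i) \<in> \<Lambda> i" using that(1) by (intro some_in_eq[THEN iffD2]) (simp add: inn_def)
      then show ?thesis unfolding q_def using that by (intro mx_eq) auto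
    qed
    define big where "big p \<longleftrightarrow> (\<exists>i. \<not> inn i \<and> cube c p \<subseteq> \<Lambda> i)" for p
    \<comment> \<open>\<open>\<phi>\<close> picks one index for each maximal cube, so that the new
      cover \<open>M\<close> lists this cube once and drops all other inner elements.\<close>
    define \<phi> where "\<phi> i = (if inn i then (LEAST k. inn k \<and> q k = q i) else i)" for i
    define M where "M i = (if \<not> inn i then \<Lambda> i else if big (q i) \<or> \<phi> i \<noteq> i then {} else cube c (q i))" for i
    have \<phi>: "inn (\<phi> i)" "q (\<phi> i) = q i" "\<phi> (\<phi> i) = \<phi> i" if "inn i" for i
    proof -
      have "inn (\<phi> i) \<and> q (\<phi> i) = q i"
        unfolding \<phi>_def using that by (simp, intro LeastI[of "\<lambda>k. inn k \<and> q k = q i" i]) simp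
      then show "inn (\<phi> i)" "q (\<phi> i) = q i" "\<phi> (\<phi> i) = \<phi> i"
        using that by (auto simp: \<phi>_def)
    qed
    have qU: "\<exists>x\<in>U. q i = mx x \<and> \<Lambda> i \<subseteq> cube c (mx x)" if "inn i" for i
    proof -
      obtain x where x: "x \<in> U" "\<Lambda> i \<subseteq> cube c (mx x)" using \<open>inn i\<close> by (auto simp: inn_def)
      then show ?thesis using q[OF that x] by blast
    qed
    have Gmx: "0 < ennreal (?G (fst (mx x)))" if "x \<in> U" for x
      using level_gauge_pos[OF c g] lv(1)[OF that] by (simp add: mx_def)
    have Mcover: "U \<subseteq> (\<Union>i. M i)"
    proof
      fix x assume x: "x \<in> U"
      show "x \<in> (\<Union>i. M i)"
      proof (cases "big (mx x)")
        case True
        then obtain i where "\<not> inn i" "cube c (mx x) \<subseteq> \<Lambda> i" by (auto simp: big_def)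
        then show ?thesis using in_mx[of x] by (auto simp: M_def)
      next
        case False
        \<comment> \<open>An empty intersection would have net measure zero, against the hypothesis
          on \<open>F\<close>. So some element of the cover meets the maximal cube, and nesting
          leaves two positions for it.\<close>
        have "F \<inter> cube c (mx x) \<noteq> {}"
        proof
          assume e: "F \<inter> cube c (mx x) = {}"
          have "ennreal (?G (fst (mx x))) \<le> 0"
            using F[of "mx x"] lv[OF x] net_measure_empty[OF g, of c, where 'n = 'n] e by (simp add: mx_def)
          then show False using Gmx[OF x] by simp
        qed
        then obtain z where z: "z \<in> F" "z \<in> cube c (mx x)" by blast
        then obtain i where i: "z \<in> \<Lambda> i" using cover lv(2)[OF x] by blast
        obtain p where p: "\<Lambda> i = cube c p" using \<Lambda>c[of i] i by blast
        have sub: "inn i \<and> q i = mx x"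
        proof (cases "fst (mx x) \<le> fst p")
          case True
          then have "\<Lambda> i \<subseteq> cube c (mx x)" using cube_nested[OF c0 True z(2)] i p by simp
          then have "inn i" using x i by (auto simp: inn_def)
          then show ?thesis using q \<open>\<Lambda> i \<subseteq> cube c (mx x)\<close> x by blast
        next
          case False
          then have s: "cube c (mx x) \<subseteq> \<Lambda> i"
            using cube_nested[OF c0, of p "mx x" z] i z p by simp
          then have inn: "inn i" using \<open>\<not> big (mx x)\<close> by (auto simp: big_def)
          then obtain y where y: "y \<in> U" "q i = mx y" "\<Lambda> i \<subseteq> cube c (mx y)" using qU by blast
          then have "mx x = mx y" using s in_mx[of x] by (intro mx_eq) auto
          then show ?thesis using inn y by simp
        qed
        then have "M (\<phi> i) = cube c (mx x)"
          using \<phi>[of i] False by (simp add: M_def)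
        then show ?thesis using in_mx[of x] by blast
      qed
    qed
    have Mcube: "M i = {} \<or> (M i \<in> adic_cubes c \<and> diameter (M i) < gauge_threshold CARD('n) g)" for i
    proof (cases "inn i \<and> \<not> big (q i) \<and> \<phi> i = i")
      case True
      then obtain x where "x \<in> U" "q i = mx x" using qU by blast
      then have "?J \<le> fst (q i)" using lv by (simp add: mx_def)
      then have "diameter (cube c (q i)) < gauge_threshold CARD('n) g"
        using level_threshold[OF c g] by (simp add: diameter_cube[OF c0])
      then show ?thesis using True cube_adic[OF c0, of "q i"] by (simp add: M_def)
    next
      case False
      then show ?thesis using \<Lambda> by (auto simp: M_def)
    qed
    \<comment> \<open>The cost of element \<open>k\<close> is charged to its representative
      \<open>\<phi> k\<close>. Summing over \<open>k\<close> dominates the cost of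
      \<open>M i\<close>, while summing over \<open>i\<close> first gives back the cost of the given
      cover.\<close>
    define a where "a i k = (if i = \<phi> k then f k else 0)" for i k
    have "ennreal (g (diameter (M i))) \<le> (\<Sum>k. a i k)" for i
    proof (cases "inn i")
      case False
      then have "ennreal (g (diameter (M i))) = a i i" by (simp add: M_def a_def \<phi>_def f_def)
      also have "\<dots> = sum (a i) {i}" by simp
      also have "\<dots> \<le> (\<Sum>k. a i k)" by (intro sum_le_suminf) auto
      finally show ?thesis .
    next
      case inn: True
      show ?thesis
      proof (cases "big (q i) \<or> \<phi> i \<noteq> i")
        case True
        then show ?thesis using inn gauge_zero[OF g] by (simp add: M_def diameter_def)
      next
        case False
        obtain x where x: "x \<in> U" "q i = mx x" using qU inn by blast
        \<comment> \<open>As no kept element swallows this maximal cube, the inner elements assigned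
          to it cover the part of \<open>F\<close> in it by themselves.\<close>
        define N where "N k = (if inn k \<and> q k = q i then \<Lambda> k else {})" for k
        have "F \<inter> cube c (mx x) \<subseteq> (\<Union>k. N k)"
        proof
          fix z assume z: "z \<in> F \<inter> cube c (mx x)"
          then obtain k where k: "z \<in> \<Lambda> k" using cover lv(2)[OF x(1)] by blast
          obtain p where p: "\<Lambda> k = cube c p" using \<Lambda>c[of k] k by blast
          have "inn k \<and> q k = mx x"
          proof (cases "fst (mx x) \<le> fst p")
            case True
            then have s: "\<Lambda> k \<subseteq> cube c (mx x)" using cube_nested[OF c0 True, of z] z k p by simp
            then have "inn k" using x k by (auto simp: inn_def)
            then show ?thesis using q s x by blast
          next
            case lt: False
            then have s: "cube c (mx x) \<subseteq> \<Lambda> k"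
              using cube_nested[OF c0, of p "mx x" z] k z p by simp
            then have innk: "inn k" using False x by (auto simp: big_def)
            then obtain y where y: "y \<in> U" "q k = mx y" "\<Lambda> k \<subseteq> cube c (mx y)" using qU by blast
            then have "mx x = mx y" using s in_mx[of x] by (intro mx_eq) auto
            then show ?thesis using innk y by simp
          qed
          then show "z \<in> (\<Union>k. N k)" using k x by (auto simp: N_def)
        qed
        moreover have "N k = {} \<or> (N k \<in> adic_cubes c \<and> diameter (N k) < gauge_threshold CARD('n) g)" for k
          using \<Lambda> by (auto simp: N_def)
        ultimately have "net_measure c g (F \<inter> cube c (mx x)) \<le> (\<Sum>k. ennreal (g (diameter (N k))))"
          by (intro net_measure_le) blast+
        also have "\<dots> \<le> (\<Sum>k. a i k)"
        proof (intro suminf_le)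
          fix k
          show "ennreal (g (diameter (N k))) \<le> a i k"
          proof (cases "inn k \<and> q k = q i")
            case True
            then have "\<phi> k = \<phi> i" using inn by (simp add: \<phi>_def)
            then show ?thesis using True False by (simp add: N_def a_def f_def)
          next
            case False
            then have "N k = {}" by (auto simp: N_def)
            then show ?thesis using gauge_zero[OF g] by (simp add: diameter_def)
          qed
        qed auto
        finally have "net_measure c g (F \<inter> cube c (mx x)) \<le> (\<Sum>k. a i k)" .
        moreover have "ennreal (g (diameter (M i))) \<le> net_measure c g (F \<inter> cube c (mx x))"
          using F[of "mx x"] lv[OF x(1)] inn False x(2) g_diameter_cube[OF c0, of g "mx x"]
          by (simp add: M_def mx_def)
        ultimately show ?thesis by (rule order_trans[rotated])
      qed
    qed
    then have "(\<Sum>i. ennreal (g (diameter (M i)))) \<le> (\<Sum>i. \<Sum>k. a i k)"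
      by (intro suminf_le) auto
    also have "\<dots> = (\<Sum>k. \<Sum>i. a i k)" by (rule suminf_swap_ennreal)
    also have "\<dots> = (\<Sum>k. f k)" unfolding a_def suminf_single_ennreal ..
    finally have "(\<Sum>i. ennreal (g (diameter (M i)))) \<le> (\<Sum>k. f k)" .
    moreover have "net_measure c g U \<le> (\<Sum>i. ennreal (g (diameter (M i))))"
      using Mcover Mcube by (intro net_measure_le)
    ultimately show "net_measure c g U \<le> (\<Sum>i. ennreal (g (diameter (\<Lambda> i))))"
      unfolding f_def by (rule order_trans[rotated])
  qed
qed

lemma net_measure_mono: "A \<subseteq> B \<Longrightarrow> net_measure c g A \<le> net_measure c g B"
  unfolding net_measure_def by (intro Inf_superset_mono) blast

section \<open>Hyperplanes close to the centres of cubes\<close>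

lemma inner_of_int_vec: "of_int_vec q \<bullet> x = (\<Sum>i\<in>UNIV. real_of_int (q $ i) * x $ i)"
  by (simp add: inner_vec_def of_int_vec_def)

text \<open>Pigeonhole: the products of \<open>x\<close> with the \<open>(N + 1) ^ n\<close> vectors
  with entries in \<open>{0..N}\<close> lie in an interval of length \<open>N ^ n * w\<close>, so
  two of them fall into the same subinterval of length \<open>w\<close>. The right endpoint needs
  one more pigeonhole, and \<open>N ^ n + 1 < (N + 1) ^ n\<close> because
  \<open>n \<ge> 2\<close>.\<close>

lemma dirichlet:
  fixes x :: "real ^ 'n"
  assumes n: "CARD('n) \<ge> 2" and N: "N \<ge> 1" and B: "B > 0" "\<And>i. \<bar>x $ i\<bar> \<le> B"
  shows "\<exists>q :: int ^ 'n. q \<noteq> 0 \<and> (\<forall>i. \<bar>q $ i\<bar> \<le> int N) \<and>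
    \<bar>of_int_vec q \<bullet> x\<bar> \<le> 2 * real CARD('n) * B / real N ^ (CARD('n) - 1)"
proof -
  let ?n = "CARD('n)"
  define K where "K = {k :: int ^ 'n. \<forall>i. k $ i \<in> {0..int N}}"
  define w where "w = 2 * real ?n * B / real N ^ (?n - 1)"
  define f where "f k = of_int_vec k \<bullet> x" for k
  have w: "w > 0" using B N by (simp add: w_def)
  have N1: "nat (int N + 1) = N + 1" by simp
  have K: "finite K" "card K = (N + 1) ^ ?n"
    unfolding K_def using N1 by (auto intro: card_vec_box(2) simp: card_vec_box(1) simp del: atLeastAtMost_iff)
  have bound: "\<bar>f k\<bar> \<le> real ?n * B * real N" if "k \<in> K" for k
  proof -
    have "\<bar>f k\<bar> \<le> (\<Sum>i\<in>UNIV. \<bar>real_of_int (k $ i) * x $ i\<bar>)"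
      unfolding f_def inner_of_int_vec by (rule sum_abs)
    also have "\<dots> \<le> (\<Sum>i\<in>(UNIV :: 'n set). real N * B)"
    proof (rule sum_mono)
      fix i
      have "0 \<le> k $ i" "k $ i \<le> int N" using that by (auto simp: K_def)
      then have "\<bar>real_of_int (k $ i)\<bar> \<le> real N" by linarith
      then show "\<bar>real_of_int (k $ i) * x $ i\<bar> \<le> real N * B"
        unfolding abs_mult using B(2)[of i] by (intro mult_mono) auto
    qed
    finally show ?thesis by (simp add: mult_ac)
  qed
  define \<phi> where "\<phi> k = \<lfloor>(f k + real ?n * B * real N) / w\<rfloor>" for k
  have Nn: "real N ^ ?n = real N * real N ^ (?n - 1)"
    using n by (simp add: power_eq_if)
  have "\<phi> ` K \<subseteq> {0..int (N ^ ?n)}"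
  proof
    fix z assume "z \<in> \<phi> ` K"
    then obtain k where k: "k \<in> K" "z = \<phi> k" by blast
    have 0: "0 \<le> (f k + real ?n * B * real N) / w" using bound[OF k(1)] w by simp
    have "f k + real ?n * B * real N \<le> 2 * real ?n * B * real N" using bound[OF k(1)] by linarith
    also have "\<dots> = real N ^ ?n * w" using N by (simp add: w_def Nn)
    finally have 1: "(f k + real ?n * B * real N) / w \<le> real N ^ ?n" using w by (simp add: pos_divide_le_eq)
    have "real_of_int z \<le> real_of_int (int (N ^ ?n))"
    proof -
      have "real_of_int (int (N ^ ?n)) = real N ^ ?n" by simp
      then show ?thesis
        using of_int_floor_le[of "(f k + real ?n * B * real N) / w"] 1 unfolding k(2) \<phi>_def by linarith
    qed
    then have "z \<le> int (N ^ ?n)" by (rule of_int_le_iff[THEN iffD1])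
    moreover have "0 \<le> z" using 0 unfolding k(2) \<phi>_def by simp
    ultimately show "z \<in> {0..int (N ^ ?n)}" by simp
  qed
  then have "card (\<phi> ` K) \<le> N ^ ?n + 1"
    using card_mono[of "{0..int (N ^ ?n)}" "\<phi> ` K"] by (simp add: nat_add_distrib del: of_nat_power)
  also have "\<dots> < (N + 1) ^ ?n"
  proof -
    have "N ^ (?n - 1) + 1 \<le> (N + 1) ^ (?n - 1)"
      using power_strict_mono[of N "N + 1" "?n - 1"] n by simp
    then have "(N + 1) * (N ^ (?n - 1) + 1) \<le> (N + 1) * (N + 1) ^ (?n - 1)" by (rule mult_left_mono) simp
    also have "\<dots> = (N + 1) ^ ?n" using n by (simp add: power_eq_if)
    finally have "(N + 1) * (N ^ (?n - 1) + 1) \<le> (N + 1) ^ ?n" .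
    moreover have "(N + 1) * (N ^ (?n - 1) + 1) = N ^ ?n + N ^ (?n - 1) + N + 1"
      using n by (simp add: power_eq_if[of N ?n] algebra_simps)
    ultimately show ?thesis using N by linarith
  qed
  finally have "\<not> inj_on \<phi> K" using K by (intro pigeonhole) simp
  then obtain k k' where kk: "k \<in> K" "k' \<in> K" "\<phi> k = \<phi> k'" "k \<noteq> k'" by (auto simp: inj_on_def)
  have "\<bar>(f k + real ?n * B * real N) / w - (f k' + real ?n * B * real N) / w\<bar> < 1"
    using kk(3) unfolding \<phi>_def by linarith
  then have "\<bar>(f k - f k') / w\<bar> < 1" by (simp add: add_divide_distrib diff_divide_distrib)
  then have "\<bar>f k - f k'\<bar> \<le> w" using w by (simp add: abs_divide)
  moreover have "of_int_vec (k - k') \<bullet> x = f k - f k'"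
    unfolding f_def inner_of_int_vec by (simp add: left_diff_distrib sum_subtractf)
  moreover have "\<bar>(k - k') $ i\<bar> \<le> int N" for i
  proof -
    have "k $ i \<in> {0..int N}" "k' $ i \<in> {0..int N}" using kk by (auto simp: K_def)
    then show ?thesis by auto
  qed
  ultimately show ?thesis using kk(4) unfolding w_def by (intro exI[of _ "k - k'"]) auto
qed

section \<open>Counting cubes whose centres lie in a slab\<close>

lemma card_int_slab:
  fixes a b A :: real
  assumes "b \<noteq> 0" "A \<ge> 0"
  shows "finite {z :: int. \<bar>a + b * real_of_int z\<bar> \<le> A}"
    and "real (card {z :: int. \<bar>a + b * real_of_int z\<bar> \<le> A}) \<le> 2 * A / \<bar>b\<bar> + 1"
proof -
  define u where "u = - a / b"
  define r where "r = A / \<bar>b\<bar>"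
  have sub: "{z :: int. \<bar>a + b * real_of_int z\<bar> \<le> A} \<subseteq> {\<lceil>u - r\<rceil>..\<lfloor>u + r\<rfloor>}"
  proof
    fix z assume "z \<in> {z :: int. \<bar>a + b * real_of_int z\<bar> \<le> A}"
    then have "\<bar>b\<bar> * \<bar>real_of_int z - u\<bar> \<le> A"
      using assms(1) by (simp add: u_def flip: abs_mult) (simp add: algebra_simps)
    then have "\<bar>real_of_int z - u\<bar> \<le> r" using assms(1) by (simp add: r_def field_simps)
    then show "z \<in> {\<lceil>u - r\<rceil>..\<lfloor>u + r\<rfloor>}" by (auto simp: ceiling_le_iff le_floor_iff)
  qed
  then show "finite {z :: int. \<bar>a + b * real_of_int z\<bar> \<le> A}" by (rule finite_subset) simp
  have "card {z :: int. \<bar>a + b * real_of_int z\<bar> \<le> A} \<le> nat (\<lfloor>u + r\<rfloor> - \<lceil>u - r\<rceil> + 1)"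
    using card_mono[OF _ sub] by simp
  also have "real (nat (\<lfloor>u + r\<rfloor> - \<lceil>u - r\<rceil> + 1)) \<le> 2 * r + 1"
  proof -
    have "r \<ge> 0" using assms by (simp add: r_def)
    then show ?thesis by linarith
  qed
  finally show "real (card {z :: int. \<bar>a + b * real_of_int z\<bar> \<le> A}) \<le> 2 * A / \<bar>b\<bar> + 1"
    by (simp add: r_def)
qed

definition center :: "nat \<Rightarrow> nat \<times> (int ^ 'n) \<Rightarrow> real ^ 'n" where
  "center c p = (\<chi> i. (real_of_int (snd p $ i) + 1 / 2) / real c ^ fst p)"

lemma center_close:
  assumes "c > 0" "x \<in> closure (cube c p)"
  shows "\<bar>x $ i - center c p $ i\<bar> \<le> 1 / (2 * real c ^ fst p)"
proof -
  obtain j \<kappa> where p: "p = (j, \<kappa>)" by (cases p)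
  have c: "real c ^ j > 0" using assms(1) by simp
  have "real_of_int (\<kappa> $ i) \<le> real c ^ j * x $ i" "real c ^ j * x $ i \<le> real_of_int (\<kappa> $ i) + 1"
    using closure_cube_le[OF assms(1), of x j \<kappa> i] assms(2) c unfolding p by (auto simp: field_simps)
  then have "\<bar>real c ^ j * x $ i - (real_of_int (\<kappa> $ i) + 1 / 2)\<bar> \<le> 1 / 2" by linarith
  moreover have "x $ i - center c p $ i = (real c ^ j * x $ i - (real_of_int (\<kappa> $ i) + 1 / 2)) / real c ^ j"
    using c unfolding center_def p by (simp add: field_simps)
  ultimately have "\<bar>x $ i - center c p $ i\<bar> \<le> (1 / 2) / real c ^ j"
    using c by (simp add: abs_divide divide_le_cancel del: divide_divide_eq_left)
  then show ?thesis by (simp add: p)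
qed

lemma center_mem:
  assumes "c > 0"
  shows "center c p \<in> cube c p"
proof (cases p)
  case (Pair j \<kappa>)
  have "real c ^ j * center c p $ i = real_of_int (\<kappa> $ i) + 1 / 2" for i
    using assms by (simp add: center_def Pair)
  then show ?thesis by (simp add: Pair mem_cube floor_eq_iff)
qed

lemma prod_if_UNIV:
  fixes i :: "'n :: finite" and a b :: nat
  shows "(\<Prod>l\<in>UNIV. if l = i then a else b) = a * b ^ (CARD('n) - 1)"
proof -
  have "(\<Prod>l\<in>UNIV. if l = i then a else b) = a * (\<Prod>l\<in>UNIV - {i}. if l = i then a else b)"
    by (subst prod.remove[of _ i]) auto
  also have "(\<Prod>l\<in>UNIV - {i}. if l = i then a else b) = (\<Prod>l\<in>UNIV - {i}. b)"
    by (rule prod.cong) auto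
  finally show ?thesis by (simp add: card_Diff_singleton)
qed

text \<open>Columns in direction \<open>i\<close> are indexed by vectors whose coordinate
  \<open>i\<close> is frozen at 0; this stands for the passage to dimension
  \<open>n - 1\<close>.\<close>

lemma card_vec_box_slice:
  fixes i :: "'n :: finite" and S :: "'n \<Rightarrow> int set"
  assumes "\<And>l. finite (S l)" "\<And>l. l \<noteq> i \<Longrightarrow> card (S l) = m"
  shows "card {v :: int ^ 'n. \<forall>l. v $ l \<in> (if l = i then {0} else S l)} = m ^ (CARD('n) - 1)"
    and "finite {v :: int ^ 'n. \<forall>l. v $ l \<in> (if l = i then {0} else S l)}"
proof -
  have *: "finite (if l = i then {0} else S l)" for l using assms(1) by simp
  have "card {v :: int ^ 'n. \<forall>l. v $ l \<in> (if l = i then {0} else S l)} =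
      (\<Prod>l\<in>UNIV. card (if l = i then {0} else S l))"
    by (rule card_vec_box(1)[OF *])
  also have "\<dots> = (\<Prod>l\<in>UNIV. if l = i then 1 else m)"
    using assms(2) by (intro prod.cong) auto
  finally show "card {v :: int ^ 'n. \<forall>l. v $ l \<in> (if l = i then {0} else S l)} = m ^ (CARD('n) - 1)"
    by (simp add: prod_if_UNIV)
  show "finite {v :: int ^ 'n. \<forall>l. v $ l \<in> (if l = i then {0} else S l)}"
    by (rule card_vec_box(2)[OF *])
qed

text \<open>Along a column in direction \<open>i\<close> the product of \<open>q\<close> with the
  centre moves in steps of \<open>q $ i / c ^ j\<close>, so a column meets the slab in at most
  \<open>2 * A * c ^ j / \<bar>q $ i\<bar> + 1\<close> centres. The estimate is strongest when
  \<open>i\<close> is a largest coordinate of \<open>q\<close>.\<close>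

lemma slab_count:
  fixes p :: "nat \<times> (int ^ 'n)" and q :: "int ^ 'n"
  assumes c: "c > 0" and j: "fst p \<le> j" and q: "q $ i \<noteq> 0" and A: "A \<ge> 0"
  shows "real (card {D \<in> subcubes c p j. \<bar>of_int_vec q \<bullet> center c D\<bar> \<le> A}) \<le>
    (real c ^ (j - fst p)) ^ (CARD('n) - 1) * (2 * A * real c ^ j / \<bar>real_of_int (q $ i)\<bar> + 1)"
proof -
  obtain J \<kappa> where p: "p = (J, \<kappa>)" by (cases p)
  define X where "X = int c ^ (j - J)"
  define S where "S l = {\<kappa> $ l * X ..< (\<kappa> $ l + 1) * X}" for l
  define V where "V = {v :: int ^ 'n. \<forall>l. v $ l \<in> (if l = i then {0} else S l)}"
  define T where "T = {D \<in> subcubes c p j. \<bar>of_int_vec q \<bullet> center c D\<bar> \<le> A}"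
  define up where "up v z = (\<chi> l. if l = i then z else v $ l)" for v :: "int ^ 'n" and z
  define Z where "Z v = {z. \<bar>of_int_vec q \<bullet> center c (j, up v z)\<bar> \<le> A}" for v
  have cS: "card (S l) = c ^ (j - J)" for l
    unfolding S_def X_def by (simp add: algebra_simps flip: of_nat_power)
  have V: "finite V" "card V = (c ^ (j - J)) ^ (CARD('n) - 1)"
    unfolding V_def using cS by (intro card_vec_box_slice; simp add: S_def)+
  have sub: "subcubes c p j = Pair j ` {v. \<forall>l. v $ l \<in> S l}"
    unfolding p S_def X_def using c j p by (intro subcubes_eq) auto
  have Z: "finite (Z v) \<and> real (card (Z v)) \<le> 2 * A * real c ^ j / \<bar>real_of_int (q $ i)\<bar> + 1" for v
  proof -
    define b where "b = real_of_int (q $ i) / real c ^ j"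
    define a where "a = of_int_vec q \<bullet> center c (j, up v 0)"
    have b: "b \<noteq> 0" using q c by (simp add: b_def)
    have "of_int_vec q \<bullet> center c (j, up v z) = a + b * real_of_int z" for z
    proof -
      have "center c (j, up v z) = center c (j, up v 0) + (real_of_int z / real c ^ j) *\<^sub>R axis i 1"
        by (auto simp: center_def up_def vec_eq_iff axis_def add_divide_distrib)
      then show ?thesis
        by (simp add: inner_add_right a_def b_def inner_axis of_int_vec_def)
    qed
    then have Zeq: "Z v = {z. \<bar>a + b * real_of_int z\<bar> \<le> A}" by (simp add: Z_def)
    have "2 * A / \<bar>b\<bar> = 2 * A * real c ^ j / \<bar>real_of_int (q $ i)\<bar>"
      using c by (simp add: b_def abs_divide)
    then show ?thesis unfolding Zeq using card_int_slab[OF b A, of a] by simp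
  qed
  have "T \<subseteq> (\<Union>v\<in>V. (\<lambda>z. (j, up v z)) ` Z v)"
  proof
    fix D assume D: "D \<in> T"
    then obtain v where v: "D = (j, v)" "\<And>l. v $ l \<in> S l" unfolding T_def sub by auto
    have v': "v = up (\<chi> l. if l = i then 0 else v $ l) (v $ i)" by (simp add: up_def vec_eq_iff)
    have "(\<chi> l. if l = i then 0 else v $ l) \<in> V" using v(2) by (simp add: V_def)
    moreover have "v $ i \<in> Z (\<chi> l. if l = i then 0 else v $ l)"
      using D v' unfolding Z_def T_def v(1) by simp
    ultimately show "D \<in> (\<Union>v\<in>V. (\<lambda>z. (j, up v z)) ` Z v)"
      using v' unfolding v(1) by blast
  qed
  then have "card T \<le> card (\<Union>v\<in>V. (\<lambda>z. (j, up v z)) ` Z v)"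
    using V Z by (intro card_mono) auto
  also have "\<dots> \<le> (\<Sum>v\<in>V. card ((\<lambda>z. (j, up v z)) ` Z v))" by (rule card_UN_le[OF V(1)])
  also have "real \<dots> \<le> (\<Sum>v\<in>V. 2 * A * real c ^ j / \<bar>real_of_int (q $ i)\<bar> + 1)"
    unfolding of_nat_sum
  proof (rule sum_mono)
    fix v
    have "real (card ((\<lambda>z. (j, up v z)) ` Z v)) \<le> real (card (Z v))" using Z by (simp add: card_image_le)
    then show "real (card ((\<lambda>z. (j, up v z)) ` Z v)) \<le> 2 * A * real c ^ j / \<bar>real_of_int (q $ i)\<bar> + 1"
      using Z[of v] by linarith
  qed
  also have "\<dots> = (real c ^ (j - fst p)) ^ (CARD('n) - 1) * (2 * A * real c ^ j / \<bar>real_of_int (q $ i)\<bar> + 1)"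
    by (simp add: V p)
  finally show ?thesis by (simp add: T_def)
qed

text \<open>As \<open>i\<close> is a largest coordinate, the hyperplane orthogonal to
  \<open>q\<close> is a graph over the other coordinates with slopes at most 1. The last condition
  puts its height over the centre within an eighth of the side, which leaves room to move sideways
  without leaving the cube.\<close>

definition near_hyperplane :: "nat \<Rightarrow> nat \<Rightarrow> nat \<times> (int ^ 'n) \<Rightarrow> int ^ 'n \<Rightarrow> 'n \<Rightarrow> bool" where
  "near_hyperplane c N D q i \<longleftrightarrow> q $ i \<noteq> 0 \<and> (\<forall>l. \<bar>q $ l\<bar> \<le> \<bar>q $ i\<bar>) \<and> \<bar>q $ i\<bar> \<le> int N \<and>
     \<bar>of_int_vec q \<bullet> center c D\<bar> \<le> \<bar>real_of_int (q $ i)\<bar> / (8 * real c ^ fst D)"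

section \<open>Most cubes are crossed near their centre by a hyperplane of small height\<close>

lemma ex_max_coordinate:
  fixes q :: "int ^ 'n"
  shows "\<exists>i. \<forall>l. \<bar>q $ l\<bar> \<le> \<bar>q $ i\<bar>"
proof -
  have "Max (range (\<lambda>l. \<bar>q $ l\<bar>)) \<in> range (\<lambda>l. \<bar>q $ l\<bar>)" by (intro Max_in) auto
  then obtain i where "Max (range (\<lambda>l. \<bar>q $ l\<bar>)) = \<bar>q $ i\<bar>" by blast
  then show ?thesis by (metis Max_ge finite finite_imageI rangeI)
qed

lemma card_max_coordinate:
  fixes i :: "'n :: finite"
  shows "finite {q :: int ^ 'n. \<bar>q $ i\<bar> = int m \<and> (\<forall>l. \<bar>q $ l\<bar> \<le> int m)}"
    and "card {q :: int ^ 'n. \<bar>q $ i\<bar> = int m \<and> (\<forall>l. \<bar>q $ l\<bar> \<le> int m)} \<le> 2 * (2 * m + 1) ^ (CARD('n) - 1)"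
proof -
  define S where "S l = (if l = i then {- int m, int m} else {- int m..int m})" for l
  have S: "finite (S l)" for l by (simp add: S_def)
  have sub: "{q :: int ^ 'n. \<bar>q $ i\<bar> = int m \<and> (\<forall>l. \<bar>q $ l\<bar> \<le> int m)} \<subseteq> {q. \<forall>l. q $ l \<in> S l}"
    by (auto simp: S_def abs_le_iff) (smt (verit))+
  show "finite {q :: int ^ 'n. \<bar>q $ i\<bar> = int m \<and> (\<forall>l. \<bar>q $ l\<bar> \<le> int m)}"
    by (rule finite_subset[OF sub card_vec_box(2)[OF S]])
  have "card {q :: int ^ 'n. \<bar>q $ i\<bar> = int m \<and> (\<forall>l. \<bar>q $ l\<bar> \<le> int m)} \<le> (\<Prod>l\<in>UNIV. card (S l))"
    using card_mono[OF card_vec_box(2)[OF S] sub] unfolding card_vec_box(1)[of S, OF S] .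
  also have "\<dots> \<le> (\<Prod>l\<in>UNIV. if l = i then 2 else 2 * m + 1)"
    by (intro prod_mono) (auto simp: S_def card_insert_if)
  finally show "card {q :: int ^ 'n. \<bar>q $ i\<bar> = int m \<and> (\<forall>l. \<bar>q $ l\<bar> \<le> int m)} \<le> 2 * (2 * m + 1) ^ (CARD('n) - 1)"
    by (simp only: prod_if_UNIV)
qed

text \<open>At scale \<open>c ^ - (n k - b)\<close> most cubes are crossed near their centre by a hyperplane of height
  at most \<open>N = c ^ k\<close>: Dirichlet's theorem provides a hyperplane, and it is as close as claimed unless
  its height is much smaller than \<open>N\<close>, which happens for few cubes.\<close>

lemma ubiquity:
  fixes p :: "nat \<times> (int ^ 'n)"
  assumes n: "CARD('n) \<ge> 2" and c: "c \<ge> 2"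
  shows "\<exists>b k0. \<forall>k\<ge>k0. fst p + b \<le> CARD('n) * k \<and>
    real (card {D \<in> subcubes c p (CARD('n) * k - b). \<not> (\<exists>q i. near_hyperplane c (c ^ k) D q i)})
      \<le> real c ^ (CARD('n) * (CARD('n) * k - b - fst p)) / 4"
proof -
  let ?n = "CARD('n)"
  have c0: "c > 0" and c1: "real c > 1" using c by auto
  obtain B where B: "B > 0" "\<And>x i. x \<in> cube c p \<Longrightarrow> \<bar>x $ i\<bar> \<le> B"
  proof -
    obtain B where B: "B > 0" "\<And>x. x \<in> cube c p \<Longrightarrow> norm x \<le> B"
      using bounded_cube[OF c0, of p] bounded_pos by blast
    have "\<bar>x $ i\<bar> \<le> B" if "x \<in> cube c p" for x i
      using B(2)[OF that] component_le_norm_cart[of x i] by linarith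
    then show ?thesis using B(1) that by blast
  qed
  \<comment> \<open>\<open>\<eta>\<close> absorbs the factor 8 of \<open>near_hyperplane\<close> and
    the constant of Dirichlet's theorem; \<open>m0\<close> will bring the proportion of exceptional
    cubes below a quarter. \<open>E\<close> gathers the constants of the count and depends on
    \<open>\<eta>\<close> but not on \<open>m0\<close>, hence the order of the choices.\<close>
  obtain \<eta> where \<eta>: "16 * real ?n * B < real c ^ \<eta>" using real_arch_pow[OF c1] by blast
  define E where "E = 2 * real ?n * 3 ^ (?n - 1) * real c ^ fst p * (4 * real ?n * B + real c ^ \<eta>)"
  obtain m0 where m0: "4 * E < real c ^ m0" using real_arch_pow[OF c1] by blast
  have n1: "1 \<le> ?n - 1" using n by simp
  show ?thesis
  proof (rule exI[of _ "m0 + \<eta>"], rule exI[of _ "fst p + m0 + \<eta>"], intro allI impI)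
    fix k assume k: "fst p + m0 + \<eta> \<le> k"
    define b where "b = m0 + \<eta>"
    define j where "j = ?n * k - b"
    define N where "N = c ^ k"
    define M where "M = c ^ (k - m0)"
    define L where "L = real c ^ (j - fst p)"
    define A where "A = 2 * real ?n * B / real N ^ (?n - 1)"
    have "k \<le> ?n * k" by simp
    then have le: "fst p + b \<le> ?n * k" using k unfolding b_def by linarith
    have N1: "N \<ge> 1" "N > 0" and M1: "M \<ge> 1" using c0 by (auto simp: N_def M_def)
    have A0: "A \<ge> 0" using B by (simp add: A_def)
    have L0: "L > 0" using c0 by (simp add: L_def)
    have NM: "real N = real M * real c ^ m0"
      using k by (simp add: N_def M_def flip: power_add)
    have cj: "real c ^ j * real c ^ b = real N ^ ?n"
      using le by (simp add: j_def N_def mult.commute flip: power_add power_mult)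
    have Nn: "real N ^ ?n = real N * real N ^ (?n - 1)"
      using n by (simp add: power_eq_if)
    have n2: "?n - 1 = Suc (?n - 2)" using n by simp
    have Mn: "real M ^ ?n = real M * real M ^ (?n - 1)" "real M ^ (?n - 1) = real M * real M ^ (?n - 2)"
    proof -
      show "real M ^ ?n = real M * real M ^ (?n - 1)" using n by (simp add: power_eq_if)
      show "real M ^ (?n - 1) = real M * real M ^ (?n - 2)" unfolding n2 by (rule power_Suc)
    qed
    \<comment> \<open>From the height \<open>M = N / c ^ m0\<close> on, the vector of Dirichlet's
      theorem is as close as \<open>near_hyperplane\<close> demands: lowering the level by
      \<open>b = m0 + \<eta>\<close> enlarges the cubes enough.\<close>
    have close: "8 * real c ^ j * A \<le> real M"
    proof -
      have "8 * real c ^ j * A * real N ^ (?n - 1) = 16 * real ?n * B * real c ^ j"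
        using N1 by (simp add: A_def)
      also have "\<dots> \<le> real c ^ \<eta> * real c ^ j" using \<eta> by (intro mult_right_mono) auto
      finally have "8 * real c ^ j * A * real N ^ (?n - 1) * real c ^ m0 \<le> real c ^ \<eta> * real c ^ j * real c ^ m0"
        by (rule mult_right_mono) simp
      also have "\<dots> = real N ^ ?n" using cj by (simp add: b_def power_add mult_ac)
      also have "\<dots> = real M * real N ^ (?n - 1) * real c ^ m0"
        unfolding Nn by (subst NM) (simp only: mult_ac)
      finally show ?thesis using N1 c0 by simp
    qed
    define Q where "Q i m = {q :: int ^ 'n. \<bar>q $ i\<bar> = int m \<and> (\<forall>l. \<bar>q $ l\<bar> \<le> int m)}" for i m
    define T where "T q = {D \<in> subcubes c p j. \<bar>of_int_vec q \<bullet> center c D\<bar> \<le> A}" for q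
    define Bad where "Bad = {D \<in> subcubes c p j. \<not> (\<exists>q i. near_hyperplane c N D q i)}"
    have jp: "fst p \<le> j" using le by (simp add: j_def)
    have finT: "finite (T q)" for q using finite_subcubes[OF c0 jp] by (simp add: T_def)
    have finQ: "finite (Q i m)" for i m unfolding Q_def by (rule card_max_coordinate)
    \<comment> \<open>For an exceptional cube, Dirichlet's vector has height below \<open>M\<close>.
      Such cubes are counted by the height \<open>m\<close>, the coordinate \<open>i\<close> which
      attains it and the vector \<open>q\<close>.\<close>
    have "Bad \<subseteq> (\<Union>i\<in>UNIV. \<Union>m\<in>{1..M}. \<Union>q\<in>Q i m. T q)"
    proof
      fix D assume D: "D \<in> Bad"
      then have Dsub: "cube c D \<subseteq> cube c p" and Dj: "fst D = j" by (auto simp: Bad_def subcubes_def)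
      have "\<bar>center c D $ i\<bar> \<le> B" for i
        using Dsub center_mem[OF c0, of D] by (intro B(2)) blast
      from dirichlet[OF n N1(1) B(1) this] obtain q where
        q: "q \<noteq> 0" "\<And>i. \<bar>q $ i\<bar> \<le> int N" "\<bar>of_int_vec q \<bullet> center c D\<bar> \<le> A" unfolding A_def by blast
      obtain i where i: "\<And>l. \<bar>q $ l\<bar> \<le> \<bar>q $ i\<bar>" using ex_max_coordinate by blast
      have qi: "q $ i \<noteq> 0"
      proof
        assume "q $ i = 0"
        then have "q $ l = 0" for l using i[of l] by simp
        then show False using q(1) by (simp add: vec_eq_iff)
      qed
      have "\<bar>q $ i\<bar> < int M"
      proof (rule ccontr)
        assume "\<not> \<bar>q $ i\<bar> < int M"
        then have "real M \<le> \<bar>real_of_int (q $ i)\<bar>" by linarith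
        then have "8 * real c ^ j * A \<le> \<bar>real_of_int (q $ i)\<bar>" using close by linarith
        then have "A \<le> \<bar>real_of_int (q $ i)\<bar> / (8 * real c ^ fst D)" using c0 Dj by (simp add: field_simps)
        then have "near_hyperplane c N D q i"
          unfolding near_hyperplane_def using q i qi by (meson order_trans)
        then show False using D by (auto simp: Bad_def)
      qed
      then have "nat \<bar>q $ i\<bar> \<in> {1..M}" "q \<in> Q i (nat \<bar>q $ i\<bar>)" using qi i by (auto simp: Q_def)
      moreover have "D \<in> T q" using q D by (simp add: T_def Bad_def)
      ultimately show "D \<in> (\<Union>i\<in>UNIV. \<Union>m\<in>{1..M}. \<Union>q\<in>Q i m. T q)" by blast
    qed
    then have "card Bad \<le> card (\<Union>i\<in>UNIV. \<Union>m\<in>{1..M}. \<Union>q\<in>Q i m. T q)"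
      using finT finQ by (intro card_mono) auto
    also have "\<dots> \<le> (\<Sum>i\<in>UNIV. card (\<Union>m\<in>{1..M}. \<Union>q\<in>Q i m. T q))"
      by (rule card_UN_le) simp
    also have "\<dots> \<le> (\<Sum>i\<in>UNIV. \<Sum>m\<in>{1..M}. card (\<Union>q\<in>Q i m. T q))"
      by (intro sum_mono card_UN_le) simp
    also have "\<dots> \<le> (\<Sum>i\<in>UNIV. \<Sum>m\<in>{1..M}. \<Sum>q\<in>Q i m. card (T q))"
      using finQ by (intro sum_mono card_UN_le)
    finally have "real (card Bad) \<le> (\<Sum>i\<in>UNIV. \<Sum>m\<in>{1..M}. \<Sum>q\<in>Q i m. real (card (T q)))"
      unfolding of_nat_sum[symmetric] of_nat_le_iff .
    also have "\<dots> \<le> (\<Sum>i\<in>(UNIV :: 'n set). \<Sum>m\<in>{1..M}. 2 * 3 ^ (?n - 1) * L ^ (?n - 1) * (real M ^ (?n - 2) * (2 * A * real c ^ j) + real M ^ (?n - 1)))"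
    proof (intro sum_mono)
      fix i and m assume m: "m \<in> {1..M}"
      have "(\<Sum>q\<in>Q i m. real (card (T q))) \<le> (\<Sum>q\<in>Q i m. L ^ (?n - 1) * (2 * A * real c ^ j / real m + 1))"
      proof (rule sum_mono)
        fix q assume q: "q \<in> Q i m"
        then have "\<bar>real_of_int (q $ i)\<bar> = real m" by (auto simp: Q_def simp flip: of_int_abs)
        moreover have "q $ i \<noteq> 0" using q m by (auto simp: Q_def)
        ultimately show "real (card (T q)) \<le> L ^ (?n - 1) * (2 * A * real c ^ j / real m + 1)"
          using slab_count[OF c0 jp _ A0, of q i] unfolding T_def L_def by simp
      qed
      also have "\<dots> = real (card (Q i m)) * (L ^ (?n - 1) * (2 * A * real c ^ j / real m + 1))" by simp
      also have "\<dots> \<le> (2 * (3 * real m) ^ (?n - 1)) * (L ^ (?n - 1) * (2 * A * real c ^ j / real m + 1))"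
      proof (rule mult_right_mono)
        have "real (card (Q i m)) \<le> real (2 * (2 * m + 1) ^ (?n - 1))"
          unfolding of_nat_le_iff Q_def by (rule card_max_coordinate)
        also have "\<dots> = 2 * (2 * real m + 1) ^ (?n - 1)" by (simp add: add.commute)
        also have "\<dots> \<le> 2 * (3 * real m) ^ (?n - 1)"
          using m by (intro mult_left_mono power_mono) auto
        finally show "real (card (Q i m)) \<le> 2 * (3 * real m) ^ (?n - 1)" .
        show "0 \<le> L ^ (?n - 1) * (2 * A * real c ^ j / real m + 1)" using L0 A0 by simp
      qed
      also have "\<dots> = 2 * 3 ^ (?n - 1) * L ^ (?n - 1) * (real m ^ (?n - 1) * (2 * A * real c ^ j / real m + 1))"
        by (simp add: power_mult_distrib)
      also have "real m ^ (?n - 1) * (2 * A * real c ^ j / real m + 1) = real m ^ (?n - 2) * (2 * A * real c ^ j) + real m ^ (?n - 1)"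
      proof -
        have "real m ^ (?n - 1) = real m * real m ^ (?n - 2)"
          unfolding n2 by (simp only: power_Suc)
        then show ?thesis using m by (simp add: field_simps)
      qed
      also have "2 * 3 ^ (?n - 1) * L ^ (?n - 1) * (real m ^ (?n - 2) * (2 * A * real c ^ j) + real m ^ (?n - 1))
         \<le> 2 * 3 ^ (?n - 1) * L ^ (?n - 1) * (real M ^ (?n - 2) * (2 * A * real c ^ j) + real M ^ (?n - 1))"
        using m A0 L0 by (intro mult_left_mono add_mono mult_right_mono power_mono) auto
      finally show "(\<Sum>q\<in>Q i m. real (card (T q))) \<le> 2 * 3 ^ (?n - 1) * L ^ (?n - 1) * (real M ^ (?n - 2) * (2 * A * real c ^ j) + real M ^ (?n - 1))" .
    qed
    \<comment> \<open>Each summand has been replaced by its bound at \<open>m = M\<close>, so the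
      sum over \<open>m\<close> contributes a factor \<open>M\<close>.\<close>
    also have "\<dots> = 2 * real ?n * 3 ^ (?n - 1) * L ^ (?n - 1) * (2 * A * real M ^ (?n - 1) * real c ^ j + real M ^ ?n)"
      by (simp add: algebra_simps Mn(1) flip: Mn(2))
    also have "\<dots> \<le> 2 * real ?n * 3 ^ (?n - 1) * L ^ (?n - 1) * (4 * real ?n * B * real c ^ j / real c ^ m0 + real c ^ \<eta> * real c ^ j / real c ^ m0)"
    proof (intro mult_left_mono add_mono)
      \<comment> \<open>In both terms the gain is \<open>(c ^ m0) ^ (n - 1)\<close>, which is at
        least \<open>c ^ m0\<close> since \<open>n \<ge> 2\<close>.\<close>
      have pw: "real c ^ m0 \<le> (real c ^ m0) ^ (?n - 1)"
        using power_increasing[OF n1, of "real c ^ m0"] c1 by simp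
      have "2 * A * real M ^ (?n - 1) = 4 * real ?n * B / (real c ^ m0) ^ (?n - 1)"
        using M1 by (simp add: A_def NM power_mult_distrib)
      also have "\<dots> \<le> 4 * real ?n * B / real c ^ m0"
        using pw B c0 by (intro divide_left_mono) auto
      finally have "2 * A * real M ^ (?n - 1) * real c ^ j \<le> 4 * real ?n * B / real c ^ m0 * real c ^ j"
        by (rule mult_right_mono) simp
      then show "2 * A * real M ^ (?n - 1) * real c ^ j \<le> 4 * real ?n * B * real c ^ j / real c ^ m0" by simp
      have "real M ^ ?n * (real c ^ m0) ^ ?n = real c ^ j * real c ^ m0 * real c ^ \<eta>"
        using cj NM by (simp add: b_def power_add power_mult_distrib mult_ac)
      moreover have "(real c ^ m0) ^ ?n = real c ^ m0 * (real c ^ m0) ^ (?n - 1)"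
        using n by (simp add: power_eq_if)
      ultimately have "real M ^ ?n * (real c ^ m0) ^ (?n - 1) = real c ^ j * real c ^ \<eta>" using c0 by simp
      moreover have "real M ^ ?n * real c ^ m0 \<le> real M ^ ?n * (real c ^ m0) ^ (?n - 1)"
        by (rule mult_left_mono[OF pw]) simp
      ultimately show "real M ^ ?n \<le> real c ^ \<eta> * real c ^ j / real c ^ m0"
        using c0 by (simp add: pos_le_divide_eq mult.commute)
    qed (use L0 in auto)
    also have "\<dots> = E / real c ^ m0 * L ^ ?n"
    proof -
      have "real c ^ j = real c ^ fst p * L" using jp by (simp add: L_def flip: power_add)
      moreover have "L ^ ?n = L * L ^ (?n - 1)" using n by (simp add: power_eq_if)
      ultimately show ?thesis by (simp add: E_def add_divide_distrib algebra_simps)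
    qed
    also have "\<dots> \<le> 1 / 4 * L ^ ?n"
      using m0 L0 c0 by (intro mult_right_mono) (auto simp: field_simps)
    finally have "real (card Bad) \<le> real c ^ (?n * (j - fst p)) / 4"
      by (simp add: L_def mult.commute flip: power_mult)
    then show "fst p + (m0 + \<eta>) \<le> ?n * k \<and>
      real (card {D \<in> subcubes c p (?n * k - (m0 + \<eta>)). \<not> (\<exists>q i. near_hyperplane c (c ^ k) D q i)})
      \<le> real c ^ (?n * (?n * k - (m0 + \<eta>) - fst p)) / 4"
      using le unfolding Bad_def N_def j_def b_def by simp
  qed
qed

section \<open>Small cubes along a hyperplane inside a cell\<close>

definition R_approx :: "real \<Rightarrow> real \<Rightarrow> (real ^ 'n) set" where
  "R_approx \<nu> \<gamma> = {\<omega>. \<exists>q :: int ^ 'n. q \<noteq> 0 \<and>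
     \<bar>of_int_vec q \<bullet> \<omega>\<bar> < \<gamma> / l1_norm (of_int_vec q) powr \<nu>}"

lemma R_set_eq: "R_set \<nu> = (\<Inter>\<gamma>\<in>{0<..}. R_approx \<nu> \<gamma>)"
  by (simp add: R_set_def R_approx_def)

lemma l1_norm_of_int_vec: "l1_norm (of_int_vec q) = (\<Sum>l\<in>UNIV. \<bar>real_of_int (q $ l)\<bar>)"
  by (simp add: l1_norm_def of_int_vec_def)

lemma l1_norm_le:
  fixes q :: "int ^ 'n"
  assumes "\<And>l. \<bar>q $ l\<bar> \<le> m"
  shows "l1_norm (of_int_vec q) \<le> real CARD('n) * real_of_int m"
proof -
  have "\<bar>real_of_int (q $ l)\<bar> \<le> real_of_int m" for l
    using assms[of l] by (metis of_int_abs of_int_le_iff)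
  then have "(\<Sum>l\<in>UNIV. \<bar>real_of_int (q $ l)\<bar>) \<le> (\<Sum>l\<in>(UNIV :: 'n set). real_of_int m)"
    by (intro sum_mono)
  then show ?thesis by (simp add: l1_norm_of_int_vec)
qed

lemma inner_of_int_vec_le:
  assumes "\<And>l. \<bar>x $ l\<bar> \<le> d"
  shows "\<bar>of_int_vec q \<bullet> x\<bar> \<le> l1_norm (of_int_vec q) * d"
proof -
  have "\<bar>of_int_vec q \<bullet> x\<bar> \<le> (\<Sum>l\<in>UNIV. \<bar>real_of_int (q $ l) * x $ l\<bar>)"
    unfolding inner_of_int_vec by (rule sum_abs)
  also have "\<dots> \<le> (\<Sum>l\<in>UNIV. \<bar>real_of_int (q $ l)\<bar> * d)"
    unfolding abs_mult using assms by (intro sum_mono mult_left_mono) auto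
  finally show ?thesis by (simp add: l1_norm_of_int_vec sum_distrib_right)
qed

lemma subcubes_coord:
  fixes p p' :: "nat \<times> (int ^ 'n)"
  assumes "c > 0" "fst p \<le> fst p'" "cube c p' \<subseteq> cube c p"
  shows "snd p' $ l \<in> {snd p $ l * int c ^ (fst p' - fst p) ..< (snd p $ l + 1) * int c ^ (fst p' - fst p)}"
proof -
  have "p' \<in> subcubes c (fst p, snd p) (fst p')" using assms(3) by (simp add: subcubes_def)
  then obtain v where "p' = (fst p', v)"
    and v: "\<forall>i. v $ i \<in> {snd p $ i * int c ^ (fst p' - fst p) ..< (snd p $ i + 1) * int c ^ (fst p' - fst p)}"
    unfolding subcubes_eq[OF assms(1,2)] by blast
  then have "snd p' = v" by (metis snd_conv)
  then show ?thesis using v by blast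
qed

text \<open>One small cube is taken in each column over a central window, at the height of the hyperplane.\<close>

lemma hyperplane_pieces:
  fixes D :: "nat \<times> (int ^ 'n)"
  assumes c: "c \<ge> 2" and near: "near_hyperplane c N D q i"
    and e: "16 * real CARD('n) \<le> real c ^ e" and l: "fst D + e \<le> lf"
    and \<gamma>: "(real CARD('n) * real N) powr (\<nu> + 1) / real c ^ lf < \<gamma>" and \<nu>: "\<nu> + 1 > 0"
  shows "\<exists>P. finite P \<and> card P = (c ^ (lf - fst D - e)) ^ (CARD('n) - 1) \<and>
    (\<forall>p\<in>P. fst p = lf \<and> closure (cube c p) \<subseteq> cube c D \<and> cube c p \<subseteq> R_approx \<nu> \<gamma> \<and>
       (\<forall>y\<in>cube c p. \<bar>of_int_vec q \<bullet> y\<bar> \<le> real CARD('n) * \<bar>real_of_int (q $ i)\<bar> / real c ^ lf)) \<and>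
    (\<forall>\<Lambda>. fst \<Lambda> \<le> lf \<longrightarrow> card {p\<in>P. cube c p \<subseteq> cube c \<Lambda>} \<le> (c ^ (lf - fst \<Lambda>)) ^ (CARD('n) - 1))"
proof -
  let ?n = "CARD('n)"
  define j where "j = fst D"
  define \<kappa> where "\<kappa> = snd D"
  have D: "D = (j, \<kappa>)" by (simp add: j_def \<kappa>_def)
  \<comment> \<open>Lengths are now measured in sides of leaves, that is, of cubes of level
    \<open>lf\<close>: the cell has side \<open>X\<close> and centre \<open>o'\<close>, and
    \<open>W\<close> is the width of the central window. The hypothesis on \<open>e\<close> becomes
    \<open>16 * n * W \<le> X\<close>.\<close>
  define X where "X = real c ^ (lf - j)"
  define W where "W = c ^ (lf - j - e)"
  define o' where "o' l = (real_of_int (\<kappa> $ l) + 1 / 2) * X" for l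
  have c0: "c > 0" using c by simp
  have cp: "real c ^ m > 0" for m using c0 by simp
  have q: "q $ i \<noteq> 0" "\<And>l. \<bar>q $ l\<bar> \<le> \<bar>q $ i\<bar>" "\<bar>q $ i\<bar> \<le> int N" "q \<noteq> 0"
    "\<bar>of_int_vec q \<bullet> center c D\<bar> \<le> \<bar>real_of_int (q $ i)\<bar> / (8 * real c ^ j)"
    using near by (auto simp: near_hyperplane_def j_def)
  have qr: "\<bar>real_of_int (q $ l)\<bar> \<le> \<bar>real_of_int (q $ i)\<bar>" for l
    using q(2)[of l] by (metis of_int_abs of_int_le_iff)
  have qi0: "\<bar>real_of_int (q $ i)\<bar> > 0" using q(1) by simp
  have cl: "real c ^ lf = real c ^ j * X" using l by (simp add: X_def j_def flip: power_add)
  have XW: "X = real c ^ e * real W" using l by (simp add: X_def W_def j_def flip: power_add)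
  have W1: "real W \<ge> 1" using c0 by (simp add: W_def)
  have XW16: "16 * real ?n * real W \<le> X" unfolding XW using e by (intro mult_right_mono) auto
  have o'c: "real c ^ lf * center c D $ l = o' l" for l
    using cp[of j] c0 by (simp add: center_def D cl o'_def)
  define S where "S l = {\<lfloor>o' l\<rfloor> ..< \<lfloor>o' l\<rfloor> + int W}" for l
  define V where "V = {v :: int ^ 'n. \<forall>l. v $ l \<in> (if l = i then {0} else S l)}"
  have V: "finite V" "card V = W ^ (?n - 1)"
    unfolding V_def by (intro card_vec_box_slice; simp add: S_def)+
  have Vi: "v $ i = 0" "l \<noteq> i \<Longrightarrow> v $ l \<in> S l" if "v \<in> V" for v l
  proof -
    have "v $ l \<in> (if l = i then {0} else S l)" for l using that unfolding V_def by blast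
    from this[of i] this[of l] show "v $ i = 0" "l \<noteq> i \<Longrightarrow> v $ l \<in> S l" by auto
  qed
  \<comment> \<open>\<open>s v\<close> is the height of the hyperplane over the column
    \<open>v\<close>, and its floor selects the leaf of that column which contains the point
    \<open>x v\<close> of the hyperplane.\<close>
  define s where "s v = - (\<Sum>l\<in>UNIV - {i}. real_of_int (q $ l) / real_of_int (q $ i) * real_of_int (v $ l))" for v :: "int ^ 'n"
  define F where "F v = (lf, (\<chi> l. if l = i then \<lfloor>s v\<rfloor> else v $ l))" for v
  define P where "P = F ` V"
  have zero: "v = v'" if "v \<in> V" "v' \<in> V" "\<And>l. l \<noteq> i \<Longrightarrow> snd (F v) $ l = snd (F v') $ l" for v v'
  proof -
    have "v $ l = v' $ l" for l
    proof (cases "l = i")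
      case True
      then show ?thesis using that(1,2) Vi(1) by simp
    next
      case False
      then show ?thesis using that(3)[of l] by (simp add: F_def)
    qed
    then show ?thesis by (simp add: vec_eq_iff)
  qed
  have inj: "inj_on F V" using zero by (auto simp: inj_on_def)
  define x where "x v = (\<chi> l. (if l = i then s v else real_of_int (v $ l)) / real c ^ lf)" for v
  have xq: "of_int_vec q \<bullet> x v = 0" for v
  proof -
    have "of_int_vec q \<bullet> x v = real_of_int (q $ i) * x v $ i + (\<Sum>l\<in>UNIV - {i}. real_of_int (q $ l) * x v $ l)"
      unfolding inner_of_int_vec by (subst sum.remove[of _ i]) auto
    also have "(\<Sum>l\<in>UNIV - {i}. real_of_int (q $ l) * x v $ l) = (\<Sum>l\<in>UNIV - {i}. real_of_int (q $ l) * real_of_int (v $ l)) / real c ^ lf"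
      unfolding sum_divide_distrib by (intro sum.cong) (auto simp: x_def)
    also have "real_of_int (q $ i) * x v $ i = - (\<Sum>l\<in>UNIV - {i}. real_of_int (q $ l) * real_of_int (v $ l)) / real c ^ lf"
      using q(1) by (simp add: x_def s_def sum_distrib_left)
    finally show ?thesis by simp
  qed
  have near_x: "\<bar>y $ l - x v $ l\<bar> \<le> 1 / real c ^ lf" if "y \<in> closure (cube c (F v))" for y v l
  proof -
    have "real_of_int (snd (F v) $ l) / real c ^ lf \<le> y $ l" "y $ l \<le> (real_of_int (snd (F v) $ l) + 1) / real c ^ lf"
      using closure_cube_le[OF c0, of y lf "snd (F v)" l] that by (auto simp: F_def)
    moreover have "real_of_int (snd (F v) $ l) / real c ^ lf \<le> x v $ l" "x v $ l \<le> (real_of_int (snd (F v) $ l) + 1) / real c ^ lf"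
      using cp[of lf] of_int_floor_le[of "s v"] real_of_int_floor_add_one_ge[of "s v"]
      by (auto simp: F_def x_def divide_le_cancel)
    moreover have "(real_of_int (snd (F v) $ l) + 1) / real c ^ lf = real_of_int (snd (F v) $ l) / real c ^ lf + 1 / real c ^ lf"
      by (simp add: add_divide_distrib)
    ultimately show ?thesis unfolding abs_le_iff by linarith
  qed
  have slab: "\<bar>of_int_vec q \<bullet> y\<bar> \<le> l1_norm (of_int_vec q) * (1 / real c ^ lf)" if "y \<in> cube c (F v)" for y v
  proof -
    have "\<bar>(y - x v) $ l\<bar> \<le> 1 / real c ^ lf" for l
      using near_x[of y v l] that closure_subset by auto
    from inner_of_int_vec_le[of "y - x v", OF this, of q] show ?thesis by (simp add: inner_diff_right xq)
  qed
  have l1: "l1_norm (of_int_vec q) \<le> real ?n * \<bar>real_of_int (q $ i)\<bar>"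
    using l1_norm_le[of q "\<bar>q $ i\<bar>"] q(2) by simp
  have l1N: "l1_norm (of_int_vec q) \<le> real ?n * real N"
  proof -
    have "\<bar>q $ l\<bar> \<le> int N" for l using q(2)[of l] q(3) by linarith
    from l1_norm_le[of q "int N", OF this] show ?thesis by simp
  qed
  have l1pos: "0 < l1_norm (of_int_vec q)"
  proof -
    have "\<bar>real_of_int (q $ i)\<bar> \<le> (\<Sum>l\<in>UNIV. \<bar>real_of_int (q $ l)\<bar>)" 
      by (rule member_le_sum[of i UNIV "\<lambda>l. \<bar>real_of_int (q $ l)\<bar>"]) simp_all
    then show ?thesis using qi0 by (simp add: l1_norm_of_int_vec)
  qed
  \<comment> \<open>Within a leaf the product with \<open>q\<close> differs from its value 0 on the
    hyperplane by at most \<open>l1_norm (of_int_vec q) / c ^ lf\<close>. As this norm is at most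
    \<open>n * N\<close>, the hypothesis on \<open>\<gamma>\<close> gives the inequality of
    \<open>R_approx\<close>.\<close>
  have RA: "cube c (F v) \<subseteq> R_approx \<nu> \<gamma>" for v
  proof
    fix y assume y: "y \<in> cube c (F v)"
    let ?m = "l1_norm (of_int_vec q)"
    have "?m powr (\<nu> + 1) \<le> (real ?n * real N) powr (\<nu> + 1)"
      using l1N l1pos \<nu> by (intro powr_mono2) auto
    then have "?m powr (\<nu> + 1) / real c ^ lf < \<gamma>" using \<gamma> cp[of lf]
      by (meson divide_right_mono le_less_trans less_imp_le)
    then have "?m powr \<nu> * (?m * (1 / real c ^ lf)) < \<gamma>" using l1pos by (simp add: powr_add mult_ac)
    then have "?m * (1 / real c ^ lf) < \<gamma> / ?m powr \<nu>" using l1pos by (simp add: pos_less_divide_eq mult_ac)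
    then have "\<bar>of_int_vec q \<bullet> y\<bar> < \<gamma> / ?m powr \<nu>" using slab[OF y] by linarith
    then show "y \<in> R_approx \<nu> \<gamma>" using q(4) unfolding R_approx_def by blast
  qed
  have clo: "closure (cube c (F v)) \<subseteq> cube c D" if v: "v \<in> V" for v
  proof
    fix y assume y: "y \<in> closure (cube c (F v))"
    have vl: "\<bar>real_of_int (v $ l) - o' l\<bar> \<le> real W" if "l \<noteq> i" for l
    proof -
      have "\<lfloor>o' l\<rfloor> \<le> v $ l" "v $ l \<le> \<lfloor>o' l\<rfloor> + int W - 1" using Vi(2)[OF v that] unfolding S_def by auto
      then show ?thesis using W1 by linarith
    qed
    \<comment> \<open>The height over the centre accounts for \<open>X / 8\<close>. Moving across
      the window changes it by at most \<open>n * W \<le> X / 16\<close>, the slopes being at most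
      1. With one more leaf side the distance from the centre stays below \<open>X / 2\<close>, so
      even closures of leaves lie in the cell.\<close>
    have xl: "\<bar>real c ^ lf * x v $ l - o' l\<bar> \<le> X / 8 + X / 16" for l
    proof (cases "l = i")
      case False
      have n1: "1 \<le> real ?n" by (simp add: Suc_leI)
      have "\<bar>real c ^ lf * x v $ l - o' l\<bar> \<le> real W"
        using vl[OF False] cp[of lf] False by (simp add: x_def)
      moreover have "16 * real W \<le> 16 * real ?n * real W" using n1 by (intro mult_right_mono) auto
      ultimately show ?thesis using XW16 W1 by linarith
    next
      case True
      let ?r = "\<lambda>l. real_of_int (q $ l) / real_of_int (q $ i)"
      have sum: "(\<Sum>l\<in>UNIV. real_of_int (q $ l) * o' l) = real c ^ lf * (of_int_vec q \<bullet> center c D)"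
        unfolding inner_of_int_vec sum_distrib_left o'c[symmetric] by (simp add: mult_ac)
      have "(\<Sum>l\<in>UNIV. real_of_int (q $ l) * o' l) = real_of_int (q $ i) * o' i + (\<Sum>l\<in>UNIV - {i}. real_of_int (q $ l) * o' l)"
        by (subst sum.remove[of _ i]) auto
      then have "o' i = real c ^ lf * (of_int_vec q \<bullet> center c D) / real_of_int (q $ i) - (\<Sum>l\<in>UNIV - {i}. ?r l * o' l)"
      proof -
        assume eq: "(\<Sum>l\<in>UNIV. real_of_int (q $ l) * o' l) = real_of_int (q $ i) * o' i + (\<Sum>l\<in>UNIV - {i}. real_of_int (q $ l) * o' l)"
        have "(\<Sum>l\<in>UNIV - {i}. ?r l * o' l) = (\<Sum>l\<in>UNIV - {i}. real_of_int (q $ l) * o' l) / real_of_int (q $ i)"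
          by (simp add: sum_divide_distrib)
        moreover have "o' i = (real c ^ lf * (of_int_vec q \<bullet> center c D) - (\<Sum>l\<in>UNIV - {i}. real_of_int (q $ l) * o' l)) / real_of_int (q $ i)"
          using q(1) eq unfolding sum by simp
        ultimately show ?thesis by (simp only: diff_divide_distrib)
      qed
      then have "s v - o' i = - (real c ^ lf * (of_int_vec q \<bullet> center c D) / real_of_int (q $ i)) - (\<Sum>l\<in>UNIV - {i}. ?r l * (real_of_int (v $ l) - o' l))"
        by (simp add: s_def right_diff_distrib sum_subtractf)
      moreover have "\<bar>real c ^ lf * (of_int_vec q \<bullet> center c D) / real_of_int (q $ i)\<bar> \<le> X / 8"
      proof -
        have "real c ^ lf * \<bar>of_int_vec q \<bullet> center c D\<bar> \<le> real c ^ lf * (\<bar>real_of_int (q $ i)\<bar> / (8 * real c ^ j))"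
          by (intro mult_left_mono q(5)) simp
        also have "\<dots> = X / 8 * \<bar>real_of_int (q $ i)\<bar>" using cp[of j] c0 by (simp add: cl)
        finally show ?thesis using qi0 by (simp add: abs_mult abs_divide pos_divide_le_eq)
      qed
      moreover have "\<bar>\<Sum>l\<in>UNIV - {i}. ?r l * (real_of_int (v $ l) - o' l)\<bar> \<le> X / 16"
      proof -
        have "\<bar>\<Sum>l\<in>UNIV - {i}. ?r l * (real_of_int (v $ l) - o' l)\<bar> \<le> (\<Sum>l\<in>UNIV - {i}. \<bar>?r l * (real_of_int (v $ l) - o' l)\<bar>)"
          by (rule sum_abs)
        also have "\<dots> \<le> (\<Sum>l\<in>UNIV - {i}. real W)"
        proof (rule sum_mono)
          fix l assume l: "l \<in> UNIV - {i}"
          have "\<bar>?r l\<bar> \<le> 1" using qr[of l] qi0 by (simp add: abs_divide)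
          then show "\<bar>?r l * (real_of_int (v $ l) - o' l)\<bar> \<le> real W"
            unfolding abs_mult using mult_mono[OF _ vl, of "\<bar>?r l\<bar>" 1 l] l by simp
        qed
        also have "\<dots> \<le> real ?n * real W" by (simp add: mult_right_mono)
        finally show ?thesis using XW16 by linarith
      qed
      ultimately have "\<bar>s v - o' i\<bar> \<le> X / 8 + X / 16" by linarith
      then show ?thesis using True cp[of lf] by (simp add: x_def)
    qed
    have "\<lfloor>real c ^ j * y $ l\<rfloor> = \<kappa> $ l" for l
    proof -
      have "\<bar>real c ^ lf * y $ l - real c ^ lf * x v $ l\<bar> \<le> 1"
      proof -
        have "real c ^ lf * \<bar>y $ l - x v $ l\<bar> \<le> real c ^ lf * (1 / real c ^ lf)"
          using near_x[OF y, of l] by (rule mult_left_mono) simp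
        also have "\<dots> = 1" using cp[of lf] by simp
        finally show ?thesis by (simp add: abs_mult flip: right_diff_distrib)
      qed
      then have "\<bar>real c ^ lf * y $ l - o' l\<bar> \<le> X / 8 + X / 16 + 1" using xl[of l] by linarith
      moreover have "16 \<le> X" 
      proof -
        have "16 * 1 * 1 \<le> 16 * real ?n * real W" using W1 by (intro mult_mono) (auto simp: Suc_leI)
        then show ?thesis using XW16 by linarith
      qed
      ultimately have "\<bar>real c ^ lf * y $ l - o' l\<bar> < X / 2" by linarith
      moreover have "real c ^ lf * y $ l - o' l = X * (real c ^ j * y $ l - (real_of_int (\<kappa> $ l) + 1 / 2))"
        by (simp add: cl o'_def algebra_simps)
      ultimately have "X * \<bar>real c ^ j * y $ l - (real_of_int (\<kappa> $ l) + 1 / 2)\<bar> < X * (1 / 2)"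
        using cp[of "lf - j"] by (simp add: abs_mult X_def)
      then have "\<bar>real c ^ j * y $ l - (real_of_int (\<kappa> $ l) + 1 / 2)\<bar> < 1 / 2"
        using cp[of "lf - j"] unfolding X_def by (rule mult_left_less_imp_less[OF _ less_imp_le])
      then show ?thesis unfolding floor_eq_iff by linarith
    qed
    then show "y \<in> cube c D" by (simp add: D mem_cube)
  qed
  show ?thesis
  proof (intro exI[of _ P] conjI ballI allI impI)
    show "finite P" using V by (simp add: P_def)
    show "card P = (c ^ (lf - fst D - e)) ^ (?n - 1)"
      using V inj by (simp add: P_def card_image W_def j_def)
    fix p assume "p \<in> P"
    then obtain v where v: "v \<in> V" "p = F v" by (auto simp: P_def)
    show "fst p = lf" using v by (simp add: F_def)
    show "closure (cube c p) \<subseteq> cube c D" using clo v by blast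
    show "cube c p \<subseteq> R_approx \<nu> \<gamma>" using RA v by blast
    show "\<bar>of_int_vec q \<bullet> y\<bar> \<le> real ?n * \<bar>real_of_int (q $ i)\<bar> / real c ^ lf" if "y \<in> cube c p" for y
      using slab[of y v] that v(2) divide_right_mono[OF l1, of "real c ^ lf"] by auto
  next
    \<comment> \<open>There is one leaf per column, and the column of a leaf inside
      \<open>\<Lambda>\<close> is one of the columns of \<open>\<Lambda>\<close>.\<close>
    fix \<Lambda> :: "nat \<times> (int ^ 'n)" assume \<Lambda>: "fst \<Lambda> \<le> lf"
    define d where "d = int c ^ (lf - fst \<Lambda>)"
    define S' where "S' l = {snd \<Lambda> $ l * d ..< (snd \<Lambda> $ l + 1) * d}" for l
    define V' where "V' = {v :: int ^ 'n. \<forall>l. v $ l \<in> (if l = i then {0} else S' l)}"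
    have cS: "card (S' l) = c ^ (lf - fst \<Lambda>)" for l
      unfolding S'_def d_def by (simp add: algebra_simps flip: of_nat_power)
    have V': "finite V'" "card V' = (c ^ (lf - fst \<Lambda>)) ^ (?n - 1)"
      unfolding V'_def using cS by (intro card_vec_box_slice; simp add: S'_def)+
    have "{p\<in>P. cube c p \<subseteq> cube c \<Lambda>} \<subseteq> F ` V'"
    proof
      fix p assume p: "p \<in> {p\<in>P. cube c p \<subseteq> cube c \<Lambda>}"
      then obtain v where v: "v \<in> V" "p = F v" by (auto simp: P_def)
      have "v $ l \<in> S' l" if "l \<noteq> i" for l
        using subcubes_coord[OF c0, of \<Lambda> p l] p \<Lambda> that unfolding v(2) S'_def d_def by (simp add: F_def)
      moreover have "v $ i = 0" using v(1) Vi(1) by simp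
      ultimately have "v \<in> V'" by (simp add: V'_def)
      then show "p \<in> F ` V'" using v(2) by blast
    qed
    then have "card {p\<in>P. cube c p \<subseteq> cube c \<Lambda>} \<le> card V'"
      using V'(1) by (meson card_image_le card_mono finite_imageI order_trans)
    then show "card {p\<in>P. cube c p \<subseteq> cube c \<Lambda>} \<le> (c ^ (lf - fst \<Lambda>)) ^ (?n - 1)"
      using V'(2) by simp
  qed
qed

section \<open>Cells which avoid the pieces of coarser scales\<close>

lemma sum_geometric_tail_le:
  fixes x :: real
  assumes "0 \<le> x" "x < 1"
  shows "(\<Sum>s\<in>{t0..<t}. x ^ s) \<le> x ^ t0 / (1 - x)"
proof -
  have eq: "(\<Sum>s\<in>{t0..<t}. x ^ s) * (1 - x) = x ^ t0 - x ^ t" if "t0 \<le> t"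
    using that
  proof (induction t rule: dec_induct)
    case (step k)
    have "(\<Sum>s\<in>{t0..<Suc k}. x ^ s) * (1 - x) = (\<Sum>s\<in>{t0..<k}. x ^ s) * (1 - x) + x ^ k * (1 - x)"
      using step(1) by (simp add: distrib_right)
    then show ?case using step(3) by (simp add: right_diff_distrib)
  qed simp
  have "(\<Sum>s\<in>{t0..<t}. x ^ s) * (1 - x) \<le> x ^ t0"
    using eq assms by (cases "t0 \<le> t") auto
  then show ?thesis using assms by (simp add: pos_le_divide_eq)
qed

lemma sum_power_diff_le:
  fixes y :: real
  assumes "0 \<le> y" "y \<le> 1 / 2"
  shows "(\<Sum>s\<in>{t0..<t}. y ^ (t - s)) \<le> 2 * y"
proof -
  have "(\<Sum>s\<in>{t0..<t}. y ^ (t - s)) \<le> (\<Sum>s\<in>{0..<t}. y ^ (t - s))"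
    using assms by (intro sum_mono2) auto
  also have "\<dots> \<le> 2 * y"
  proof (induction t)
    case (Suc t)
    have "(\<Sum>s\<in>{0..<Suc t}. y ^ (Suc t - s)) = y * (\<Sum>s\<in>{0..<t}. y ^ (t - s)) + y"
      by (simp add: sum_distrib_left Suc_diff_le)
    also have "\<dots> \<le> y * (2 * y) + y" using Suc assms by (intro add_right_mono mult_left_mono) auto
    also have "\<dots> \<le> 2 * y" using assms mult_left_mono[of y "1/2" y] by simp
    finally show ?case .
  qed (use assms in simp)
  finally show ?thesis .
qed

text \<open>A cell meeting a piece has its centre in a slab around the hyperplane whose thickness is
  governed by the side of a leaf plus the side of a cell, and \<open>slab_count\<close> inside
  \<open>D0\<close> applies. The proportion obtained is of the order of the two sides divided by the
  side of \<open>D0\<close>.\<close>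

lemma touched_count:
  fixes D0 :: "nat \<times> (int ^ 'n)"
  assumes c: "c \<ge> 2" and j: "fst D0 \<le> j"
    and q: "q $ i \<noteq> 0" "\<And>l. \<bar>q $ l\<bar> \<le> \<bar>q $ i\<bar>"
    and P: "\<And>p. p \<in> P \<Longrightarrow> cube c p \<subseteq> cube c D0"
      "\<And>p y. p \<in> P \<Longrightarrow> y \<in> cube c p \<Longrightarrow> \<bar>of_int_vec q \<bullet> y\<bar> \<le> real CARD('n) * \<bar>real_of_int (q $ i)\<bar> / real c ^ lf"
  shows "real (card {D. fst D = j \<and> (\<exists>p\<in>P. cube c p \<inter> cube c D \<noteq> {})}) \<le>
    (real c ^ (j - fst D0)) ^ CARD('n) * (3 * real CARD('n) * (real c ^ fst D0 / real c ^ lf + real c ^ fst D0 / real c ^ j))"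
    and "finite {D. fst D = j \<and> (\<exists>p\<in>P. cube c p \<inter> cube c D \<noteq> {})}"
proof -
  let ?n = "real CARD('n)"
  let ?T = "{D. fst D = j \<and> (\<exists>p\<in>P. cube c p \<inter> cube c D \<noteq> {})}"
  define L where "L = real c ^ (j - fst D0)"
  define A where "A = ?n * \<bar>real_of_int (q $ i)\<bar> * (1 / real c ^ lf + 1 / real c ^ j)"
  have c0: "c > 0" using c by simp
  have A0: "A \<ge> 0" by (simp add: A_def)
  have qi: "\<bar>real_of_int (q $ i)\<bar> > 0" using q(1) by simp
  have L: "real c ^ j = real c ^ fst D0 * L" using j by (simp add: L_def flip: power_add)
  have L0: "L > 0" using c0 by (simp add: L_def)
  have sub: "?T \<subseteq> {D \<in> subcubes c D0 j. \<bar>of_int_vec q \<bullet> center c D\<bar> \<le> A}"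
  proof
    fix D assume "D \<in> ?T"
    then obtain p y where D: "fst D = j" "p \<in> P" "y \<in> cube c p" "y \<in> cube c D" by blast
    have "cube c D \<subseteq> cube c D0"
      using cube_nested[OF c0, of D0 D y] D P(1)[OF D(2)] j by auto
    moreover have "\<bar>of_int_vec q \<bullet> center c D\<bar> \<le> A"
    proof -
      have "\<bar>(center c D - y) $ l\<bar> \<le> 1 / (2 * real c ^ j)" for l
        using center_close[OF c0, of y D l] closure_subset D by (auto simp: abs_minus_commute)
      then have "\<bar>of_int_vec q \<bullet> (center c D - y)\<bar> \<le> l1_norm (of_int_vec q) * (1 / (2 * real c ^ j))"
        by (rule inner_of_int_vec_le)
      also have "\<dots> \<le> (?n * \<bar>real_of_int (q $ i)\<bar>) * (1 / real c ^ j)"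
        using l1_norm_le[of q "\<bar>q $ i\<bar>"] q(2) c0
        by (intro mult_mono) (auto simp: field_simps)
      finally have "\<bar>of_int_vec q \<bullet> center c D - of_int_vec q \<bullet> y\<bar> \<le> ?n * \<bar>real_of_int (q $ i)\<bar> / real c ^ j"
        by (simp add: inner_diff_right)
      moreover have "\<bar>of_int_vec q \<bullet> y\<bar> \<le> ?n * \<bar>real_of_int (q $ i)\<bar> / real c ^ lf"
        by (rule P(2)[OF D(2,3)])
      moreover have "A = ?n * \<bar>real_of_int (q $ i)\<bar> / real c ^ lf + ?n * \<bar>real_of_int (q $ i)\<bar> / real c ^ j"
        by (simp add: A_def distrib_left)
      ultimately show ?thesis by linarith
    qed
    ultimately show "D \<in> {D \<in> subcubes c D0 j. \<bar>of_int_vec q \<bullet> center c D\<bar> \<le> A}"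
      using D by (simp add: subcubes_def)
  qed
  have fin: "finite {D \<in> subcubes c D0 j. \<bar>of_int_vec q \<bullet> center c D\<bar> \<le> A}"
    using finite_subcubes[OF c0 j] by simp
  show "finite ?T" by (rule finite_subset[OF sub fin])
  have "real (card ?T) \<le> L ^ (CARD('n) - 1) * (2 * A * real c ^ j / \<bar>real_of_int (q $ i)\<bar> + 1)"
    using card_mono[OF fin sub] slab_count[of c D0 j q i A] c0 j q(1) A0 unfolding L_def by linarith
  also have "2 * A * real c ^ j / \<bar>real_of_int (q $ i)\<bar> = 2 * ?n * (real c ^ j / real c ^ lf + 1)"
  proof -
    have "A = \<bar>real_of_int (q $ i)\<bar> * (?n * (1 / real c ^ lf + 1 / real c ^ j))" by (simp add: A_def)
    then have "2 * A * real c ^ j / \<bar>real_of_int (q $ i)\<bar> = 2 * (?n * (1 / real c ^ lf + 1 / real c ^ j)) * real c ^ j"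
      using qi by simp
    also have "\<dots> = 2 * ?n * (real c ^ j / real c ^ lf + 1)" using c0 by (simp add: distrib_left distrib_right)
    finally show ?thesis .
  qed
  also have "L ^ (CARD('n) - 1) * (2 * ?n * (real c ^ j / real c ^ lf + 1) + 1) \<le>
     L ^ (CARD('n) - 1) * (3 * ?n * (real c ^ j / real c ^ lf + 1))"
  proof (rule mult_left_mono)
    have "1 * 1 \<le> ?n * (real c ^ j / real c ^ lf + 1)" by (intro mult_mono) (auto simp: Suc_leI)
    then show "2 * ?n * (real c ^ j / real c ^ lf + 1) + 1 \<le> 3 * ?n * (real c ^ j / real c ^ lf + 1)" by (simp add: mult.assoc)
  qed (use L0 in simp)
  also have "\<dots> = L ^ CARD('n) * (3 * ?n * (real c ^ fst D0 / real c ^ lf + real c ^ fst D0 / real c ^ j))"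
  proof -
    have 1: "L ^ CARD('n) = L ^ (CARD('n) - 1) * L" by (simp flip: power_Suc2)
    have 2: "L * (real c ^ fst D0 / real c ^ lf + real c ^ fst D0 / real c ^ j) = real c ^ j / real c ^ lf + 1"
      using c0 L0 unfolding L by (simp add: distrib_left mult.commute)
    show ?thesis unfolding 1 2[symmetric] by (simp only: mult_ac)
  qed
  finally show "real (card ?T) \<le> (real c ^ (j - fst D0)) ^ CARD('n) * (3 * ?n * (real c ^ fst D0 / real c ^ lf + real c ^ fst D0 / real c ^ j))"
    by (simp add: L_def)
qed

text \<open>With \<open>N = c ^ (a t)\<close>, the cells of scale \<open>t\<close> have side comparable to \<open>N\<^sup>-\<^sup>n\<close>, the distance at which Dirichlet's
  theorem finds a hyperplane, and the leaves have side comparable to \<open>N\<^sup>-\<^sup>\<nu>\<^sup>-\<^sup>1\<close>, the distance required in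
  the definition of \<^const>\<open>R_set\<close>.\<close>

definition cell_level :: "nat \<Rightarrow> nat \<Rightarrow> nat \<Rightarrow> nat \<Rightarrow> nat" where
  "cell_level n a b t = n * (a * t) - b"

definition leaf_level :: "real \<Rightarrow> nat \<Rightarrow> nat \<Rightarrow> nat \<Rightarrow> nat" where
  "leaf_level \<nu> a b t = nat \<lceil>(\<nu> + 1) * real (a * t)\<rceil> + b"

text \<open>What the distribution of mass asks of a cell: the number of its pieces, their position,
  and how many of them a smaller cube can hold. The vector \<open>q\<close> behind the pieces is
  forgotten here.\<close>

definition slab_pieces :: "nat \<Rightarrow> nat \<Rightarrow> real \<Rightarrow> real \<Rightarrow> nat \<times> (int ^ 'n) \<Rightarrow> nat \<Rightarrow> (nat \<times> (int ^ 'n)) set \<Rightarrow> bool"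
  where "slab_pieces c e \<nu> \<gamma> D lf P \<longleftrightarrow> finite P \<and> card P = (c ^ (lf - fst D - e)) ^ (CARD('n) - 1) \<and>
    (\<forall>F\<in>P. fst F = lf \<and> closure (cube c F) \<subseteq> cube c D \<and> cube c F \<subseteq> R_approx \<nu> \<gamma>) \<and>
    (\<forall>\<Lambda>. fst \<Lambda> \<le> lf \<longrightarrow> card {F\<in>P. cube c F \<subseteq> cube c \<Lambda>} \<le> (c ^ (lf - fst \<Lambda>)) ^ (CARD('n) - 1))"

text \<open>Every scale keeps half of its cells, although cells meeting a piece of a coarser scale are dropped:
  pieces are thin, so the fraction of cells which they touch decays geometrically in the gap of scales.\<close>

lemma separated_pieces:
  fixes p :: "nat \<times> (int ^ 'n)"
  assumes n: "CARD('n) \<ge> 2" and c: "c \<ge> 2" and \<nu>: "\<nu> > real CARD('n) - 1" and \<gamma>: "\<gamma> > 0"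
    and e: "16 * real CARD('n) \<le> real c ^ e"
  shows "\<exists>a b b' t0 sel P. a \<ge> 1 \<and>
     (\<forall>t\<ge>t0. fst p < cell_level CARD('n) a b t \<and> cell_level CARD('n) a b t + e \<le> leaf_level \<nu> a b' t \<and>
       sel t \<subseteq> subcubes c p (cell_level CARD('n) a b t) \<and>
       real c ^ (CARD('n) * (cell_level CARD('n) a b t - fst p)) / 2 \<le> real (card (sel t)) \<and>
       (\<forall>D\<in>sel t. slab_pieces c e \<nu> \<gamma> D (leaf_level \<nu> a b' t) (P t D))) \<and>
     (\<forall>s t D D'. \<forall>F\<in>P s D. t0 \<le> s \<longrightarrow> s < t \<longrightarrow> D \<in> sel s \<longrightarrow> D' \<in> sel t \<longrightarrow> cube c F \<inter> cube c D' = {})"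
proof -
  let ?n = "CARD('n)"
  have c0: "c > 0" and c1: "real c > 1" using c by auto
  have cp: "real c ^ m > 0" for m using c0 by simp
  \<comment> \<open>The gap \<open>a\<close> between scales controls the loss due to cell sides:
    \<open>48 * n \<le> c ^ a\<close> gives \<open>2 * y \<le> 1 / (24 * n)\<close> for the ratio
    \<open>y\<close> of consecutive cell sides defined below.\<close>
  obtain a0 where a0: "48 * real ?n < real c ^ a0" using real_arch_pow[OF c1] by blast
  define a where "a = Suc a0"
  have a: "48 * real ?n \<le> real c ^ a" "a \<ge> 1"
  proof -
    have "real c ^ a0 \<le> real c ^ a" using c1 by (intro power_increasing) (auto simp: a_def)
    then show "48 * real ?n \<le> real c ^ a" using a0 by linarith
  qed (simp add: a_def)
  obtain b k0 where ub: "\<And>k. k \<ge> k0 \<Longrightarrow> fst p + b \<le> ?n * k \<and>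
    real (card {D \<in> subcubes c p (?n * k - b). \<not> (\<exists>q i. near_hyperplane c (c ^ k) D q i)})
      \<le> real c ^ (?n * (?n * k - b - fst p)) / 4"
    using ubiquity[OF n c, of p] by blast
  \<comment> \<open>Leaves \<open>b'\<close> levels deeper absorb the factor
    \<open>n powr (\<nu> + 1) / \<gamma>\<close>, as required by
    \<open>hyperplane_pieces\<close>.\<close>
  obtain b' where b': "real ?n powr (\<nu> + 1) / \<gamma> < real c ^ b'" using real_arch_pow[OF c1] by blast
  \<comment> \<open>The condition on \<open>\<nu>\<close> enters as \<open>\<theta> > 0\<close>: the
    ratio of leaf side to cell side at scale \<open>t\<close> is at most \<open>x ^ t\<close> with
    \<open>x < 1\<close>.\<close>
  define \<theta> where "\<theta> = \<nu> + 1 - real ?n"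
  have \<theta>: "\<theta> > 0" using \<nu> by (simp add: \<theta>_def)
  define x where "x = real c powr (- \<theta> * real a)"
  have x: "0 < x" "x < 1"
    using c1 \<theta> a(2) by (auto simp: x_def powr_less_one mult_neg_pos)
  define j where "j t = cell_level ?n a b t" for t
  define lf where "lf t = leaf_level \<nu> a b' t" for t
  \<comment> \<open>This limit determines \<open>t0\<close>: from there on the tail of the series of
    \<open>x ^ s\<close> is below \<open>1 / (24 * n)\<close>, and leaves are at least
    \<open>e\<close> levels deeper than cells.\<close>
  have x_lim: "(\<lambda>t. x ^ t) \<longlonglongrightarrow> 0" using x by (intro LIMSEQ_realpow_zero) auto
  have "\<forall>\<^sub>F t in sequentially. x ^ t < (1 - x) / (24 * real ?n)"
    using x by (intro order_tendstoD(2)[OF x_lim]) auto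
  moreover have "\<forall>\<^sub>F t in sequentially. x ^ t < 1 / real c ^ e"
    using cp by (intro order_tendstoD(2)[OF x_lim]) auto
  moreover have "\<forall>\<^sub>F t in sequentially. t \<ge> k0 + fst p + b + 1" by (rule eventually_ge_at_top)
  ultimately have "\<forall>\<^sub>F t in sequentially. x ^ t < (1 - x) / (24 * real ?n) \<and> x ^ t < 1 / real c ^ e \<and> t \<ge> k0 + fst p + b + 1"
    by eventually_elim auto
  then obtain t0 where t0: "x ^ t < (1 - x) / (24 * real ?n)" "x ^ t < 1 / real c ^ e" "t \<ge> k0 + fst p + b + 1"
    if "t \<ge> t0" for t unfolding eventually_sequentially by blast
  have big: "t \<le> a * t" "2 * (a * t) \<le> ?n * (a * t)" for t using a(2) n by auto
  have jt: "fst p < j t" "j t + b = ?n * (a * t)" "a * t \<ge> k0" if "t \<ge> t0" for t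
    using t0(3)[OF that] big[of t] unfolding j_def cell_level_def by linarith+
  have ratio: "real c ^ j t / real c ^ lf t \<le> x ^ t" if "t \<ge> t0" for t
  proof -
    have "real (lf t) \<ge> (\<nu> + 1) * real (a * t)"
      unfolding lf_def leaf_level_def using \<nu> by linarith
    moreover have "real (j t) \<le> real ?n * real (a * t)"
    proof -
      have "j t \<le> ?n * (a * t)" by (simp add: j_def cell_level_def)
      then show ?thesis by (metis of_nat_le_iff of_nat_mult)
    qed
    ultimately have "real (j t) - real (lf t) \<le> - \<theta> * real a * real t"
      by (simp add: \<theta>_def algebra_simps)
    then have "real c powr (real (j t) - real (lf t)) \<le> real c powr (- \<theta> * real a * real t)"
      using c1 by (intro powr_mono) auto
    moreover have "x ^ t = real c powr (- \<theta> * real a * real t)"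
    proof -
      have "x ^ t = x powr real t" using x by (simp add: powr_realpow)
      then show ?thesis by (simp add: x_def powr_powr)
    qed
    ultimately show ?thesis
      using c0 by (simp add: powr_diff powr_realpow)
  qed
  have jl: "j t + e \<le> lf t" if "t \<ge> t0" for t
  proof -
    have "real c ^ j t / real c ^ lf t < 1 / real c ^ e" using ratio[OF that] t0(2)[OF that] by linarith
    then have "real c ^ (j t + e) < real c ^ lf t" using cp by (simp add: power_add field_simps)
    then show ?thesis using c1 by simp
  qed
  have Npow: "(real ?n * real (c ^ (a * t))) powr (\<nu> + 1) / real c ^ lf t < \<gamma>" for t
  proof -
    have "real (lf t) \<ge> (\<nu> + 1) * real (a * t) + real b'"
      unfolding lf_def leaf_level_def using \<nu> by linarith
    then have "real c powr ((\<nu> + 1) * real (a * t) + real b') \<le> real c powr real (lf t)"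
      using c1 by (intro powr_mono) auto
    then have 1: "real c powr ((\<nu> + 1) * real (a * t)) * real c ^ b' \<le> real c ^ lf t"
      using c0 by (simp add: powr_add powr_realpow)
    have 2: "real (c ^ (a * t)) powr (\<nu> + 1) = real c powr ((\<nu> + 1) * real (a * t))"
      using c0 by (simp add: powr_powr mult.commute flip: powr_realpow)
    have "(real ?n * real (c ^ (a * t))) powr (\<nu> + 1) = real ?n powr (\<nu> + 1) * real c powr ((\<nu> + 1) * real (a * t))"
      by (simp only: 2 powr_mult of_nat_0_le_iff)
    also have "\<dots> < (\<gamma> * real c ^ b') * real c powr ((\<nu> + 1) * real (a * t))"
      using b' \<gamma> c0 by (intro mult_strict_right_mono) (auto simp: field_simps)
    also have "\<dots> \<le> \<gamma> * real c ^ lf t" using 1 \<gamma> by (simp add: mult_ac)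
    finally show ?thesis using cp by (simp add: pos_divide_less_eq)
  qed
  define good where "good t = {D \<in> subcubes c p (j t). \<exists>q i. near_hyperplane c (c ^ (a * t)) D q i}" for t
  \<comment> \<open>Compared with \<open>slab_pieces\<close>, this keeps the slab inequality, from
    which the number of touched cells is derived.\<close>
  define \<Phi> where "\<Phi> t D q i P \<longleftrightarrow> finite P \<and> card P = (c ^ (lf t - fst D - e)) ^ (?n - 1) \<and>
    (\<forall>F\<in>P. fst F = lf t \<and> closure (cube c F) \<subseteq> cube c D \<and> cube c F \<subseteq> R_approx \<nu> \<gamma> \<and>
       (\<forall>y\<in>cube c F. \<bar>of_int_vec q \<bullet> y\<bar> \<le> real ?n * \<bar>real_of_int (q $ i)\<bar> / real c ^ lf t)) \<and>
    (\<forall>\<Lambda>. fst \<Lambda> \<le> lf t \<longrightarrow> card {F\<in>P. cube c F \<subseteq> cube c \<Lambda>} \<le> (c ^ (lf t - fst \<Lambda>)) ^ (?n - 1))"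
    for t and D :: "nat \<times> (int ^ 'n)" and q i P
  have "\<exists>q i P. near_hyperplane c (c ^ (a * t)) D q i \<and> \<Phi> t D q i P" if tD: "t \<ge> t0" "D \<in> good t" for t D
  proof -
    obtain q i where near: "near_hyperplane c (c ^ (a * t)) D q i" using tD(2) by (auto simp: good_def)
    have "fst D = j t" using tD(2) by (auto simp: good_def subcubes_def)
    then have "fst D + e \<le> lf t" using jl[OF tD(1)] by simp
    have "\<exists>P. \<Phi> t D q i P"
      unfolding \<Phi>_def by (rule hyperplane_pieces[OF c near e \<open>fst D + e \<le> lf t\<close> Npow]) (use \<nu> in simp)
    then show ?thesis using near by blast
  qed
  then obtain q i P where "\<And>t D. t \<ge> t0 \<Longrightarrow> D \<in> good t \<Longrightarrow>
    near_hyperplane c (c ^ (a * t)) D (q t D) (i t D) \<and> \<Phi> t D (q t D) (i t D) (P t D)" by metis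
  note qiP = this[unfolded \<Phi>_def]
  define touch where "touch t s D0 = {D. fst D = j t \<and> (\<exists>F\<in>P s D0. cube c F \<inter> cube c D \<noteq> {})}" for t s D0
  \<comment> \<open>A cell is dropped when it is touched by a piece of any good cell of an earlier
    scale, whether or not that cell was itself selected. The selection is thus not recursive, and
    its size can be estimated scale by scale.\<close>
  define sel where "sel t = good t - (\<Union>s\<in>{t0..<t}. \<Union>D0\<in>good s. touch t s D0)" for t
  have jmono: "j s \<le> j t" if "s \<le> t" for s t
    using that by (auto simp: j_def cell_level_def intro!: diff_le_mono mult_le_mono)
  have goodlev: "fst D = j t" if "D \<in> good t" for D t using that by (auto simp: good_def subcubes_def)
  define y where "y = 1 / real c ^ (?n * a)"
  have y: "0 \<le> y" "y \<le> 1 / 2" "2 * y \<le> 1 / (24 * real ?n)"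
  proof -
    have "real c ^ a \<le> real c ^ (?n * a)" using c1 by (intro power_increasing) auto
    then have 1: "48 * real ?n \<le> real c ^ (?n * a)" using a(1) by linarith
    then have "y \<le> 1 / (48 * real ?n)"
      unfolding y_def using c0 by (intro divide_left_mono) auto
    then show "2 * y \<le> 1 / (24 * real ?n)" by simp
    have "2 \<le> real c ^ (?n * a)" using 1 n by linarith
    then show "y \<le> 1 / 2" unfolding y_def using c0 by (intro divide_left_mono) auto
  qed (simp add: y_def)
  have jratio: "real c ^ j s / real c ^ j t = y ^ (t - s)" if st: "t0 \<le> s" "s \<le> t" for s t
  proof -
    have "j t = j s + ?n * a * (t - s)"
    proof -
      have "?n * (a * t) = ?n * (a * s) + ?n * a * (t - s)"
      proof -
        obtain d where "t = s + d" using st(2) le_Suc_ex by blast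
        then show ?thesis by (simp add: distrib_left)
      qed
      then show ?thesis using jt(2)[of s] jt(2)[of t] st by simp
    qed
    then show ?thesis using cp by (simp add: y_def power_add power_one_over power_mult)
  qed
  have selcard: "real c ^ (?n * (j t - fst p)) / 2 \<le> real (card (sel t))" if t: "t \<ge> t0" for t
  proof -
    define Z where "Z = real c ^ (?n * (j t - fst p))"
    have fin: "finite (subcubes c p (j t))" and card: "real (card (subcubes c p (j t))) = Z"
      using finite_subcubes[OF c0, of p "j t"] card_subcubes[OF c0, of p "j t"] jt(1)[OF t]
      by (auto simp: Z_def mult.commute)
    define U where "U = (\<Union>s\<in>{t0..<t}. \<Union>D0\<in>good s. touch t s D0)"
    have goodfin: "finite (good s)" if "s \<ge> t0" for s
      using finite_subcubes[OF c0, of p "j s"] jt(1)[OF that] by (auto simp: good_def)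
    have touch1: "finite (touch t s D0)" "real (card (touch t s D0)) \<le> (real c ^ (j t - j s)) ^ ?n * (3 * real ?n * (x ^ s + y ^ (t - s)))"
      if s: "s \<in> {t0..<t}" and D0: "D0 \<in> good s" for s D0
    proof -
      have s': "t0 \<le> s" "s \<le> t" using s by auto
      note Q = qiP[OF s'(1) D0]
      have nh: "near_hyperplane c (c ^ (a * s)) D0 (q s D0) (i s D0)" using Q by blast
      have 1: "q s D0 $ i s D0 \<noteq> 0" "\<And>l. \<bar>q s D0 $ l\<bar> \<le> \<bar>q s D0 $ i s D0\<bar>"
        using nh by (auto simp: near_hyperplane_def)
      have 2: "fst D0 \<le> j t" using goodlev[OF D0] jmono[OF s'(2)] by simp
      have 3: "cube c F \<subseteq> cube c D0" if "F \<in> P s D0" for F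
        using Q that closure_subset[of "cube c F"] by blast
      have 4: "\<bar>of_int_vec (q s D0) \<bullet> y\<bar> \<le> real ?n * \<bar>real_of_int (q s D0 $ i s D0)\<bar> / real c ^ lf s"
        if "F \<in> P s D0" "y \<in> cube c F" for F y
        using Q that by blast
      note tc = touched_count[OF c 2 1 3 4]
      show "finite (touch t s D0)" unfolding touch_def by (rule tc(2))
      have "real (card (touch t s D0)) \<le> (real c ^ (j t - j s)) ^ ?n * (3 * real ?n * (real c ^ j s / real c ^ lf s + real c ^ j s / real c ^ j t))"
        using tc(1) unfolding touch_def goodlev[OF D0] .
      also have "\<dots> \<le> (real c ^ (j t - j s)) ^ ?n * (3 * real ?n * (x ^ s + y ^ (t - s)))"
        using ratio[OF s'(1)] jratio[OF s'] by (intro mult_left_mono add_mono) auto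
      finally show "real (card (touch t s D0)) \<le> (real c ^ (j t - j s)) ^ ?n * (3 * real ?n * (x ^ s + y ^ (t - s)))" .
    qed
    have finU: "finite U" unfolding U_def using touch1(1) goodfin by (intro finite_UN_I) auto
    have "card U \<le> (\<Sum>s\<in>{t0..<t}. card (\<Union>D0\<in>good s. touch t s D0))"
      unfolding U_def by (rule card_UN_le) simp
    also have "\<dots> \<le> (\<Sum>s\<in>{t0..<t}. \<Sum>D0\<in>good s. card (touch t s D0))"
      using goodfin by (intro sum_mono card_UN_le) auto
    finally have "real (card U) \<le> (\<Sum>s\<in>{t0..<t}. \<Sum>D0\<in>good s. real (card (touch t s D0)))"
      unfolding of_nat_sum[symmetric] of_nat_le_iff .
    also have "\<dots> \<le> (\<Sum>s\<in>{t0..<t}. Z * (3 * real ?n * (x ^ s + y ^ (t - s))))"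
    proof (rule sum_mono)
      fix s assume s: "s \<in> {t0..<t}"
      define B where "B = 3 * real ?n * (x ^ s + y ^ (t - s))"
      have B: "B \<ge> 0" using x y by (simp add: B_def)
      have "(\<Sum>D0\<in>good s. real (card (touch t s D0))) \<le> (\<Sum>D0\<in>good s. (real c ^ (j t - j s)) ^ ?n * B)"
        unfolding B_def using touch1(2)[OF s] by (intro sum_mono)
      also have "\<dots> = real (card (good s)) * ((real c ^ (j t - j s)) ^ ?n * B)" by simp
      also have "\<dots> \<le> real (c ^ ((j s - fst p) * ?n)) * ((real c ^ (j t - j s)) ^ ?n * B)"
      proof (rule mult_right_mono)
        have "card (good s) \<le> card (subcubes c p (j s))"
          unfolding good_def using finite_subcubes[OF c0, of p "j s"] jt(1)[of s] s by (intro card_mono) auto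
        then show "real (card (good s)) \<le> real (c ^ ((j s - fst p) * ?n))"
          using card_subcubes[OF c0, of p "j s"] jt(1)[of s] s by simp
        show "0 \<le> (real c ^ (j t - j s)) ^ ?n * B" using B by simp
      qed
      also have "real (c ^ ((j s - fst p) * ?n)) * ((real c ^ (j t - j s)) ^ ?n * B) = Z * B"
      proof -
        have "(j s - fst p) * ?n + (j t - j s) * ?n = ?n * (j t - fst p)"
          using jmono[of s t] jt(1)[of s] s by (simp flip: distrib_right)
        then have "real c ^ ((j s - fst p) * ?n) * (real c ^ (j t - j s)) ^ ?n = Z"
          unfolding Z_def by (metis power_add power_mult)
        then show ?thesis by (simp add: mult.assoc)
      qed
      finally show "(\<Sum>D0\<in>good s. real (card (touch t s D0))) \<le> Z * (3 * real ?n * (x ^ s + y ^ (t - s)))"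
        by (simp add: B_def)
    qed
    also have "\<dots> = Z * (3 * real ?n * ((\<Sum>s\<in>{t0..<t}. x ^ s) + (\<Sum>s\<in>{t0..<t}. y ^ (t - s))))"
      by (simp add: sum_distrib_left sum.distrib distrib_left)
    \<comment> \<open>Two sums of at most \<open>1 / (24 * n)\<close> each, times
      \<open>3 * n\<close>, make a quarter. The exceptional cells of \<open>ubiquity\<close> are at
      most another quarter, so half of the cells survive.\<close>
    also have "\<dots> \<le> Z * (3 * real ?n * (1 / (24 * real ?n) + 1 / (24 * real ?n)))"
    proof (intro mult_left_mono add_mono)
      have "(\<Sum>s\<in>{t0..<t}. x ^ s) \<le> x ^ t0 / (1 - x)" using x by (intro sum_geometric_tail_le) auto
      also have "\<dots> \<le> 1 / (24 * real ?n)" using t0(1)[of t0] x by (simp add: field_simps)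
      finally show "(\<Sum>s\<in>{t0..<t}. x ^ s) \<le> 1 / (24 * real ?n)" .
      show "(\<Sum>s\<in>{t0..<t}. y ^ (t - s)) \<le> 1 / (24 * real ?n)"
        using sum_power_diff_le[OF y(1,2), of t t0] y(3) by linarith
    qed (simp_all add: Z_def)
    also have "\<dots> = Z / 4" by simp
    finally have cardU: "real (card U) \<le> Z / 4" .
    define Bad where "Bad = {D \<in> subcubes c p (j t). \<not> (\<exists>q i. near_hyperplane c (c ^ (a * t)) D q i)}"
    have cardBad: "real (card Bad) \<le> Z / 4"
      using ub[OF jt(3)[OF t]] unfolding Bad_def j_def cell_level_def Z_def by blast
    have "subcubes c p (j t) \<subseteq> sel t \<union> (Bad \<union> U)" by (auto simp: sel_def good_def Bad_def U_def)
    then have "card (subcubes c p (j t)) \<le> card (sel t \<union> (Bad \<union> U))"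
      using fin finU goodfin[OF t] by (intro card_mono) (auto simp: sel_def Bad_def)
    also have "\<dots> \<le> card (sel t) + (card Bad + card U)"
      by (meson card_Un_le add_left_mono order_trans)
    finally have "Z \<le> real (card (sel t)) + (real (card Bad) + real (card U))"
      using card by linarith
    then have "Z / 2 \<le> real (card (sel t))" using cardU cardBad by linarith
    then show ?thesis by (simp add: Z_def)
  qed
  show ?thesis
  proof (rule exI[of _ a], rule exI[of _ b], rule exI[of _ b'], rule exI[of _ t0], rule exI[of _ sel],
      rule exI[of _ P], intro conjI allI impI ballI)
    fix t assume t: "t \<ge> t0"
    have "sel t \<subseteq> good t" by (auto simp: sel_def)
    moreover have "good t \<subseteq> subcubes c p (j t)" by (auto simp: good_def)
    moreover have "slab_pieces c e \<nu> \<gamma> D (lf t) (P t D)" if "D \<in> good t" for D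
      using qiP[OF t that] unfolding slab_pieces_def by simp
    ultimately show "fst p < cell_level ?n a b t" "cell_level ?n a b t + e \<le> leaf_level \<nu> a b' t"
      "sel t \<subseteq> subcubes c p (cell_level ?n a b t)"
      "real c ^ (?n * (cell_level ?n a b t - fst p)) / 2 \<le> real (card (sel t))"
      "\<And>D. D \<in> sel t \<Longrightarrow> slab_pieces c e \<nu> \<gamma> D (leaf_level \<nu> a b' t) (P t D)"
      unfolding j_def[symmetric] lf_def[symmetric]
      using jt(1)[OF t] jl[OF t] selcard[OF t] by blast+
  next
    fix s t D D' F assume *: "F \<in> P s D" "t0 \<le> s" "s < t" "D \<in> sel s" "D' \<in> sel t"
    have "D \<in> good s" using *(4) by (simp add: sel_def)
    then have "D' \<notin> touch t s D" using * by (force simp: sel_def)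
    moreover have "fst D' = j t" using *(5) goodlev by (simp add: sel_def)
    ultimately show "cube c F \<inter> cube c D' = {}" using *(1) unfolding touch_def by blast
  qed (rule a(2))
qed

section \<open>Distributing the volume of a cube over pieces of many scales\<close>

lemma sum_UN_le:
  fixes f :: "'a \<Rightarrow> real"
  assumes "finite I" "\<And>i. i \<in> I \<Longrightarrow> finite (A i)" "\<And>i x. i \<in> I \<Longrightarrow> x \<in> A i \<Longrightarrow> 0 \<le> f x"
  shows "sum f (\<Union>i\<in>I. A i) \<le> (\<Sum>i\<in>I. sum f (A i))"
  using assms
proof (induction I rule: finite_induct)
  case (insert i I)
  have "sum f (\<Union>i\<in>insert i I. A i) = sum f (A i \<union> (\<Union>i\<in>I. A i))" by simp
  also have "\<dots> \<le> sum f (A i) + sum f (\<Union>i\<in>I. A i)"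
  proof -
    have fin: "finite (A i)" "finite (\<Union>i\<in>I. A i)" using insert by auto
    have "0 \<le> sum f (A i \<inter> (\<Union>i\<in>I. A i))" using insert.prems(2) by (intro sum_nonneg) auto
    then show ?thesis using sum.union_inter[OF fin, of f] by linarith
  qed
  also have "sum f (\<Union>i\<in>I. A i) \<le> (\<Sum>i\<in>I. sum f (A i))"
    using insert.prems by (intro insert.IH) auto
  finally show ?case using insert by simp
qed simp

text \<open>A cube \<open>\<Lambda>\<close> smaller than the cells containing it meets the pieces of a single cell only, since the
  cells of finer scales avoid those pieces: this accounts for the second term of the bound. Its
  factor \<open>\<epsilon>\<close> comes from dividing by the total mass, which the divergence makes as large as desired.\<close>

lemma cube_mass_distribution:
  fixes h :: "real \<Rightarrow> real"
  assumes n: "CARD('n) \<ge> 2" and c: "c \<ge> 2" and \<nu>: "\<nu> > real CARD('n) - 1"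
    and h0: "\<forall>r. 0 < r \<longrightarrow> r \<le> \<eta> \<longrightarrow> 0 < h r"
    and hmono: "\<forall>r r'. 0 < r \<longrightarrow> r \<le> r' \<longrightarrow> r' \<le> \<eta> \<longrightarrow> h r \<le> h r'"
    and diverge: "\<forall>a b b' t0 S. 1 \<le> a \<longrightarrow> (\<exists>T. S \<le>
       (\<Sum>t\<in>{t0..<T}. h (1 / real c ^ leaf_level \<nu> a b' t) * real c ^ cell_level CARD('n) a b t))"
  shows "\<exists>C>0. \<forall>(p :: nat \<times> (int ^ 'n)) \<gamma> \<epsilon>. 0 < \<gamma> \<longrightarrow> 0 < \<epsilon> \<longrightarrow> 1 / real c ^ fst p \<le> \<eta> \<longrightarrow>
    (\<exists>P w. finite P \<and> disjoint_cubes c P \<and> sum w P = 1 / (real c ^ fst p) ^ CARD('n) \<and>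
      (\<forall>F\<in>P. 0 \<le> w F \<and> fst p < fst F \<and> closure (cube c F) \<subseteq> cube c p \<and> cube c F \<subseteq> R_approx \<nu> \<gamma>) \<and>
      (\<forall>\<Lambda>. fst p \<le> fst \<Lambda> \<longrightarrow> sum w {F\<in>P. cube c F \<subseteq> cube c \<Lambda>} \<le>
         C * (1 / (real c ^ fst \<Lambda>) ^ CARD('n) + \<epsilon> * (h (1 / real c ^ fst \<Lambda>) / (real c ^ fst \<Lambda>) ^ (CARD('n) - 1)))))"
proof -
  let ?n = "CARD('n)"
  note h0 = h0[rule_format] and hmono = hmono[rule_format] and diverge = diverge[rule_format]
  have c0: "c > 0" and c1: "real c > 1" using c by auto
  have cp: "real c ^ m > 0" for m using c0 by simp
  obtain e where e: "16 * real ?n < real c ^ e" using real_arch_pow[OF c1] by blast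
  \<comment> \<open>\<open>K\<close> is the number of windows that would fill the cross-section of a
    cell, so only the fraction \<open>1 / K\<close> of its columns carries a piece. The 2 in
    \<open>2 * K\<close> stands for the half of the cells that were selected.\<close>
  define K where "K = (real c ^ e) ^ (?n - 1)"
  have K: "K > 0" using cp by (simp add: K_def)
  show ?thesis
  proof (intro exI[of _ "2 * K"] conjI allI impI)
    show "0 < 2 * K" using K by simp
    fix p :: "nat \<times> (int ^ 'n)" and \<gamma> \<epsilon> :: real
    assume \<gamma>: "0 < \<gamma>" and \<epsilon>: "0 < \<epsilon>" and p: "1 / real c ^ fst p \<le> \<eta>"
    obtain a b b' t0 sel P where a: "a \<ge> 1" and
      *: "\<forall>t\<ge>t0. fst p < cell_level ?n a b t \<and> cell_level ?n a b t + e \<le> leaf_level \<nu> a b' t \<and>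
         sel t \<subseteq> subcubes c p (cell_level ?n a b t) \<and>
         real c ^ (?n * (cell_level ?n a b t - fst p)) / 2 \<le> real (card (sel t)) \<and>
         (\<forall>D\<in>sel t. slab_pieces c e \<nu> \<gamma> D (leaf_level \<nu> a b' t) (P t D))" and
      sep0: "\<forall>s t D D'. \<forall>F\<in>P s D. t0 \<le> s \<longrightarrow> s < t \<longrightarrow> D \<in> sel s \<longrightarrow> D' \<in> sel t \<longrightarrow> cube c F \<inter> cube c D' = {}"
      using separated_pieces[OF n c \<nu> \<gamma> less_imp_le[OF e], of p] by (elim exE conjE) (rule that)
    have sep: "cube c F \<inter> cube c D' = {}" if "F \<in> P s D" "t0 \<le> s" "s < t" "D \<in> sel s" "D' \<in> sel t" for s t D D' F
      using sep0 that by blast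
    define j where "j t = cell_level ?n a b t" for t
    define lf where "lf t = leaf_level \<nu> a b' t" for t
    have jt: "fst p < j t" "j t + e \<le> lf t" "sel t \<subseteq> subcubes c p (j t)"
      "real c ^ (?n * (j t - fst p)) / 2 \<le> real (card (sel t))"
      and SP: "\<And>D. D \<in> sel t \<Longrightarrow> slab_pieces c e \<nu> \<gamma> D (lf t) (P t D)" if "t0 \<le> t" for t
      using * that unfolding j_def lf_def by blast+
    have sellev: "fst D = j t" "cube c D \<subseteq> cube c p" if "t0 \<le> t" "D \<in> sel t" for t D
      using jt(3)[OF that(1)] that(2) by (auto simp: subcubes_def)
    have Pcard: "card (P t D) = (c ^ (lf t - j t - e)) ^ (?n - 1)" if "t0 \<le> t" "D \<in> sel t" for t D
      using SP[OF that] sellev(1)[OF that] by (simp add: slab_pieces_def)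
    have Pfin: "finite (P t D)"
      and Plev: "\<And>F. F \<in> P t D \<Longrightarrow> fst F = lf t"
      and Pclo: "\<And>F. F \<in> P t D \<Longrightarrow> closure (cube c F) \<subseteq> cube c D"
      and PR: "\<And>F. F \<in> P t D \<Longrightarrow> cube c F \<subseteq> R_approx \<nu> \<gamma>"
      and Ploc: "\<And>\<Lambda>. fst \<Lambda> \<le> lf t \<Longrightarrow> card {F\<in>P t D. cube c F \<subseteq> cube c \<Lambda>} \<le> (c ^ (lf t - fst \<Lambda>)) ^ (?n - 1)"
      if "t0 \<le> t" "D \<in> sel t" for t D
      using SP[OF that] unfolding slab_pieces_def by blast+
    have Psub: "cube c F \<subseteq> cube c D" if "t0 \<le> t" "D \<in> sel t" "F \<in> P t D" for t D F
      using Pclo[OF that] closure_subset[of "cube c F"] by blast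
    have selfin: "finite (sel t)" if "t0 \<le> t" for t
      using finite_subset[OF jt(3)[OF that]] finite_subcubes[OF c0] jt(1)[OF that] by (meson less_imp_le)
    obtain T where T: "1 / \<epsilon> \<le> (\<Sum>t\<in>{t0..<T}. h (1 / real c ^ lf t) * real c ^ j t)"
      using diverge[OF a] unfolding j_def lf_def by blast
    define I where "I = {t0..<T}"
    define S where "S = (\<Sum>t\<in>I. h (1 / real c ^ lf t) * real c ^ j t)"
    have S: "1 / \<epsilon> \<le> S" using T by (simp add: S_def I_def)
    have S0: "S > 0" using S \<epsilon> by (meson less_le_trans zero_less_divide_1_iff)
    have It: "t0 \<le> t" if "t \<in> I" for t using that by (simp add: I_def)
    \<comment> \<open>The value of \<open>r ^ (n - 1) * h r\<close> at the side \<open>r\<close> of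
      a cube of level \<open>l\<close>. A leaf has this weight before normalisation.\<close>
    define u where "u l = h (1 / real c ^ l) / (real c ^ l) ^ (?n - 1)" for l
    have small: "0 < 1 / real c ^ l" "1 / real c ^ l \<le> \<eta>" if "fst p \<le> l" for l
    proof -
      have "real c ^ fst p \<le> real c ^ l" using that c1 by (intro power_increasing) auto
      then have "1 / real c ^ l \<le> 1 / real c ^ fst p" using cp by (intro divide_left_mono) auto
      then show "1 / real c ^ l \<le> \<eta>" using p by linarith
    qed (use cp in simp)
    have u0: "0 \<le> u l" if "fst p \<le> l" for l
      using h0[OF small[OF that]] cp by (simp add: u_def)
    have lfp: "fst p \<le> lf t" if "t \<in> I" for t using jt(1,2)[OF It[OF that]] by simp
    define Q where "Q = (\<Union>t\<in>I. \<Union>D\<in>sel t. P t D)"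
    define w0 where "w0 F = u (fst F)" for F :: "nat \<times> (int ^ 'n)"
    have QI: "\<exists>t\<in>I. \<exists>D\<in>sel t. F \<in> P t D" if "F \<in> Q" for F using that by (auto simp: Q_def)
    have w00: "0 \<le> w0 F" if "F \<in> Q" for F
      using QI[OF that] Plev u0 lfp It unfolding w0_def by metis
    have finQ: "finite Q" unfolding Q_def using selfin Pfin It by (intro finite_UN_I) (auto simp: I_def)
    \<comment> \<open>If the scales differed, the finer cell would meet a piece of the coarser scale
      and would have been dropped. At equal scales, two cells with a common point coincide.\<close>
    have uniq: "t = t' \<and> D = D'" if tt: "t \<in> I" "D \<in> sel t" "F \<in> P t D" "t' \<in> I" "D' \<in> sel t'"
      "F' \<in> P t' D'" "cube c F \<inter> cube c D' \<noteq> {}" "cube c F' \<inter> cube c D \<noteq> {}" for t D t' D' F F'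
    proof -
      have "t = t'"
        using sep[of F t D t' D'] sep[of F' t' D' t D] tt It[OF tt(1)] It[OF tt(4)]
        by (meson linorder_less_linear)
      moreover obtain x where "x \<in> cube c F" "x \<in> cube c D'" using tt(7) by blast
      moreover have "cube c F \<subseteq> cube c D" using Psub[OF It[OF tt(1)] tt(2,3)] .
      ultimately show ?thesis
        using sellev(1)[OF It[OF tt(1)] tt(2)] sellev(1)[OF It[OF tt(4)] tt(5)]
        by (metis cube_eqI subsetD)
    qed
    have disj: "disjoint_cubes c Q"
    proof -
      { fix F F' assume F: "F \<in> Q" "F' \<in> Q" and ne: "cube c F \<inter> cube c F' \<noteq> {}"
        obtain t D where tD: "t \<in> I" "D \<in> sel t" "F \<in> P t D" using QI F by blast
        obtain t' D' where tD': "t' \<in> I" "D' \<in> sel t'" "F' \<in> P t' D'" using QI F by blast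
        have "t = t' \<and> D = D'"
          using ne Psub[OF It[OF tD(1)] tD(2,3)] Psub[OF It[OF tD'(1)] tD'(2,3)]
          by (intro uniq[OF tD tD']) blast+
        then have "fst F = fst F'" using Plev[OF It[OF tD(1)] tD(2,3)] Plev[OF It[OF tD'(1)] tD'(2,3)] by simp
        then have "F = F'" using ne cube_eqI by blast }
      then show ?thesis unfolding disjoint_cubes_def by blast
    qed
    define m where "m = 1 / (real c ^ fst p) ^ ?n"
    have sumP: "sum w0 (P t D) = h (1 / real c ^ lf t) / (K * (real c ^ j t) ^ (?n - 1))" if "t \<in> I" "D \<in> sel t" for t D
    proof -
      have "sum w0 (P t D) = real (card (P t D)) * u (lf t)"
        using Plev[OF It[OF that(1)] that(2)] by (simp add: w0_def)
      also have "\<dots> = ((real c ^ (lf t - j t - e)) / real c ^ lf t) ^ (?n - 1) * h (1 / real c ^ lf t)"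
        using Pcard[OF It[OF that(1)] that(2)] by (simp add: u_def power_divide)
      also have "real c ^ (lf t - j t - e) / real c ^ lf t = 1 / (real c ^ e * real c ^ j t)"
      proof -
        have "lf t = (lf t - j t - e) + (e + j t)" using jt(2)[OF It[OF that(1)]] by simp
        then have "real c ^ lf t = real c ^ (lf t - j t - e) * (real c ^ e * real c ^ j t)" by (metis power_add)
        then show ?thesis using c0 by simp
      qed
      finally show ?thesis by (simp add: K_def power_divide power_mult_distrib)
    qed
    \<comment> \<open>The lower bound for the total mass, by which the local bounds will be divided.
      Here \<open>m\<close> is the volume of \<open>cube c p\<close>, which appears because each
      scale selects half of the cells of that cube.\<close>
    have W: "m * S / (2 * K) \<le> sum w0 Q"
    proof -
      have "m * S / (2 * K) = (\<Sum>t\<in>I. m * (h (1 / real c ^ lf t) * real c ^ j t) / (2 * K))"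
        by (simp add: S_def sum_distrib_left sum_divide_distrib)
      also have "\<dots> \<le> (\<Sum>t\<in>I. \<Sum>D\<in>sel t. sum w0 (P t D))"
      proof (rule sum_mono)
        fix t assume t: "t \<in> I"
        have h: "0 < h (1 / real c ^ lf t)" using h0 small lfp[OF t] by blast
        have "m * (h (1 / real c ^ lf t) * real c ^ j t) / (2 * K) =
           (real c ^ (?n * (j t - fst p)) / 2) * (h (1 / real c ^ lf t) / (K * (real c ^ j t) ^ (?n - 1)))"
        proof -
          have 1: "real c ^ (?n * (j t - fst p)) * (real c ^ fst p) ^ ?n = (real c ^ j t) ^ ?n"
            using jt(1)[OF It[OF t]]
            by (simp add: mult.commute[of _ "(real c ^ fst p) ^ ?n"] mult.commute[of ?n] power_mult
                flip: power_mult_distrib power_add)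
          have 2: "(real c ^ j t) ^ ?n = real c ^ j t * (real c ^ j t) ^ (?n - 1)"
            using n by (simp add: power_eq_if)
          have 3: "m * real c ^ j t = real c ^ (?n * (j t - fst p)) / (real c ^ j t) ^ (?n - 1)"
            using 1 2 cp[of "j t"] cp[of "fst p"] by (simp add: m_def divide_eq_eq eq_divide_eq)
          have "m * (h (1 / real c ^ lf t) * real c ^ j t) / (2 * K) = (m * real c ^ j t) * h (1 / real c ^ lf t) / (2 * K)"
            by (simp only: mult_ac)
          then show ?thesis unfolding 3 by simp
        qed
        also have "\<dots> \<le> real (card (sel t)) * (h (1 / real c ^ lf t) / (K * (real c ^ j t) ^ (?n - 1)))"
          using jt(4)[OF It[OF t]] h K cp by (intro mult_right_mono) auto
        also have "\<dots> = (\<Sum>D\<in>sel t. sum w0 (P t D))" using sumP[OF t] by simp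
        finally show "m * (h (1 / real c ^ lf t) * real c ^ j t) / (2 * K) \<le> (\<Sum>D\<in>sel t. sum w0 (P t D))" .
      qed
      also have "\<dots> = (\<Sum>t\<in>I. sum w0 (\<Union>D\<in>sel t. P t D))"
      proof (rule sum.cong[OF refl], rule sum.UNION_disjoint[symmetric])
        fix t assume t: "t \<in> I"
        show "finite (sel t)" using selfin It t by blast
        show "\<forall>D\<in>sel t. finite (P t D)" using Pfin It t by blast
        show "\<forall>D\<in>sel t. \<forall>D'\<in>sel t. D \<noteq> D' \<longrightarrow> P t D \<inter> P t D' = {}"
        proof (intro ballI impI, rule ccontr)
          fix D D' assume D: "D \<in> sel t" "D' \<in> sel t" "D \<noteq> D'" "P t D \<inter> P t D' \<noteq> {}"
          then obtain F where F: "F \<in> P t D" "F \<in> P t D'" by blast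
          have "cube c F \<inter> cube c D' \<noteq> {}" "cube c F \<inter> cube c D \<noteq> {}"
            using Psub[OF It[OF t] D(1) F(1)] Psub[OF It[OF t] D(2) F(2)] cube_ne[OF c0, of F] by blast+
          then show False using uniq[OF t D(1) F(1) t D(2) F(2)] D(3) by blast
        qed
      qed
      also have "\<dots> = sum w0 Q"
        unfolding Q_def
      proof (rule sum.UNION_disjoint[symmetric])
        show "\<forall>t\<in>I. finite (\<Union>D\<in>sel t. P t D)" using selfin Pfin It by blast
        show "\<forall>t\<in>I. \<forall>t'\<in>I. t \<noteq> t' \<longrightarrow> (\<Union>D\<in>sel t. P t D) \<inter> (\<Union>D\<in>sel t'. P t' D) = {}"
        proof (intro ballI impI, rule ccontr)
          fix t t' assume t: "t \<in> I" "t' \<in> I" "t \<noteq> t'" "(\<Union>D\<in>sel t. P t D) \<inter> (\<Union>D\<in>sel t'. P t' D) \<noteq> {}"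
          then obtain F D D' where D: "D \<in> sel t" "D' \<in> sel t'" and F: "F \<in> P t D" "F \<in> P t' D'" by blast
          have "cube c F \<inter> cube c D' \<noteq> {}" "cube c F \<inter> cube c D \<noteq> {}"
            using Psub[OF It[OF t(1)] D(1) F(1)] Psub[OF It[OF t(2)] D(2) F(2)] cube_ne[OF c0, of F] by blast+
          then show False using uniq[OF t(1) D(1) F(1) t(2) D(2) F(2)] t(3) by blast
        qed
      qed (simp add: I_def)
      finally show ?thesis .
    qed
    have m0: "m > 0" using cp by (simp add: m_def)
    have W0: "sum w0 Q > 0" using W m0 S0 K by (meson less_le_trans divide_pos_pos mult_pos_pos zero_less_numeral)
    define w where "w F = w0 F * (m / sum w0 Q)" for F
    \<comment> \<open>Pieces inside \<open>\<Lambda>\<close> come from cells inside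
      \<open>\<Lambda>\<close> (\<open>Q1\<close>) or from a cell which contains
      \<open>\<Lambda>\<close> (\<open>Q2\<close>). The former are bounded by counting all subcubes,
      hence in proportion to volume; the latter by counting the columns of
      \<open>\<Lambda>\<close>.\<close>
    have local: "sum w0 {F\<in>Q. cube c F \<subseteq> cube c \<Lambda>} \<le> S / (real c ^ fst \<Lambda>) ^ ?n + u (fst \<Lambda>)" if \<Lambda>: "fst p \<le> fst \<Lambda>" for \<Lambda>
    proof -
      define I1 where "I1 = {t\<in>I. fst \<Lambda> \<le> j t}"
      define Q1 where "Q1 = (\<Union>t\<in>I1. \<Union>D\<in>sel t \<inter> subcubes c \<Lambda> (j t). P t D)"
      define Q2 where "Q2 = {F. cube c F \<subseteq> cube c \<Lambda> \<and> (\<exists>t\<in>I. j t < fst \<Lambda> \<and> (\<exists>D\<in>sel t. F \<in> P t D))}"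
      have meet: "\<exists>x. x \<in> cube c D \<and> x \<in> cube c \<Lambda>" if "t \<in> I" "D \<in> sel t" "F \<in> P t D" "cube c F \<subseteq> cube c \<Lambda>" for t D F
        using Psub[OF It[OF that(1)] that(2,3)] that(4) cube_ne[OF c0, of F] by blast
      have sub: "{F\<in>Q. cube c F \<subseteq> cube c \<Lambda>} \<subseteq> Q1 \<union> Q2"
      proof
        fix F assume F: "F \<in> {F\<in>Q. cube c F \<subseteq> cube c \<Lambda>}"
        then obtain t D where tD: "t \<in> I" "D \<in> sel t" "F \<in> P t D" using QI by blast
        show "F \<in> Q1 \<union> Q2"
        proof (cases "fst \<Lambda> \<le> j t")
          case True
          obtain x where "x \<in> cube c D" "x \<in> cube c \<Lambda>" using meet[OF tD] F by blast
          then have "D \<in> subcubes c \<Lambda> (j t)"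
            using cube_nested[OF c0, of \<Lambda> D x] sellev(1)[OF It[OF tD(1)] tD(2)] True by (simp add: subcubes_def)
          then show ?thesis using tD True unfolding Q1_def I1_def by blast
        next
          case False
          then show ?thesis using tD F unfolding Q2_def by (auto simp: not_le)
        qed
      qed
      have Q12: "Q1 \<subseteq> Q" "Q2 \<subseteq> Q" unfolding Q1_def Q2_def Q_def I1_def by blast+
      have fin12: "finite Q1" "finite Q2" using Q12 finQ finite_subset by auto
      have "sum w0 Q1 \<le> (\<Sum>t\<in>I1. sum w0 (\<Union>D\<in>sel t \<inter> subcubes c \<Lambda> (j t). P t D))"
        unfolding Q1_def
      proof (rule sum_UN_le)
        show "finite I1" by (simp add: I1_def I_def)
        show "finite (\<Union>D\<in>sel t \<inter> subcubes c \<Lambda> (j t). P t D)" if "t \<in> I1" for t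
          using that selfin[of t] Pfin[of t] It[of t] unfolding I1_def by blast
        show "0 \<le> w0 F" if "t \<in> I1" "F \<in> (\<Union>D\<in>sel t \<inter> subcubes c \<Lambda> (j t). P t D)" for t F
          using that unfolding I1_def Q_def by (intro w00) (unfold Q_def, blast)
      qed
      also have "\<dots> \<le> (\<Sum>t\<in>I1. \<Sum>D\<in>sel t \<inter> subcubes c \<Lambda> (j t). sum w0 (P t D))"
      proof (rule sum_mono, rule sum_UN_le)
        fix t assume t: "t \<in> I1"
        then have tI: "t \<in> I" by (simp add: I1_def)
        show "finite (sel t \<inter> subcubes c \<Lambda> (j t))" using selfin[OF It[OF tI]] by simp
        show "finite (P t D)" if "D \<in> sel t \<inter> subcubes c \<Lambda> (j t)" for D
          using that Pfin[OF It[OF tI]] by blast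
        show "0 \<le> w0 F" if "D \<in> sel t \<inter> subcubes c \<Lambda> (j t)" "F \<in> P t D" for D F
          using that tI by (intro w00) (unfold Q_def, blast)
      qed
      also have "\<dots> \<le> (\<Sum>t\<in>I1. h (1 / real c ^ lf t) * real c ^ j t / (real c ^ fst \<Lambda>) ^ ?n)"
      proof (rule sum_mono)
        fix t assume t: "t \<in> I1"
        then have tI: "t \<in> I" and tj: "fst \<Lambda> \<le> j t" by (auto simp: I1_def)
        define A where "A = h (1 / real c ^ lf t) / (K * (real c ^ j t) ^ (?n - 1))"
        have h: "0 < h (1 / real c ^ lf t)" using h0 small lfp[OF tI] by blast
        have A: "0 \<le> A" using h K cp by (simp add: A_def)
        have K1: "1 \<le> K" unfolding K_def using c1 by (simp add: one_le_power)
        have "(\<Sum>D\<in>sel t \<inter> subcubes c \<Lambda> (j t). sum w0 (P t D)) = real (card (sel t \<inter> subcubes c \<Lambda> (j t))) * A"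
          using sumP[OF tI] by (simp add: A_def)
        also have "\<dots> \<le> real (card (subcubes c \<Lambda> (j t))) * A"
          using A finite_subcubes[OF c0 tj] by (intro mult_right_mono) (auto intro: card_mono)
        also have "\<dots> = (real c ^ (j t - fst \<Lambda>)) ^ ?n * A"
          using card_subcubes[OF c0 tj] by (simp add: power_mult)
        also have "\<dots> \<le> (real c ^ (j t - fst \<Lambda>)) ^ ?n * (h (1 / real c ^ lf t) / (real c ^ j t) ^ (?n - 1))"
        proof (rule mult_left_mono)
          have "h (1 / real c ^ lf t) / (K * (real c ^ j t) ^ (?n - 1)) \<le> h (1 / real c ^ lf t) / (1 * (real c ^ j t) ^ (?n - 1))"
            using h K1 K cp by (intro divide_left_mono mult_right_mono) auto
          then show "A \<le> h (1 / real c ^ lf t) / (real c ^ j t) ^ (?n - 1)" by (simp add: A_def)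
        qed simp
        also have "\<dots> = h (1 / real c ^ lf t) * real c ^ j t / (real c ^ fst \<Lambda>) ^ ?n"
        proof -
          have 1: "(real c ^ (j t - fst \<Lambda>)) ^ ?n * (real c ^ fst \<Lambda>) ^ ?n = (real c ^ j t) ^ ?n"
            using tj by (simp flip: power_mult_distrib power_add)
          have 2: "(real c ^ j t) ^ ?n = real c ^ j t * (real c ^ j t) ^ (?n - 1)"
            using n by (simp add: power_eq_if)
          have 3: "(real c ^ (j t - fst \<Lambda>)) ^ ?n / (real c ^ j t) ^ (?n - 1) = real c ^ j t / (real c ^ fst \<Lambda>) ^ ?n"
            using 1 2 cp[of "j t"] cp[of "fst \<Lambda>"] by (simp add: divide_eq_eq eq_divide_eq)
          have "(real c ^ (j t - fst \<Lambda>)) ^ ?n * (h (1 / real c ^ lf t) / (real c ^ j t) ^ (?n - 1)) =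
            h (1 / real c ^ lf t) * ((real c ^ (j t - fst \<Lambda>)) ^ ?n / (real c ^ j t) ^ (?n - 1))" by simp
          then show ?thesis unfolding 3 by simp
        qed
        finally show "(\<Sum>D\<in>sel t \<inter> subcubes c \<Lambda> (j t). sum w0 (P t D)) \<le> h (1 / real c ^ lf t) * real c ^ j t / (real c ^ fst \<Lambda>) ^ ?n" .
      qed
      also have "\<dots> \<le> (\<Sum>t\<in>I. h (1 / real c ^ lf t) * real c ^ j t / (real c ^ fst \<Lambda>) ^ ?n)"
      proof (rule sum_mono2)
        fix t assume "t \<in> I - I1"
        then have "0 < h (1 / real c ^ lf t)" using h0 small lfp by blast
        then show "0 \<le> h (1 / real c ^ lf t) * real c ^ j t / (real c ^ fst \<Lambda>) ^ ?n" using cp by simp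
      qed (auto simp: I1_def I_def)
      also have "\<dots> = S / (real c ^ fst \<Lambda>) ^ ?n" by (simp add: S_def sum_divide_distrib)
      finally have B1: "sum w0 Q1 \<le> S / (real c ^ fst \<Lambda>) ^ ?n" .
      have B2: "sum w0 Q2 \<le> u (fst \<Lambda>)"
      proof (cases "Q2 = {}")
        case True
        then show ?thesis using u0[OF \<Lambda>] by simp
      next
        case False
        then obtain F0 t D where F0: "cube c F0 \<subseteq> cube c \<Lambda>" "F0 \<in> P t D" and tD: "t \<in> I" "j t < fst \<Lambda>" "D \<in> sel t"
          unfolding Q2_def by blast
        have \<Lambda>D: "cube c \<Lambda> \<subseteq> cube c D'" if t'D': "t' \<in> I" "j t' < fst \<Lambda>" "D' \<in> sel t'" "F \<in> P t' D'" "cube c F \<subseteq> cube c \<Lambda>" for t' D' F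
        proof -
          obtain x where "x \<in> cube c D'" "x \<in> cube c \<Lambda>" using meet[OF t'D'(1,3,4,5)] by blast
          then show ?thesis
            using cube_nested[OF c0, of D' \<Lambda> x] sellev(1)[OF It[OF t'D'(1)] t'D'(3)] t'D'(2) by simp
        qed
        have lfF: "fst F0 = lf t" using Plev[OF It[OF tD(1)] tD(3) F0(2)] .
        have \<Lambda>lf: "fst \<Lambda> \<le> lf t" using cube_subset_level[OF c F0(1)] lfF by simp
        have "Q2 \<subseteq> {F\<in>P t D. cube c F \<subseteq> cube c \<Lambda>}"
        proof
          fix F assume F: "F \<in> Q2"
          then obtain t' D' where t'D': "t' \<in> I" "j t' < fst \<Lambda>" "D' \<in> sel t'" "F \<in> P t' D'" and F\<Lambda>: "cube c F \<subseteq> cube c \<Lambda>"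
            unfolding Q2_def by blast
          have "cube c F \<inter> cube c D \<noteq> {}"
            using \<Lambda>D[OF tD(1,2,3) F0(2,1)] F\<Lambda> cube_ne[OF c0, of F] by blast
          moreover have "cube c F0 \<inter> cube c D' \<noteq> {}"
            using \<Lambda>D[OF t'D' F\<Lambda>] F0(1) cube_ne[OF c0, of F0] by blast
          ultimately have "t = t' \<and> D = D'" using uniq[OF tD(1,3) F0(2) t'D'(1,3,4)] by blast
          then show "F \<in> {F\<in>P t D. cube c F \<subseteq> cube c \<Lambda>}" using t'D' F\<Lambda> by blast
        qed
        note Q2sub = this
        have PQ: "P t D \<subseteq> Q" using tD unfolding Q_def by blast
        have "sum w0 Q2 \<le> sum w0 {F\<in>P t D. cube c F \<subseteq> cube c \<Lambda>}"
        proof (rule sum_mono2[OF _ Q2sub])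
          show "finite {F\<in>P t D. cube c F \<subseteq> cube c \<Lambda>}" using Pfin[OF It[OF tD(1)] tD(3)] by simp
          show "0 \<le> w0 F" if "F \<in> {F\<in>P t D. cube c F \<subseteq> cube c \<Lambda>} - Q2" for F
            using that PQ by (intro w00) blast
        qed
        also have "\<dots> = real (card {F\<in>P t D. cube c F \<subseteq> cube c \<Lambda>}) * u (lf t)"
          using Plev[OF It[OF tD(1)] tD(3)] by (simp add: w0_def)
        also have "\<dots> \<le> real ((c ^ (lf t - fst \<Lambda>)) ^ (?n - 1)) * u (lf t)"
          using Ploc[OF It[OF tD(1)] tD(3) \<Lambda>lf] u0[OF lfp[OF tD(1)]]
          by (intro mult_right_mono) (simp_all only: of_nat_le_iff)
        also have "\<dots> = (real c ^ (lf t - fst \<Lambda>) / real c ^ lf t) ^ (?n - 1) * h (1 / real c ^ lf t)"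
          by (simp add: u_def power_divide)
        also have "real c ^ (lf t - fst \<Lambda>) / real c ^ lf t = 1 / real c ^ fst \<Lambda>"
          using \<Lambda>lf cp c0 by (simp add: power_diff)
        \<comment> \<open>The number of columns has replaced the leaf side by the side of
          \<open>\<Lambda>\<close> in the power \<open>n - 1\<close>; monotonicity of
          \<open>h\<close> does the same in the remaining factor.\<close>
        also have "(1 / real c ^ fst \<Lambda>) ^ (?n - 1) * h (1 / real c ^ lf t) \<le> (1 / real c ^ fst \<Lambda>) ^ (?n - 1) * h (1 / real c ^ fst \<Lambda>)"
        proof (rule mult_left_mono)
          have "1 / real c ^ lf t \<le> 1 / real c ^ fst \<Lambda>"
            using \<Lambda>lf c1 by (intro divide_left_mono power_increasing) auto
          then show "h (1 / real c ^ lf t) \<le> h (1 / real c ^ fst \<Lambda>)"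
            using small[OF \<Lambda>] small[OF lfp[OF tD(1)]] by (intro hmono) auto
        qed simp
        finally show ?thesis by (simp add: u_def power_divide)
      qed
      have "sum w0 {F\<in>Q. cube c F \<subseteq> cube c \<Lambda>} \<le> sum w0 (Q1 \<union> Q2)"
      proof (rule sum_mono2[OF _ sub])
        show "finite (Q1 \<union> Q2)" using fin12 by simp
        show "0 \<le> w0 F" if "F \<in> Q1 \<union> Q2 - {F\<in>Q. cube c F \<subseteq> cube c \<Lambda>}" for F
          using that Q12 by (intro w00) blast
      qed
      also have "\<dots> \<le> sum w0 Q1 + sum w0 Q2"
      proof -
        have "0 \<le> sum w0 (Q1 \<inter> Q2)" using Q12 w00 by (intro sum_nonneg) blast
        then show ?thesis using sum.union_inter[OF fin12, of w0] by linarith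
      qed
      finally show ?thesis using B1 B2 by linarith
    qed
    show "\<exists>P w. finite P \<and> disjoint_cubes c P \<and> sum w P = 1 / (real c ^ fst p) ^ ?n \<and>
      (\<forall>F\<in>P. 0 \<le> w F \<and> fst p < fst F \<and> closure (cube c F) \<subseteq> cube c p \<and> cube c F \<subseteq> R_approx \<nu> \<gamma>) \<and>
      (\<forall>\<Lambda>. fst p \<le> fst \<Lambda> \<longrightarrow> sum w {F\<in>P. cube c F \<subseteq> cube c \<Lambda>} \<le>
         2 * K * (1 / (real c ^ fst \<Lambda>) ^ ?n + \<epsilon> * (h (1 / real c ^ fst \<Lambda>) / (real c ^ fst \<Lambda>) ^ (?n - 1))))"
    proof (rule exI[of _ Q], rule exI[of _ w], intro conjI ballI allI impI)
      show "finite Q" by (rule finQ)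
      show "disjoint_cubes c Q" by (rule disj)
      have "sum w Q = sum w0 Q * (m / sum w0 Q)" unfolding w_def by (rule sum_distrib_right[symmetric])
      then show "sum w Q = 1 / (real c ^ fst p) ^ ?n" using W0 by (simp add: m_def)
    next
      fix F assume F: "F \<in> Q"
      obtain t D where tD: "t \<in> I" "D \<in> sel t" "F \<in> P t D" using QI[OF F] by blast
      note t = It[OF tD(1)]
      show "0 \<le> w F" using w00[OF F] m0 W0 by (simp add: w_def)
      show "fst p < fst F" using Plev[OF t tD(2,3)] jt(1,2)[OF t] by simp
      show "closure (cube c F) \<subseteq> cube c p" using Pclo[OF t tD(2,3)] sellev(2)[OF t tD(2)] by blast
      show "cube c F \<subseteq> R_approx \<nu> \<gamma>" by (rule PR[OF t tD(2,3)])
    next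
      fix \<Lambda> :: "nat \<times> (int ^ 'n)" assume \<Lambda>: "fst p \<le> fst \<Lambda>"
      let ?Y = "1 / (real c ^ fst \<Lambda>) ^ ?n"
      have "m / sum w0 Q \<le> 2 * K / S"
      proof -
        have "m * S \<le> 2 * K * sum w0 Q" using W K by (simp add: pos_divide_le_eq mult.commute)
        then show ?thesis using W0 S0 by (simp add: divide_le_eq le_divide_eq mult.commute)
      qed
      moreover have nn: "0 \<le> S / (real c ^ fst \<Lambda>) ^ ?n + u (fst \<Lambda>)" using S0 cp u0[OF \<Lambda>] by simp
      moreover have "sum w {F\<in>Q. cube c F \<subseteq> cube c \<Lambda>} = sum w0 {F\<in>Q. cube c F \<subseteq> cube c \<Lambda>} * (m / sum w0 Q)"
        unfolding w_def by (rule sum_distrib_right[symmetric])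
      moreover have "\<dots> \<le> (S / (real c ^ fst \<Lambda>) ^ ?n + u (fst \<Lambda>)) * (m / sum w0 Q)"
        using local[OF \<Lambda>] m0 W0 by (intro mult_right_mono) auto
      ultimately have "sum w {F\<in>Q. cube c F \<subseteq> cube c \<Lambda>} \<le> (S / (real c ^ fst \<Lambda>) ^ ?n + u (fst \<Lambda>)) * (2 * K / S)"
        by (smt (verit) mult_left_mono)
      also have "\<dots> = 2 * K * (?Y + (1 / S) * u (fst \<Lambda>))" using S0 by (simp add: distrib_left distrib_right add_divide_distrib)
      also have "\<dots> \<le> 2 * K * (?Y + \<epsilon> * u (fst \<Lambda>))"
      proof (intro mult_left_mono add_left_mono mult_right_mono)
        show "1 / S \<le> \<epsilon>" using S S0 \<epsilon> by (simp add: field_simps)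
      qed (use K u0[OF \<Lambda>] in auto)
      finally show "sum w {F\<in>Q. cube c F \<subseteq> cube c \<Lambda>} \<le>
         2 * K * (?Y + \<epsilon> * (h (1 / real c ^ fst \<Lambda>) / (real c ^ fst \<Lambda>) ^ (?n - 1)))"
        by (simp add: u_def)
    qed
  qed
qed

section \<open>Condensation of the approximation sum\<close>

text \<open>Cauchy condensation in base \<open>B\<close> for terms which are nonnegative and
  nonincreasing only from \<open>m\<close> on, so blocks are taken from \<open>B ^ i0\<close>. The
  block from \<open>B ^ I\<close> has at most \<open>B ^ Suc I\<close> terms, none larger than its
  first.\<close>

lemma condensation_upper:
  fixes f :: "nat \<Rightarrow> real"
  assumes B: "B \<ge> 2" and m: "m \<le> B ^ i0"
    and f0: "\<And>k. m \<le> k \<Longrightarrow> 0 \<le> f k" and anti: "\<And>k k'. m \<le> k \<Longrightarrow> k \<le> k' \<Longrightarrow> f k' \<le> f k"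
    and sum: "summable (\<lambda>i. real B ^ i * f (B ^ i))"
  shows "summable f"
proof -
  have Bm: "m \<le> B ^ i" if "i0 \<le> i" for i
  proof -
    have "B ^ i0 \<le> B ^ i" using B that by (intro power_increasing) auto
    then show ?thesis using m by simp
  qed
  have step: "(\<Sum>k\<in>{B ^ i0..<B ^ I}. f k) \<le> real B * (\<Sum>i\<in>{i0..<I}. real B ^ i * f (B ^ i))" if "i0 \<le> I" for I
    using that
  proof (induction I rule: dec_induct)
    case (step I)
    have le: "B ^ i0 \<le> B ^ I" "B ^ I \<le> B ^ Suc I" using B step by (auto intro: power_increasing)
    have "(\<Sum>k\<in>{B ^ I..<B ^ Suc I}. f k) \<le> (\<Sum>k\<in>{B ^ I..<B ^ Suc I}. f (B ^ I))"
      using Bm[OF step(1)] by (intro sum_mono anti) auto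
    also have "\<dots> = real (B ^ Suc I - B ^ I) * f (B ^ I)" by simp
    also have "\<dots> \<le> real (B ^ Suc I) * f (B ^ I)"
      using f0[OF Bm[OF step(1)]] by (intro mult_right_mono of_nat_mono diff_le_self)
    finally have "(\<Sum>k\<in>{B ^ I..<B ^ Suc I}. f k) \<le> real B * (real B ^ I * f (B ^ I))" by (simp add: mult_ac)
    moreover have "(\<Sum>k\<in>{B ^ i0..<B ^ Suc I}. f k) = (\<Sum>k\<in>{B ^ i0..<B ^ I}. f k) + (\<Sum>k\<in>{B ^ I..<B ^ Suc I}. f k)"
      by (rule sum.atLeastLessThan_concat[OF le, symmetric])
    ultimately show ?case using step(1,3) by (simp add: distrib_left)
  qed simp
  define F where "F = (\<Sum>i. real B ^ (i + i0) * f (B ^ (i + i0)))"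
  have sum': "summable (\<lambda>i. real B ^ (i + i0) * f (B ^ (i + i0)))"
    using sum by (subst summable_iff_shift)
  have "(\<Sum>i\<in>{i0..<I}. real B ^ i * f (B ^ i)) \<le> F" for I
  proof -
    have "(\<Sum>i\<in>{i0..<I}. real B ^ i * f (B ^ i)) = (\<Sum>i<I - i0. real B ^ (i + i0) * f (B ^ (i + i0)))"
      by (rule sum.reindex_bij_witness[of _ "\<lambda>i. i + i0" "\<lambda>i. i - i0"]) auto
    also have "\<dots> \<le> F" unfolding F_def using f0 Bm by (intro sum_le_suminf[OF sum']) auto
    finally show ?thesis .
  qed
  then have bound: "(\<Sum>k\<in>{B ^ i0..<B ^ I}. f k) \<le> real B * F" if "i0 \<le> I" for I
    using step[OF that] by (meson mult_left_mono of_nat_0_le_iff order_trans)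
  have "summable (\<lambda>k. f (k + B ^ i0))"
  proof (rule summableI_nonneg_bounded)
    show "0 \<le> f (k + B ^ i0)" for k using m by (intro f0) simp
    fix k
    have "k + B ^ i0 < B ^ (k + B ^ i0)" using B by (intro power_gt_expt) simp
    have "(\<Sum>i<k. f (i + B ^ i0)) = (\<Sum>i\<in>{B ^ i0..<k + B ^ i0}. f i)"
      by (rule sum.reindex_bij_witness[of _ "\<lambda>i. i - B ^ i0" "\<lambda>i. i + B ^ i0"]) auto
    also have "\<dots> \<le> (\<Sum>i\<in>{B ^ i0..<B ^ (k + B ^ i0 + i0)}. f i)"
    proof (rule sum_mono2)
      have "B ^ (k + B ^ i0) \<le> B ^ (k + B ^ i0 + i0)" using B by (intro power_increasing) auto
      then show "{B ^ i0..<k + B ^ i0} \<subseteq> {B ^ i0..<B ^ (k + B ^ i0 + i0)}"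
        using \<open>k + B ^ i0 < B ^ (k + B ^ i0)\<close> by auto
    qed (use m f0 in auto)
    also have "\<dots> \<le> real B * F" by (rule bound) simp
    finally show "(\<Sum>i<k. f (i + B ^ i0)) \<le> real B * F" .
  qed
  then show ?thesis by (subst (asm) summable_iff_shift)
qed

text \<open>Each block is compared with the value at its right end. Since \<open>B \<ge> 2\<close>,
  the block before \<open>B ^ Suc I\<close> contains at least half of that many indices, whence the
  factor 2.\<close>

lemma condensation_lower:
  fixes f :: "nat \<Rightarrow> real"
  assumes B: "B \<ge> 2" and m: "m \<le> B ^ i0"
    and f0: "\<And>k. m \<le> k \<Longrightarrow> 0 \<le> f k" and anti: "\<And>k k'. m \<le> k \<Longrightarrow> k \<le> k' \<Longrightarrow> f k' \<le> f k"
    and sum: "summable f"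
  shows "summable (\<lambda>i. real B ^ i * f (B ^ i))"
proof -
  have Bm: "m \<le> B ^ i" if "i0 \<le> i" for i
  proof -
    have "B ^ i0 \<le> B ^ i" using B that by (intro power_increasing) auto
    then show ?thesis using m by simp
  qed
  have step: "(\<Sum>i\<in>{i0..<I}. real B ^ Suc i * f (B ^ Suc i)) \<le> 2 * (\<Sum>k\<in>{B ^ i0..<B ^ I}. f k)" if "i0 \<le> I" for I
    using that
  proof (induction I rule: dec_induct)
    case (step I)
    have le: "B ^ i0 \<le> B ^ I" "B ^ I \<le> B ^ Suc I" using B step by (auto intro: power_increasing)
    have f: "0 \<le> f (B ^ Suc I)" using Bm[of "Suc I"] step(1) by (intro f0) simp
    have "2 * B ^ I \<le> B ^ Suc I" using B by simp
    then have "real (B ^ Suc I) \<le> 2 * real (B ^ Suc I - B ^ I)" by linarith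
    then have "real (B ^ Suc I) * f (B ^ Suc I) \<le> 2 * real (B ^ Suc I - B ^ I) * f (B ^ Suc I)"
      using f by (rule mult_right_mono)
    also have "\<dots> = 2 * (\<Sum>k\<in>{B ^ I..<B ^ Suc I}. f (B ^ Suc I))" by simp
    also have "\<dots> \<le> 2 * (\<Sum>k\<in>{B ^ I..<B ^ Suc I}. f k)"
    proof (intro mult_left_mono sum_mono anti)
      fix k assume "k \<in> {B ^ I..<B ^ Suc I}"
      then show "m \<le> k" "k \<le> B ^ Suc I" using Bm[OF step(1)] by auto
    qed simp
    finally have "real B ^ Suc I * f (B ^ Suc I) \<le> 2 * (\<Sum>k\<in>{B ^ I..<B ^ Suc I}. f k)" by simp
    moreover have "(\<Sum>k\<in>{B ^ i0..<B ^ Suc I}. f k) = (\<Sum>k\<in>{B ^ i0..<B ^ I}. f k) + (\<Sum>k\<in>{B ^ I..<B ^ Suc I}. f k)"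
      by (rule sum.atLeastLessThan_concat[OF le, symmetric])
    ultimately show ?case using step(1,3) by simp
  qed simp
  have sumf: "summable (\<lambda>k. f (k + B ^ i0))" using sum by (subst summable_iff_shift)
  have "summable (\<lambda>i. real B ^ (i + Suc i0) * f (B ^ (i + Suc i0)))"
  proof (rule summableI_nonneg_bounded)
    show "0 \<le> real B ^ (i + Suc i0) * f (B ^ (i + Suc i0))" for i using Bm[of "i + Suc i0"] f0 by simp
    fix I
    have "(\<Sum>i<I. real B ^ (i + Suc i0) * f (B ^ (i + Suc i0))) = (\<Sum>i\<in>{i0..<I + i0}. real B ^ Suc i * f (B ^ Suc i))"
      by (rule sum.reindex_bij_witness[of _ "\<lambda>i. i - i0" "\<lambda>i. i + i0"]) auto
    also have "\<dots> \<le> 2 * (\<Sum>k\<in>{B ^ i0..<B ^ (I + i0)}. f k)" by (rule step) simp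
    also have "(\<Sum>k\<in>{B ^ i0..<B ^ (I + i0)}. f k) = (\<Sum>k<B ^ (I + i0) - B ^ i0. f (k + B ^ i0))"
      by (rule sum.reindex_bij_witness[of _ "\<lambda>i. i + B ^ i0" "\<lambda>i. i - B ^ i0"]) auto
    also have "\<dots> \<le> (\<Sum>k. f (k + B ^ i0))" using m f0 by (intro sum_le_suminf[OF sumf]) auto
    finally show "(\<Sum>i<I. real B ^ (i + Suc i0) * f (B ^ (i + Suc i0))) \<le> 2 * (\<Sum>k. f (k + B ^ i0))" by simp
  qed
  then show ?thesis by (subst (asm) summable_iff_shift)
qed

section \<open>The approximation sum as a series over the scales\<close>

lemma gauge1E:
  assumes "h \<in> gauges 1"
  obtains \<eta> where "0 < \<eta>" "\<And>r. 0 < r \<Longrightarrow> r \<le> \<eta> \<Longrightarrow> 0 < h r"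
    "\<And>r r'. 0 \<le> r \<Longrightarrow> r \<le> r' \<Longrightarrow> r' \<le> \<eta> \<Longrightarrow> h r \<le> h r'"
    "\<And>r r'. 0 < r \<Longrightarrow> r \<le> r' \<Longrightarrow> r' \<le> \<eta> \<Longrightarrow> h r' / r' \<le> h r / r"
    "continuous_on {0..\<eta>} h"
proof -
  obtain \<eta> where \<eta>: "\<eta> > 0" "continuous_on {0..\<eta>} h" "mono_on {0..\<eta>} h" "\<forall>r\<in>{0<..\<eta>}. 0 < h r / r ^ 1"
    "antimono_on {0<..\<eta>} (\<lambda>r. h r / r ^ 1)"
    using assms unfolding gauges_def by blast
  show thesis
  proof (rule that[OF \<eta>(1)])
    show "0 < h r" if "0 < r" "r \<le> \<eta>" for r using \<eta>(4) that by (auto simp: zero_less_divide_iff)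
    show "h r \<le> h r'" if "0 \<le> r" "r \<le> r'" "r' \<le> \<eta>" for r r'
      using monotone_onD[OF \<eta>(3), of r r'] that by auto
    show "h r' / r' \<le> h r / r" if "0 < r" "r \<le> r'" "r' \<le> \<eta>" for r r'
      using monotone_onD[OF \<eta>(5), of r r'] that by auto
  qed (rule \<eta>(2))
qed

lemma powr_minus_tendsto_0:
  assumes "0 < \<beta>"
  shows "(\<lambda>k. real k powr (- \<beta>)) \<longlonglongrightarrow> 0"
  using assms by (intro tendsto_neg_powr[OF _ filterlim_real_sequentially]) simp

lemma powr_minus_small:
  assumes "0 < \<beta>" "0 < (\<eta> :: real)"
  obtains m where "m \<ge> 1" "\<And>k. m \<le> k \<Longrightarrow> 0 < real k powr (- \<beta>) \<and> real k powr (- \<beta>) \<le> \<eta>"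
proof -
  have "\<forall>\<^sub>F k in sequentially. real k powr (- \<beta>) < \<eta>"
    using powr_minus_tendsto_0[OF assms(1)] assms(2) by (rule order_tendstoD)
  then obtain m where m: "\<And>k. m \<le> k \<Longrightarrow> real k powr (- \<beta>) < \<eta>" by (auto simp: eventually_sequentially)
  show thesis by (rule that[of "Suc m"]) (auto intro!: less_imp_le[OF m])
qed

text \<open>From some index on the terms are positive and truncation by \<open>ennreal\<close> is
  invisible. The real series also has a term at \<open>k = 0\<close>, where
  \<open>0 powr _ = 0\<close>; one extra term does not affect convergence.\<close>

lemma approx_sum_finite_iff:
  assumes h: "h \<in> gauges 1" and \<nu>: "0 < \<nu> + 1" and n: "0 < n"
  shows "approx_sum n \<nu> h < \<infinity> \<longleftrightarrow> summable (\<lambda>k. h (real k powr (- ((\<nu> + 1) / real n))))"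
proof -
  define \<beta> where "\<beta> = (\<nu> + 1) / real n"
  have \<beta>: "0 < \<beta>" using \<nu> n by (simp add: \<beta>_def)
  obtain \<eta> where \<eta>: "0 < \<eta>" "\<And>r. 0 < r \<Longrightarrow> r \<le> \<eta> \<Longrightarrow> 0 < h r" using gauge1E[OF h] by metis
  obtain m where m: "m \<ge> 1" "\<And>k. m \<le> k \<Longrightarrow> 0 < real k powr (- \<beta>) \<and> real k powr (- \<beta>) \<le> \<eta>"
    using powr_minus_small[OF \<beta> \<eta>(1)] by metis
  define f where "f k = h (real k powr (- \<beta>))" for k
  have pos: "0 < f k" if "m \<le> k" for k using \<eta>(2) m(2)[OF that] by (simp add: f_def)
  have "approx_sum n \<nu> h = (\<Sum>k. ennreal (max 0 (f (Suc k))))"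
    unfolding approx_sum_def f_def \<beta>_def by (auto simp: max_def ennreal_neg intro!: suminf_cong)
  then have "approx_sum n \<nu> h < \<infinity> \<longleftrightarrow> (\<Sum>k. ennreal (max 0 (f (Suc k)))) \<noteq> top"
    by (simp only: less_top infinity_ennreal_def)
  also have "\<dots> \<longleftrightarrow> summable (\<lambda>k. max 0 (f (Suc k)))"
  proof
    show "summable (\<lambda>k. max 0 (f (Suc k)))" if "(\<Sum>k. ennreal (max 0 (f (Suc k)))) \<noteq> top"
      by (rule summable_suminf_not_top[OF _ that]) simp
    show "(\<Sum>k. ennreal (max 0 (f (Suc k)))) \<noteq> top" if "summable (\<lambda>k. max 0 (f (Suc k)))"
      by (rule ennreal_suminf_neq_top[OF that]) simp
  qed
  also have "\<dots> \<longleftrightarrow> summable (\<lambda>k. f (Suc k))"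
  proof (rule summable_cong)
    show "\<forall>\<^sub>F k in sequentially. max 0 (f (Suc k)) = f (Suc k)"
      unfolding eventually_sequentially using pos by (intro exI[of _ m]) (auto simp: max_def intro: less_imp_le)
  qed
  also have "\<dots> \<longleftrightarrow> summable f" by (rule summable_Suc_iff)
  finally show ?thesis by (simp add: f_def[abs_def] \<beta>_def)
qed

lemma powr_condensed:
  assumes "c \<ge> 2" "0 < n"
  shows "real ((c ^ (n * a)) ^ t) powr (- ((\<nu> + 1) / real n)) = real c powr (- ((\<nu> + 1) * real (a * t)))"
proof -
  have "real ((c ^ (n * a)) ^ t) = real c powr real (n * a * t)"
  proof -
    have "real ((c ^ (n * a)) ^ t) = real c ^ (n * a * t)" by (simp add: power_mult)
    also have "\<dots> = real c powr real (n * a * t)" using assms by (intro powr_realpow[symmetric]) simp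
    finally show ?thesis .
  qed
  then show ?thesis using assms by (simp add: powr_powr mult_ac)
qed

text \<open>Condensation in base \<open>c ^ (n * a)\<close> evaluates the sum at
  \<open>q = N ^ n\<close> for \<open>N = c ^ (a * t)\<close>. There
  \<open>q powr (- ((\<nu> + 1) / n))\<close> is the leaf side
  \<open>N powr (- (\<nu> + 1))\<close>, and the condensation weight is \<open>N ^ n\<close>, the
  reciprocal of the cell side up to a constant.\<close>

lemma approx_sum_condensed:
  assumes h: "h \<in> gauges 1" and \<nu>: "0 < \<nu> + 1" and n: "0 < n" and c: "c \<ge> 2" and a: "a \<ge> 1"
  shows "approx_sum n \<nu> h < \<infinity> \<longleftrightarrow> summable (\<lambda>t. real c ^ (n * (a * t)) * h (real c powr (- ((\<nu> + 1) * real (a * t)))))"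
proof -
  define \<beta> where "\<beta> = (\<nu> + 1) / real n"
  have \<beta>: "0 < \<beta>" using \<nu> n by (simp add: \<beta>_def)
  obtain \<eta> where \<eta>: "0 < \<eta>" "\<And>r. 0 < r \<Longrightarrow> r \<le> \<eta> \<Longrightarrow> 0 < h r"
    "\<And>r r'. 0 \<le> r \<Longrightarrow> r \<le> r' \<Longrightarrow> r' \<le> \<eta> \<Longrightarrow> h r \<le> h r'" using gauge1E[OF h] by metis
  obtain m where m: "m \<ge> 1" "\<And>k. m \<le> k \<Longrightarrow> 0 < real k powr (- \<beta>) \<and> real k powr (- \<beta>) \<le> \<eta>"
    using powr_minus_small[OF \<beta> \<eta>(1)] by metis
  define f where "f k = h (real k powr (- \<beta>))" for k
  define B where "B = c ^ (n * a)"
  have B: "B \<ge> 2"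
  proof -
    have "c ^ 1 \<le> c ^ (n * a)" using c n a by (intro power_increasing) auto
    then show ?thesis using c by (simp add: B_def)
  qed
  have mB: "m \<le> B ^ m" using B power_gt_expt[of B m] by simp
  have f0: "0 \<le> f k" if "m \<le> k" for k using \<eta>(2) m(2)[OF that] by (simp add: f_def less_imp_le)
  have anti: "f k' \<le> f k" if "m \<le> k" "k \<le> k'" for k k'
    unfolding f_def
  proof (rule \<eta>(3))
    show "real k' powr (- \<beta>) \<le> real k powr (- \<beta>)" using that m(1) \<beta> by (intro powr_mono2') auto
  qed (use m(2)[OF that(1)] in auto)
  have "approx_sum n \<nu> h < \<infinity> \<longleftrightarrow> summable f"
    unfolding f_def \<beta>_def by (rule approx_sum_finite_iff[OF h \<nu> n])
  also have "\<dots> \<longleftrightarrow> summable (\<lambda>i. real B ^ i * f (B ^ i))"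
    using condensation_upper[of B m m f, OF B mB f0 anti] condensation_lower[of B m m f, OF B mB f0 anti] by blast
  also have "(\<lambda>i. real B ^ i * f (B ^ i)) = (\<lambda>t. real c ^ (n * (a * t)) * h (real c powr (- ((\<nu> + 1) * real (a * t)))))"
    unfolding f_def \<beta>_def B_def powr_condensed[OF c n] by (simp add: mult.assoc flip: power_mult)
  finally show ?thesis .
qed

section \<open>The divergence case\<close>

text \<open>The offsets \<open>b\<close>, \<open>b'\<close> and the rounding change a condensed term
  by a bounded factor only: as \<open>h r / r\<close> is nonincreasing, dividing the argument by at
  most \<open>c ^ (1 + b')\<close> divides \<open>h\<close> by at most as much.\<close>

lemma leaf_sum_unbounded:
  assumes h: "h \<in> gauges 1" and \<nu>: "0 < \<nu> + 1" and n: "0 < n" and c: "c \<ge> 2" and a: "a \<ge> 1"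
    and div: "approx_sum n \<nu> h = \<infinity>"
  shows "\<exists>T. S \<le> (\<Sum>t\<in>{t0..<T}. h (1 / real c ^ leaf_level \<nu> a b' t) * real c ^ cell_level n a b t)"
proof (rule ccontr)
  define trm where "trm t = h (1 / real c ^ leaf_level \<nu> a b' t) * real c ^ cell_level n a b t" for t
  define cond where "cond t = real c ^ (n * (a * t)) * h (real c powr (- ((\<nu> + 1) * real (a * t))))" for t
  assume "\<not> ?thesis"
  then have "\<not> S \<le> sum trm {t0..<T}" for T unfolding trm_def by blast
  then have bound: "sum trm {t0..<T} \<le> S" for T by (meson linear)
  have c0: "c > 0" and c1: "real c > 1" using c by auto
  have cp: "real c ^ k > 0" for k using c0 by simp
  obtain \<eta> where \<eta>: "0 < \<eta>" "\<And>r. 0 < r \<Longrightarrow> r \<le> \<eta> \<Longrightarrow> 0 < h r"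
    "\<And>r r'. 0 \<le> r \<Longrightarrow> r \<le> r' \<Longrightarrow> r' \<le> \<eta> \<Longrightarrow> h r \<le> h r'"
    "\<And>r r'. 0 < r \<Longrightarrow> r \<le> r' \<Longrightarrow> r' \<le> \<eta> \<Longrightarrow> h r' / r' \<le> h r / r" using gauge1E[OF h] by metis
  define s where "s t = real c powr (- ((\<nu> + 1) * real (a * t)))" for t
  have s0: "0 < s t" for t using c0 by (simp add: s_def)
  have "(\<lambda>t. s t) \<longlonglongrightarrow> 0"
  proof -
    define x where "x = real c powr (- ((\<nu> + 1) * real a))"
    have "0 < x" "x < 1" using c1 \<nu> a by (auto simp: x_def powr_less_one mult_neg_pos)
    then have "(\<lambda>t. x ^ t) \<longlonglongrightarrow> 0" by (intro LIMSEQ_realpow_zero) auto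
    moreover have "x ^ t = s t" for t
    proof -
      have "x ^ t = x powr real t" using \<open>0 < x\<close> by (simp add: powr_realpow)
      then show ?thesis by (simp add: x_def s_def powr_powr mult_ac)
    qed
    ultimately show ?thesis by simp
  qed
  then have "\<forall>\<^sub>F t in sequentially. s t < \<eta>" using \<eta>(1) by (rule order_tendstoD)
  then obtain t2 where t2: "\<And>t. t2 \<le> t \<Longrightarrow> s t < \<eta>" by (auto simp: eventually_sequentially)
  define t1 where "t1 = max t0 t2"
  \<comment> \<open>The 1 in the exponent pays for the ceiling in \<open>leaf_level\<close>.\<close>
  define K where "K = 1 / (real c ^ (1 + b') * real c ^ b)"
  have K0: "K > 0" using c0 by (simp add: K_def)
  have ge: "K * cond t \<le> trm t" and cond0: "0 \<le> cond t" if t: "t1 \<le> t" for t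
  proof -
    have st: "s t \<le> \<eta>" using t2[of t] t by (simp add: t1_def)
    have hs: "0 < h (s t)" by (rule \<eta>(2)[OF s0 st])
    show "0 \<le> cond t" using hs by (simp add: cond_def s_def)
    define r where "r = 1 / real c ^ leaf_level \<nu> a b' t"
    have r0: "0 < r" using cp by (simp add: r_def)
    have rpow: "r = real c powr (- real (leaf_level \<nu> a b' t))"
      using c0 by (simp add: r_def powr_minus powr_realpow inverse_eq_divide)
    have lev: "(\<nu> + 1) * real (a * t) \<le> real (leaf_level \<nu> a b' t)"
      "real (leaf_level \<nu> a b' t) \<le> (\<nu> + 1) * real (a * t) + real (1 + b')"
    proof -
      have "0 \<le> (\<nu> + 1) * real (a * t)" using \<nu> by simp
      then show "(\<nu> + 1) * real (a * t) \<le> real (leaf_level \<nu> a b' t)"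
        "real (leaf_level \<nu> a b' t) \<le> (\<nu> + 1) * real (a * t) + real (1 + b')"
        unfolding leaf_level_def by linarith+
    qed
    have rs: "r \<le> s t" unfolding rpow s_def using lev(1) c1 by (intro powr_mono) auto
    have "s t / real c ^ (1 + b') = real c powr (- ((\<nu> + 1) * real (a * t)) - real (1 + b'))"
      unfolding powr_diff s_def using c0 by (simp add: powr_realpow[symmetric] powr_add)
    also have "\<dots> \<le> r" unfolding rpow using lev(2) c1 by (intro powr_mono) auto
    finally have rs': "s t / real c ^ (1 + b') \<le> r" .
    have "h (s t) / s t \<le> h r / r" by (rule \<eta>(4)[OF r0 rs st])
    then have "h (s t) * (r / s t) \<le> h r" using r0 by (simp add: pos_le_divide_eq)
    moreover have "h (s t) * (1 / real c ^ (1 + b')) \<le> h (s t) * (r / s t)"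
      using rs' hs s0[of t] cp[of "1 + b'"] by (intro mult_left_mono) (auto simp: field_simps)
    ultimately have hr: "h (s t) / real c ^ (1 + b') \<le> h r" by simp
    have "n * (a * t) \<le> cell_level n a b t + b" by (simp add: cell_level_def)
    then have "real c ^ (n * (a * t)) \<le> real c ^ (cell_level n a b t + b)" using c1 by (intro power_increasing) auto
    then have "real c ^ (n * (a * t)) / real c ^ b \<le> real c ^ cell_level n a b t"
      using cp[of b] by (simp add: pos_divide_le_eq power_add)
    then have "(h (s t) / real c ^ (1 + b')) * (real c ^ (n * (a * t)) / real c ^ b) \<le> h r * real c ^ cell_level n a b t"
      using hr hs cp by (intro mult_mono) (auto intro: order_trans[OF _ hr])
    then show "K * cond t \<le> trm t"
      by (simp add: K_def cond_def trm_def s_def r_def mult_ac)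
  qed
  define M where "M = (S - sum trm {t0..<t1}) / K"
  have bound1: "(\<Sum>i<k. cond (i + t1)) \<le> M" for k
  proof -
    have "K * (\<Sum>i<k. cond (i + t1)) = (\<Sum>i<k. K * cond (i + t1))" by (rule sum_distrib_left)
    also have "\<dots> \<le> (\<Sum>i<k. trm (i + t1))" by (intro sum_mono ge) simp
    also have "\<dots> = sum trm {t1..<k + t1}"
      by (rule sum.reindex_bij_witness[of _ "\<lambda>i. i - t1" "\<lambda>i. i + t1"]) auto
    also have "\<dots> = sum trm {t0..<k + t1} - sum trm {t0..<t1}"
      using sum.atLeastLessThan_concat[of t0 t1 "k + t1" "trm"] by (simp add: t1_def)
    also have "\<dots> \<le> S - sum trm {t0..<t1}" using bound[of "k + t1"] by simp
    finally show ?thesis using K0 by (simp add: M_def pos_le_divide_eq mult.commute)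
  qed
  have "summable (\<lambda>i. cond (i + t1))"
    by (rule summableI_nonneg_bounded[OF _ bound1]) (auto intro: cond0)
  then have "summable cond" by (subst (asm) summable_iff_shift)
  then have "approx_sum n \<nu> h < \<infinity>"
    unfolding approx_sum_condensed[OF h \<nu> n c a] cond_def .
  then show False using div by simp
qed

text \<open>If \<open>h r / r\<close> stayed below \<open>M\<close>, the sum would be dominated by a
  multiple of the series of \<open>k powr (- \<beta>)\<close>, which converges because
  \<open>\<beta> = (\<nu> + 1) / n > 1\<close>. Monotonicity of the quotient carries one large value
  to all smaller radii.\<close>

lemma gauge_quotient_unbounded:
  assumes h: "h \<in> gauges 1" and n: "0 < n" and \<nu>: "\<nu> > real n - 1" and div: "approx_sum n \<nu> h = \<infinity>"
  shows "\<exists>\<delta>>0. \<forall>r. 0 < r \<longrightarrow> r \<le> \<delta> \<longrightarrow> M \<le> h r / r"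
proof -
  obtain \<eta> where \<eta>: "0 < \<eta>" "\<And>r. 0 < r \<Longrightarrow> r \<le> \<eta> \<Longrightarrow> 0 < h r"
    "\<And>r r'. 0 < r \<Longrightarrow> r \<le> r' \<Longrightarrow> r' \<le> \<eta> \<Longrightarrow> h r' / r' \<le> h r / r" using gauge1E[OF h] by metis
  define \<beta> where "\<beta> = (\<nu> + 1) / real n"
  have \<beta>: "\<beta> > 1" using \<nu> n by (simp add: \<beta>_def)
  obtain m where m: "m \<ge> 1" "\<And>k. m \<le> k \<Longrightarrow> 0 < real k powr (- \<beta>) \<and> real k powr (- \<beta>) \<le> \<eta>"
    using powr_minus_small[OF _ \<eta>(1), of \<beta>] \<beta> by auto
  have \<nu>1: "0 < \<nu> + 1" using \<nu> by simp
  have "\<exists>r0. 0 < r0 \<and> r0 \<le> \<eta> \<and> M \<le> h r0 / r0"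
  proof (rule ccontr)
    assume "\<not> ?thesis"
    then have "\<not> M \<le> h r / r" if "0 < r" "r \<le> \<eta>" for r using that by blast
    then have lt: "h r \<le> M * r" if "0 < r" "r \<le> \<eta>" for r
      using that by (simp add: not_le pos_divide_less_eq less_imp_le)
    have "summable (\<lambda>k. h (real k powr (- \<beta>)))"
    proof (rule summable_comparison_test)
      show "\<exists>N. \<forall>k\<ge>N. norm (h (real k powr (- \<beta>))) \<le> M * real k powr (- \<beta>)"
        using m \<eta>(2) lt by (intro exI[of _ m]) (auto intro: less_imp_le simp: abs_of_pos)
      show "summable (\<lambda>k. M * real k powr (- \<beta>))"
        using \<beta> by (intro summable_mult) (simp add: summable_real_powr_iff)
    qed
    then show False using approx_sum_finite_iff[OF h \<nu>1 n] div by (simp add: \<beta>_def)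
  qed
  then obtain r0 where r0: "0 < r0" "r0 \<le> \<eta>" "M \<le> h r0 / r0" by blast
  have "M \<le> h r / r" if "0 < r" "r \<le> r0" for r
    using \<eta>(3)[OF that r0(2)] r0(3) by linarith
  then show ?thesis using r0(1) by blast
qed

section \<open>Moving the mass of a cube onto the approximating sets\<close>

lemma disjoint_subcubes: "disjoint_cubes c (subcubes c p j)"
  unfolding disjoint_cubes_def
proof (intro ballI impI, rule ccontr)
  fix p1 p2 assume p: "p1 \<in> subcubes c p j" "p2 \<in> subcubes c p j" "p1 \<noteq> p2" "cube c p1 \<inter> cube c p2 \<noteq> {}"
  then obtain x where x: "x \<in> cube c p1" "x \<in> cube c p2" by blast
  have "fst p1 = fst p2" using p by (simp add: subcubes_def)
  then show False using cube_eqI[OF _ x] p(3) by blast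
qed

text \<open>The mass of \<open>q\<close> is spread evenly over its cubes of a deep level
  \<open>J1\<close>, and in each of these it is moved by \<open>cube_mass_distribution\<close>.
  Either term of the bound there uses up half of the capacity: the volume term because capacity per
  volume is large from \<open>J1\<close> on, the gauge term by the choice of
  \<open>\<epsilon>\<close>.\<close>

lemma splittable_R_approx:
  fixes g h :: "real \<Rightarrow> real"
  assumes n: "CARD('n) \<ge> 2" and c: "c \<ge> 2" and \<nu>: "\<nu> > real CARD('n) - 1" and \<gamma>: "0 < \<gamma>"
    and h: "h \<in> gauges 1" and div: "approx_sum CARD('n) \<nu> h = \<infinity>"
    and g: "g \<in> gauges CARD('n)"
    and comp: "0 < B" "0 < r0" "\<And>r. 0 < r \<Longrightarrow> r \<le> r0 \<Longrightarrow> r ^ (CARD('n) - 1) * h r \<le> B * g r"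
  shows "splittable c (level_gauge TYPE('n) c g) (level_threshold TYPE('n) c g) (R_approx \<nu> \<gamma> :: (real ^ 'n) set)"
proof -
  let ?n = "CARD('n)" and ?G = "level_gauge TYPE('n) c g" and ?J = "level_threshold TYPE('n) c g"
  have c0: "c > 0" and c1: "real c > 1" using c by auto
  have cp: "real c ^ k > 0" for k using c0 by simp
  have \<nu>1: "0 < \<nu> + 1" using \<nu> by simp
  have n0: "0 < ?n" by simp
  obtain \<eta> where \<eta>: "0 < \<eta>" "\<And>r. 0 < r \<Longrightarrow> r \<le> \<eta> \<Longrightarrow> 0 < h r"
    "\<And>r r'. 0 \<le> r \<Longrightarrow> r \<le> r' \<Longrightarrow> r' \<le> \<eta> \<Longrightarrow> h r \<le> h r'" using gauge1E[OF h] by metis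
  have hmono: "\<And>r r'. 0 < r \<Longrightarrow> r \<le> r' \<Longrightarrow> r' \<le> \<eta> \<Longrightarrow> h r \<le> h r'" using \<eta>(3) by simp
  have hpos': "\<forall>r. 0 < r \<longrightarrow> r \<le> \<eta> \<longrightarrow> 0 < h r"
    and hmono': "\<forall>r r'. 0 < r \<longrightarrow> r \<le> r' \<longrightarrow> r' \<le> \<eta> \<longrightarrow> h r \<le> h r'"
    using \<eta>(2) hmono by auto
  have div': "\<forall>a b b' t0 S. 1 \<le> a \<longrightarrow> (\<exists>T. S \<le>
       (\<Sum>t\<in>{t0..<T}. h (1 / real c ^ leaf_level \<nu> a b' t) * real c ^ cell_level ?n a b t))"
    using leaf_sum_unbounded[OF h \<nu>1 n0 c _ div] by blast
  obtain C where C: "C > 0" and blk: "\<forall>(p :: nat \<times> (int ^ 'n)) \<gamma> \<epsilon>. 0 < \<gamma> \<longrightarrow> 0 < \<epsilon> \<longrightarrow> 1 / real c ^ fst p \<le> \<eta> \<longrightarrow>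
    (\<exists>P w. finite P \<and> disjoint_cubes c P \<and> sum w P = 1 / (real c ^ fst p) ^ ?n \<and>
      (\<forall>F\<in>P. 0 \<le> w F \<and> fst p < fst F \<and> closure (cube c F) \<subseteq> cube c p \<and> cube c F \<subseteq> R_approx \<nu> \<gamma>) \<and>
      (\<forall>\<Lambda>. fst p \<le> fst \<Lambda> \<longrightarrow> sum w {F\<in>P. cube c F \<subseteq> cube c \<Lambda>} \<le>
         C * (1 / (real c ^ fst \<Lambda>) ^ ?n + \<epsilon> * (h (1 / real c ^ fst \<Lambda>) / (real c ^ fst \<Lambda>) ^ (?n - 1)))))"
    using cube_mass_distribution[where 'n = 'n, OF n c \<nu> hpos' hmono' div']
    by (elim exE conjE) (rule that)
  define d where "d j = sqrt (real ?n) / real c ^ j" for j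
  have d0: "0 < d j" for j using cp by (simp add: d_def)
  have dn: "1 / real c ^ j \<le> d j" for j unfolding d_def by (intro divide_right_mono) (auto simp: Suc_leI)
  have dsmall: "\<exists>j0. \<forall>j\<ge>j0. d j \<le> e" if "0 < e" for e
    using order_tendstoD(2)[OF diameter_tendsto_0[OF c] that, of ?n]
    by (auto simp: eventually_sequentially d_def intro: less_imp_le)
  show ?thesis
    unfolding splittable_def
  proof (intro allI impI)
    fix q :: "nat \<times> (int ^ 'n)" assume q: "?J \<le> fst q"
    \<comment> \<open>\<open>m\<close> is the density with respect to volume at which
      \<open>cube c q\<close> is exactly saturated.\<close>
    define m where "m = ?G (fst q) * (real c ^ fst q) ^ ?n"
    have m0: "0 < m" using level_gauge_pos[OF c g q] cp by (simp add: m_def)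
    define \<epsilon> where "\<epsilon> = 1 / (2 * m * C * B)"
    have \<epsilon>: "0 < \<epsilon>" using m0 C comp(1) by (simp add: \<epsilon>_def)
    obtain \<delta> where \<delta>: "0 < \<delta>" "\<And>r. 0 < r \<Longrightarrow> r \<le> \<delta> \<Longrightarrow> 2 * m * C * B \<le> h r / r"
      using gauge_quotient_unbounded[OF h n0 \<nu> div, of "2 * m * C * B"] by blast
    obtain j0 where j0: "\<And>j. j0 \<le> j \<Longrightarrow> d j \<le> min (min \<delta> \<eta>) r0"
      using dsmall[of "min (min \<delta> \<eta>) r0"] \<delta>(1) \<eta>(1) comp(2) by auto
    \<comment> \<open>From this level on \<open>h r / r\<close> is so large that capacity per volume
      is at least \<open>2 * m * C\<close>; the comparison of \<open>h\<close> with \<open>g\<close>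
      and the monotonicity of \<open>h\<close> are available too.\<close>
    define J1 where "J1 = max j0 (fst q)"
    have big: "2 * m * C \<le> ?G j * (real c ^ j) ^ ?n" and cmp: "h (1 / real c ^ j) / (real c ^ j) ^ (?n - 1) \<le> B * ?G j"
      if j: "J1 \<le> j" for j
    proof -
      have dj: "d j \<le> \<delta>" "d j \<le> \<eta>" "d j \<le> r0" using j0[of j] j by (auto simp: J1_def)
      have Gd: "d j ^ (?n - 1) * h (d j) \<le> B * ?G j"
        using comp(3)[OF d0 dj(3)] by (simp add: level_gauge_def d_def)
      have dn1: "1 \<le> d j * real c ^ j" using dn[of j] cp[of j] by (simp add: pos_divide_le_eq)
      have "2 * m * C * B * 1 \<le> (h (d j) / d j) * (d j * real c ^ j) ^ ?n"
        using \<delta>(2)[OF d0 dj(1)] dn1 m0 C comp(1) by (intro mult_mono one_le_power) (auto intro: order_trans[rotated])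
      also have "\<dots> = d j ^ (?n - 1) * h (d j) * (real c ^ j) ^ ?n"
      proof -
        have "d j ^ ?n = d j * d j ^ (?n - 1)" by (simp add: power_eq_if)
        then show ?thesis using d0[of j] by (simp add: power_mult_distrib)
      qed
      also have "\<dots> \<le> B * ?G j * (real c ^ j) ^ ?n" by (rule mult_right_mono[OF Gd]) simp
      finally have "B * (2 * m * C) \<le> B * (?G j * (real c ^ j) ^ ?n)" by (simp add: mult_ac)
      then show "2 * m * C \<le> ?G j * (real c ^ j) ^ ?n" using comp(1) by simp
      have "h (1 / real c ^ j) / (real c ^ j) ^ (?n - 1) = (1 / real c ^ j) ^ (?n - 1) * h (1 / real c ^ j)"
        by (simp add: power_divide)
      also have "\<dots> \<le> d j ^ (?n - 1) * h (d j)"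
      proof (rule mult_mono)
        show "(1 / real c ^ j) ^ (?n - 1) \<le> d j ^ (?n - 1)" using dn cp by (intro power_mono) auto
        show "h (1 / real c ^ j) \<le> h (d j)" using dn dj(2) cp by (intro hmono) auto
        show "0 \<le> h (1 / real c ^ j)"
          using \<eta>(2)[of "1 / real c ^ j"] dn[of j] dj(2) cp[of j] by auto
      qed (use d0[of j] in simp)
      finally show "h (1 / real c ^ j) / (real c ^ j) ^ (?n - 1) \<le> B * ?G j" using Gd by linarith
    qed
    have qJ1: "fst q \<le> J1" by (simp add: J1_def)
    have Sfin: "finite (subcubes c q J1)" and Scard: "real (card (subcubes c q J1)) = (real c ^ (J1 - fst q)) ^ ?n"
      using finite_subcubes[OF c0 qJ1] card_subcubes[OF c0 qJ1] by (auto simp: power_mult)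
    \<comment> \<open>Between \<open>q\<close> and level \<open>J1\<close> an even distribution
      respects capacities, since capacity per volume does not decrease with the level; at
      \<open>q\<close> itself equality holds.\<close>
    have msum: "(real c ^ (J1 - fst \<Lambda>)) ^ ?n * (m / (real c ^ J1) ^ ?n) \<le> ?G (fst \<Lambda>)"
      "fst \<Lambda> = fst q \<Longrightarrow> (real c ^ (J1 - fst \<Lambda>)) ^ ?n * (m / (real c ^ J1) ^ ?n) = ?G (fst q)"
      if "fst q \<le> fst \<Lambda>" "fst \<Lambda> \<le> J1" for \<Lambda> :: "nat \<times> (int ^ 'n)"
    proof -
      have "(real c ^ J1) ^ ?n = (real c ^ (J1 - fst \<Lambda>)) ^ ?n * (real c ^ fst \<Lambda>) ^ ?n"
        using that(2) by (simp flip: power_mult_distrib power_add)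
      then have eq: "(real c ^ (J1 - fst \<Lambda>)) ^ ?n * (m / (real c ^ J1) ^ ?n) = m / (real c ^ fst \<Lambda>) ^ ?n"
        using c0 by simp
      have "m \<le> ?G (fst \<Lambda>) * (real c ^ fst \<Lambda>) ^ ?n"
        using level_gauge_mono[OF c g q that(1)] by (simp add: m_def power_mult)
      then show "(real c ^ (J1 - fst \<Lambda>)) ^ ?n * (m / (real c ^ J1) ^ ?n) \<le> ?G (fst \<Lambda>)"
        unfolding eq using cp by (simp add: pos_divide_le_eq)
      show "(real c ^ (J1 - fst \<Lambda>)) ^ ?n * (m / (real c ^ J1) ^ ?n) = ?G (fst q)" if "fst \<Lambda> = fst q"
        unfolding eq using that c0 by (simp add: m_def)
    qed
    define w1 where "w1 = (\<lambda>_ :: nat \<times> (int ^ 'n). m / (real c ^ J1) ^ ?n)"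
    have w1: "0 \<le> m / (real c ^ J1) ^ ?n" using m0 by simp
    have fl: "flow c ?G (fst q) (subcubes c q J1) w1"
      unfolding flow_def
    proof (intro conjI allI impI)
      show "disjoint_cubes c (subcubes c q J1)" by (rule disjoint_subcubes)
      fix \<Lambda> :: "nat \<times> (int ^ 'n)" assume \<Lambda>: "fst q \<le> fst \<Lambda>"
      let ?F = "{p \<in> subcubes c q J1. cube c p \<subseteq> cube c \<Lambda>}"
      show "sum w1 ?F \<le> ?G (fst \<Lambda>)"
      proof (cases "fst \<Lambda> \<le> J1")
        case True
        have "?F \<subseteq> subcubes c \<Lambda> J1" by (auto simp: subcubes_def)
        then have "real (card ?F) \<le> (real c ^ (J1 - fst \<Lambda>)) ^ ?n"
        proof -
          assume sub: "?F \<subseteq> subcubes c \<Lambda> J1"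
          have "real (card ?F) \<le> real (card (subcubes c \<Lambda> J1))"
            by (intro of_nat_mono card_mono finite_subcubes[OF c0 True] sub)
          then show ?thesis using card_subcubes[OF c0 True] by (simp add: power_mult)
        qed
        note cardF = this
        have "sum w1 ?F = real (card ?F) * (m / (real c ^ J1) ^ ?n)" by (simp add: w1_def)
        also have "\<dots> \<le> (real c ^ (J1 - fst \<Lambda>)) ^ ?n * (m / (real c ^ J1) ^ ?n)"
          by (rule mult_right_mono[OF cardF w1])
        finally show ?thesis using msum(1)[OF \<Lambda> True] by linarith
      next
        case False
        have "?F = {}"
        proof -
          { fix p assume "p \<in> ?F"
            then have "fst \<Lambda> \<le> fst p" "fst p = J1" using cube_subset_level[OF c, of p \<Lambda>] by (auto simp: subcubes_def)
            then have False using False by simp }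
          then show ?thesis by blast
        qed
        then show ?thesis using level_gauge_pos[OF c g le_trans[OF q \<Lambda>]] by (simp only: sum.empty)
      qed
    qed (use Sfin w1 qJ1 in \<open>auto simp: subcubes_def w1_def\<close>)
    have sum1: "sum w1 (subcubes c q J1) = ?G (fst q)"
      using msum(2)[OF order_refl qJ1 refl] by (simp add: w1_def Scard del: times_divide_eq_right)
    have "\<exists>P' w'. flow c ?G (fst q) P' w' \<and> sum w' P' = sum w1 (subcubes c q J1) \<and>
      (\<forall>p'\<in>P'. cube c p' \<subseteq> R_approx \<nu> \<gamma> \<and> (\<exists>p\<in>subcubes c q J1. fst p < fst p' \<and> closure (cube c p') \<subseteq> cube c p))"
    proof (rule flow_refine[OF c0 fl])
      fix r assume r: "r \<in> subcubes c q J1"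
      then have rJ1: "fst r = J1" by (simp add: subcubes_def)
      have "1 / real c ^ fst r \<le> \<eta>" using dn[of J1] j0[of J1] rJ1 by (simp add: J1_def)
      from blk[THEN spec, THEN spec, THEN spec, THEN mp, OF \<gamma>, THEN mp, OF \<epsilon>, THEN mp, OF this] obtain P w where P: "finite P" "disjoint_cubes c P" "sum w P = 1 / (real c ^ fst r) ^ ?n"
        "\<forall>F\<in>P. 0 \<le> w F \<and> fst r < fst F \<and> closure (cube c F) \<subseteq> cube c r \<and> cube c F \<subseteq> R_approx \<nu> \<gamma>"
        "\<forall>\<Lambda>. fst r \<le> fst \<Lambda> \<longrightarrow> sum w {F\<in>P. cube c F \<subseteq> cube c \<Lambda>} \<le>
         C * (1 / (real c ^ fst \<Lambda>) ^ ?n + \<epsilon> * (h (1 / real c ^ fst \<Lambda>) / (real c ^ fst \<Lambda>) ^ (?n - 1)))"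
        by (elim exE conjE) (rule that)
      have "flow c ?G (fst r) P (\<lambda>F. m * w F)"
        unfolding flow_def
      proof (intro conjI allI impI)
        fix \<Lambda> :: "nat \<times> (int ^ 'n)" assume \<Lambda>: "fst r \<le> fst \<Lambda>"
        let ?u = "h (1 / real c ^ fst \<Lambda>) / (real c ^ fst \<Lambda>) ^ (?n - 1)"
        have \<Lambda>J: "J1 \<le> fst \<Lambda>" using \<Lambda> rJ1 by simp
        have "sum (\<lambda>F. m * w F) {F\<in>P. cube c F \<subseteq> cube c \<Lambda>} = m * sum w {F\<in>P. cube c F \<subseteq> cube c \<Lambda>}"
          by (rule sum_distrib_left[symmetric])
        also have "\<dots> \<le> m * (C * (1 / (real c ^ fst \<Lambda>) ^ ?n + \<epsilon> * ?u))"
          using P(5)[rule_format, OF \<Lambda>] m0 by (intro mult_left_mono) auto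
        \<comment> \<open>\<open>\<epsilon>\<close> was chosen so that
          \<open>m * C * \<epsilon> = 1 / (2 * B)\<close>.\<close>
        also have "\<dots> = (2 * m * C) / (2 * (real c ^ fst \<Lambda>) ^ ?n) + ?u / (2 * B)"
          using m0 C comp(1) by (simp add: \<epsilon>_def distrib_left)
        also have "\<dots> \<le> ?G (fst \<Lambda>) / 2 + ?G (fst \<Lambda>) / 2"
        proof (rule add_mono)
          have "(2 * m * C) / (2 * (real c ^ fst \<Lambda>) ^ ?n) \<le> (?G (fst \<Lambda>) * (real c ^ fst \<Lambda>) ^ ?n) / (2 * (real c ^ fst \<Lambda>) ^ ?n)"
            by (intro divide_right_mono big[OF \<Lambda>J]) simp
          then show "(2 * m * C) / (2 * (real c ^ fst \<Lambda>) ^ ?n) \<le> ?G (fst \<Lambda>) / 2" using c0 by simp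
          have "?u / (2 * B) \<le> (B * ?G (fst \<Lambda>)) / (2 * B)"
            using comp(1) by (intro divide_right_mono cmp[OF \<Lambda>J]) simp
          then show "?u / (2 * B) \<le> ?G (fst \<Lambda>) / 2" using comp(1) by simp
        qed
        finally show "sum (\<lambda>F. m * w F) {F\<in>P. cube c F \<subseteq> cube c \<Lambda>} \<le> ?G (fst \<Lambda>)" by simp
      qed (use P m0 in \<open>auto intro: less_imp_le\<close>)
      moreover have "sum (\<lambda>F. m * w F) P = w1 r"
        using sum_distrib_left[of m w P] P(3) rJ1 by (simp add: w1_def)
      ultimately show "\<exists>R v. flow c ?G (fst r) R v \<and> sum v R = w1 r \<and>
          (\<forall>p\<in>R. fst r < fst p \<and> closure (cube c p) \<subseteq> cube c r \<and> cube c p \<subseteq> R_approx \<nu> \<gamma>)"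
        using P(4) by blast
    qed
    then obtain P w where P: "flow c ?G (fst q) P w" "sum w P = ?G (fst q)"
      "\<forall>p'\<in>P. cube c p' \<subseteq> R_approx \<nu> \<gamma> \<and> (\<exists>p\<in>subcubes c q J1. fst p < fst p' \<and> closure (cube c p') \<subseteq> cube c p)"
      unfolding sum1 by blast
    have "fst q < fst p \<and> closure (cube c p) \<subseteq> cube c q \<and> cube c p \<subseteq> R_approx \<nu> \<gamma>" if p: "p \<in> P" for p
    proof -
      obtain r where "r \<in> subcubes c q J1" "fst r < fst p" "closure (cube c p) \<subseteq> cube c r" using P(3) p by blast
      then show ?thesis using P(3) p qJ1 by (auto simp: subcubes_def)
    qed
    then show "\<exists>P w. flow c ?G (fst q) P w \<and> sum w P = ?G (fst q) \<and>
       (\<forall>p\<in>P. fst q < fst p \<and> closure (cube c p) \<subseteq> cube c q \<and> cube c p \<subseteq> R_approx \<nu> \<gamma>)"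
      using P by blast
  qed
qed

section \<open>Large intersection in the divergence case\<close>

lemma R_approx_mono: "\<gamma> \<le> \<gamma>' \<Longrightarrow> R_approx \<nu> \<gamma> \<subseteq> R_approx \<nu> \<gamma>'"
  unfolding R_approx_def by (force intro: less_le_trans divide_right_mono)

lemma R_set_seq: "R_set \<nu> = (\<Inter>k. R_approx \<nu> (1 / real (Suc k)))"
proof
  show "(\<Inter>k. R_approx \<nu> (1 / real (Suc k))) \<subseteq> R_set \<nu>"
  proof
    fix x assume x: "x \<in> (\<Inter>k. R_approx \<nu> (1 / real (Suc k)))"
    have "x \<in> R_approx \<nu> \<gamma>" if \<gamma>: "0 < \<gamma>" for \<gamma>
    proof -
      obtain k where "inverse (real (Suc k)) < \<gamma>" using reals_Archimedean[OF \<gamma>] by blast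
      then have "1 / real (Suc k) \<le> \<gamma>" by (simp add: inverse_eq_divide)
      then show ?thesis using x R_approx_mono by blast
    qed
    then show "x \<in> R_set \<nu>" by (simp add: R_set_eq)
  qed
qed (auto simp: R_set_eq)

lemma open_R_approx: "open (R_approx \<nu> \<gamma>)"
proof -
  have "R_approx \<nu> \<gamma> = (\<Union>q\<in>- {0}. {\<omega>. \<bar>of_int_vec q \<bullet> \<omega>\<bar> < \<gamma> / l1_norm (of_int_vec q) powr \<nu>})"
    by (auto simp: R_approx_def)
  also have "open \<dots>" by (intro open_UN ballI open_Collect_less continuous_intros)
  finally show ?thesis .
qed

lemma gdelta_R_set: "gdelta_in euclidean (R_set \<nu>)"
  unfolding R_set_seq using open_R_approx
  by (intro gdelta_in_Inter) (auto intro!: open_imp_gdelta_in)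

lemma Id_times_gauge:
  assumes "h \<in> gauges 1" "n \<ge> 1"
  shows "Id_times (n - 1) h \<in> gauges n"
  using Id_times_in_gauges[OF assms(1), of "n - 1"] assms(2) by simp

lemma gauge_prec_comparable:
  assumes g: "g \<in> gauges N" and prec: "g' \<prec>\<^sub>0 g"
  shows "\<exists>r0>0. \<forall>r. 0 < r \<longrightarrow> r \<le> r0 \<longrightarrow> g r \<le> g' r"
proof -
  have "\<forall>\<^sub>F r in at_right 0. 1 \<le> g' r / g r"
    using prec unfolding gauge_prec_def filterlim_at_top by blast
  then obtain b where b: "b > 0" "\<And>r. 0 < r \<Longrightarrow> r < b \<Longrightarrow> 1 \<le> g' r / g r"
    unfolding eventually_at_right_field by auto
  define r0 where "r0 = min b (gauge_threshold N g) / 2"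
  have "g r \<le> g' r" if "0 < r" "r \<le> r0" for r
  proof -
    have r: "r < b" "r < gauge_threshold N g" using that b(1) gauge_threshold_pos[OF g] by (auto simp: r0_def)
    then have "0 < g r" using gauge_pos[OF g] that by blast
    then show ?thesis using b(2)[OF that(1) r(1)] by (simp add: le_divide_eq)
  qed
  moreover have "0 < r0" using b(1) gauge_threshold_pos[OF g] by (simp add: r0_def)
  ultimately show ?thesis by blast
qed

text \<open>A gauge tested by the class dominates \<open>Id_times (n - 1) h\<close> near zero, so
  one splitting lemma with \<open>B = 1\<close> serves all of them. The intersection over
  \<open>\<gamma> = 1 / (k + 1)\<close> is taken care of by the iteration in
  \<open>flow_cover\<close>.\<close>

lemma R_set_large_intersection:
  fixes V :: "(real ^ 'n) set"
  assumes n: "CARD('n) \<ge> 2" and c: "c \<ge> 2" and \<nu>: "\<nu> > real CARD('n) - 1"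
    and h: "h \<in> gauges 1" and div: "approx_sum CARD('n) \<nu> h = \<infinity>"
  shows "R_set \<nu> \<in> large_intersection_class c (Id_times (CARD('n) - 1) h) V"
  unfolding large_intersection_class_def
proof (intro CollectI conjI ballI impI allI gdelta_R_set)
  fix g U assume g: "g \<in> gauges CARD('n)" and prec: "g \<prec>\<^sub>0 Id_times (CARD('n) - 1) h"
    and U: "open U \<and> U \<subseteq> V"
  have "Id_times (CARD('n) - 1) h \<in> gauges CARD('n)" using n by (intro Id_times_gauge h) simp
  from gauge_prec_comparable[OF this prec] obtain r0 where r0: "r0 > 0"
    "\<And>r. 0 < r \<Longrightarrow> r \<le> r0 \<Longrightarrow> r ^ (CARD('n) - 1) * h r \<le> 1 * g r"
    by (auto simp: Id_times_def)
  have split: "splittable c (level_gauge TYPE('n) c g) (level_threshold TYPE('n) c g) (R_approx \<nu> (1 / real (Suc k)) :: (real ^ 'n) set)" for k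
    by (rule splittable_R_approx[OF n c \<nu> _ h div g zero_less_one r0]) auto
  have "net_measure c g U \<le> net_measure c g (R_set \<nu> \<inter> U)"
    using U R_set_seq[of \<nu>] by (intro net_measure_open_ge[OF c g] net_measure_cube_ge[OF c g split]) auto
  then show "net_measure c g (R_set \<nu> \<inter> U) = net_measure c g U"
    by (intro antisym[OF net_measure_mono]) auto
qed

section \<open>Covers by countably many cubes\<close>

text \<open>Each finite family is padded with empty sets, whose diameter is 0 by convention and
  which therefore cost \<open>g 0 = 0\<close>; the resulting double sequence is enumerated by
  \<open>prod_decode\<close>.\<close>

lemma enumerate_cover:
  fixes \<D> :: "nat \<Rightarrow> (nat \<times> (int ^ 'n)) set"
  assumes fin: "\<And>k. finite (\<D> k)" and g0: "g 0 = 0"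
  shows "\<exists>L. (\<forall>i. L i = {} \<or> (\<exists>k. \<exists>D\<in>\<D> k. L i = cube c D)) \<and>
    (\<Union>k. \<Union>D\<in>\<D> k. cube c D) \<subseteq> (\<Union>i. L i) \<and>
    (\<Sum>i. ennreal (g (diameter (L i)))) = (\<Sum>k. \<Sum>D\<in>\<D> k. ennreal (g (diameter (cube c D))))"
proof -
  have "\<forall>k. \<exists>e. bij_betw e {0..<card (\<D> k)} (\<D> k)" using ex_bij_betw_nat_finite[OF fin] by blast
  then obtain e where e: "\<And>k. bij_betw (e k) {0..<card (\<D> k)} (\<D> k)" by metis
  define M where "M = (\<lambda>(k, i). if i < card (\<D> k) then cube c (e k i) else {})"
  define f where "f ki = ennreal (g (diameter (M ki)))" for ki
  have "(\<Sum>D\<in>\<D> k. ennreal (g (diameter (cube c D)))) = (\<Sum>i. f (k, i))" for k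
  proof -
    have "(\<Sum>i. f (k, i)) = (\<Sum>i\<in>{0..<card (\<D> k)}. f (k, i))"
      by (intro suminf_finite) (auto simp: f_def M_def diameter_def g0)
    also have "\<dots> = (\<Sum>i\<in>{0..<card (\<D> k)}. ennreal (g (diameter (cube c (e k i)))))"
      by (intro sum.cong) (auto simp: f_def M_def)
    also have "\<dots> = (\<Sum>D\<in>\<D> k. ennreal (g (diameter (cube c D))))"
      by (rule sum.reindex_bij_betw[OF e])
    finally show ?thesis by simp
  qed
  then have sum: "(\<Sum>i. f (prod_decode i)) = (\<Sum>k. \<Sum>D\<in>\<D> k. ennreal (g (diameter (cube c D))))"
    by (rule suminf_ennreal_2dimen)
  have "M ki = {} \<or> (\<exists>k. \<exists>D\<in>\<D> k. M ki = cube c D)" for ki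
  proof (cases "snd ki < card (\<D> (fst ki))")
    case True
    then have "e (fst ki) (snd ki) \<in> \<D> (fst ki)" using bij_betwE[OF e] by auto
    then show ?thesis using True by (auto simp: M_def split_beta)
  qed (auto simp: M_def split_beta)
  moreover have "cube c D \<subseteq> (\<Union>i. M (prod_decode i))" if D: "D \<in> \<D> k" for k D
  proof -
    obtain i where i: "i < card (\<D> k)" "D = e k i"
    proof -
      have "D \<in> e k ` {0..<card (\<D> k)}" using D bij_betw_imp_surj_on[OF e[of k]] by simp
      then show ?thesis using that by auto
    qed
    then have "cube c D = M (prod_decode (prod_encode (k, i)))" by (simp add: M_def)
    then show ?thesis by blast
  qed
  ultimately show ?thesis
    using sum unfolding f_def by (intro exI[of _ "\<lambda>i. M (prod_decode i)"] conjI allI UN_least)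
qed

text \<open>Over a distance of \<open>1 / c ^ j\<close> the floor of a scaled coordinate changes by
  at most 1, which leaves three values for each coordinate.\<close>

lemma cover_bounded_by_cubes:
  fixes S :: "(real ^ 'n) set"
  assumes c: "c > 0" and S: "bounded S" "diameter S \<le> 1 / real c ^ j"
  shows "\<exists>P. finite P \<and> card P \<le> 3 ^ CARD('n) \<and> (\<forall>p\<in>P. fst p = j) \<and> S \<subseteq> (\<Union>p\<in>P. cube c p)"
proof (cases "S = {}")
  case True
  then show ?thesis by (intro exI[of _ "{}"]) auto
next
  case False
  then obtain x where x: "x \<in> S" by blast
  have cp: "real c ^ j > 0" using c by simp
  define T where "T i = {\<lfloor>real c ^ j * x $ i\<rfloor> - 1..\<lfloor>real c ^ j * x $ i\<rfloor> + 1}" for i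
  define P where "P = Pair j ` {v :: int ^ 'n. \<forall>i. v $ i \<in> T i}"
  have T: "finite (T i)" "card (T i) = 3" for i by (auto simp: T_def)
  have "finite {v :: int ^ 'n. \<forall>i. v $ i \<in> T i}" "card {v :: int ^ 'n. \<forall>i. v $ i \<in> T i} = 3 ^ CARD('n)"
    using card_vec_box[of T, OF T(1)] T(2) by simp_all
  then have P: "finite P" "card P \<le> 3 ^ CARD('n)" unfolding P_def by (auto intro: order_trans[OF card_image_le])
  have "S \<subseteq> (\<Union>p\<in>P. cube c p)"
  proof
    fix y assume y: "y \<in> S"
    have "index c j y $ i \<in> T i" for i
    proof -
      have "\<bar>y $ i - x $ i\<bar> \<le> dist y x" using component_le_norm_cart[of "y - x" i] by (simp add: dist_norm)
      also have "\<dots> \<le> diameter S" using diameter_bounded_bound[OF S(1) y x] .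
      also have "\<dots> \<le> 1 / real c ^ j" by (rule S(2))
      finally have "real c ^ j * \<bar>y $ i - x $ i\<bar> \<le> 1" using cp by (simp add: pos_le_divide_eq mult.commute)
      then have "\<bar>real c ^ j * y $ i - real c ^ j * x $ i\<bar> \<le> 1"
        by (simp add: abs_mult flip: right_diff_distrib)
      then show ?thesis unfolding T_def index_def vec_lambda_beta atLeastAtMost_iff by linarith
    qed
    then have "(j, index c j y) \<in> P" by (simp add: P_def)
    then show "y \<in> (\<Union>p\<in>P. cube c p)" by (auto simp: mem_cube_index intro!: bexI)
  qed
  then show ?thesis using P by (intro exI[of _ P]) (auto simp: P_def)
qed

section \<open>Arbitrary covers compared with covers by cubes\<close>

lemma gauge_scale:
  assumes g: "g \<in> gauges N" and r: "0 < r" "1 \<le> s" "s * r < gauge_threshold N g"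
  shows "g (s * r) \<le> s ^ N * g r"
proof -
  have "r \<le> s * r" using r by simp
  then have "g (s * r) / (s * r) ^ N \<le> g r / r ^ N" using gauge_antimono[OF g r(1) _ r(3)] by blast
  then show ?thesis using r by (simp add: power_mult_distrib divide_le_eq field_simps)
qed

lemma gauge_tendsto_0:
  assumes "g \<in> gauges N"
  shows "(g \<longlongrightarrow> 0) (at_right 0)"
proof -
  obtain \<epsilon> where \<epsilon>: "\<epsilon> > 0" "continuous_on {0..\<epsilon>} g" "g 0 = 0"
    using assms unfolding gauges_def by blast
  have "(g \<longlongrightarrow> g 0) (at 0 within {0..\<epsilon>})" 
    using \<epsilon>(2)[unfolded continuous_on_def, rule_format, of 0] \<epsilon>(1) by simp
  then show ?thesis using \<epsilon> at_within_Icc_at_right[of 0 \<epsilon>] by simp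
qed

lemma ex_power_bracket:
  assumes c: "c \<ge> 2" and d: "0 < d" "d < 1 / real c ^ J"
  shows "\<exists>j\<ge>J. d \<le> 1 / real c ^ j \<and> 1 \<le> real c ^ Suc j * d"
proof -
  have c1: "real c > 1" and c0: "c > 0" using c by auto
  define j where "j = (LEAST j. 1 \<le> real c ^ Suc j * d)"
  have "\<exists>j. 1 \<le> real c ^ Suc j * d"
  proof -
    obtain k where "1 / d < real c ^ k" using real_arch_pow[OF c1] by blast
    moreover have "real c ^ k \<le> real c ^ Suc k" using c1 by (intro power_increasing) auto
    ultimately have "1 / d < real c ^ Suc k" by linarith
    then have "1 \<le> real c ^ Suc k * d" using d(1) by (simp add: pos_divide_less_eq del: power_Suc)
    then show ?thesis ..
  qed
  then have j: "1 \<le> real c ^ Suc j * d" unfolding j_def by (rule LeastI_ex)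
  have "d < 1 / real c ^ j"
  proof (cases j)
    case 0
    have "1 / real c ^ J \<le> 1 / 1" using c1 by (intro divide_left_mono) (auto simp: one_le_power)
    then show ?thesis using d(2) 0 by simp
  next
    case (Suc k)
    then have "\<not> 1 \<le> real c ^ Suc k * d" unfolding j_def by (intro not_less_Least) simp
    then show ?thesis using Suc c0 by (simp add: pos_less_divide_eq mult.commute del: power_Suc)
  qed
  moreover have "J \<le> j"
  proof -
    have "1 \<le> real c ^ Suc j * d" by (rule j)
    also have "\<dots> < real c ^ Suc j * (1 / real c ^ J)" using d(2) c0 by (intro mult_strict_left_mono) auto
    finally have "real c ^ J < real c ^ Suc j" using c0 by (simp add: pos_less_divide_eq del: power_Suc)
    then have "J < Suc j" using c1 by (rule power_less_imp_less_exp[rotated])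
    then show ?thesis by simp
  qed
  ultimately show ?thesis using j by (intro exI[of _ j]) auto
qed

text \<open>A set is replaced by boundedly many cubes of comparable diameter, and
  \<open>gauge_scale\<close> compares the costs. A set of diameter zero costs nothing while cubes
  around it do, hence the additive \<open>\<epsilon>\<close>.\<close>

lemma hausdorff_cover_by_cubes:
  fixes S :: "(real ^ 'n) set"
  assumes c: "c \<ge> 2" and g: "g \<in> gauges CARD('n)" and \<epsilon>: "0 < \<epsilon>"
    and S: "bounded S" "diameter S < 1 / real c ^ J"
    and J: "sqrt (real CARD('n)) * real c / real c ^ J < gauge_threshold CARD('n) g"
  shows "\<exists>P. finite P \<and> (\<forall>p\<in>P. J \<le> fst p) \<and> S \<subseteq> (\<Union>p\<in>P. cube c p) \<and>
    (\<Sum>p\<in>P. ennreal (g (diameter (cube c p)))) \<le>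
      ennreal (3 ^ CARD('n) * (sqrt (real CARD('n)) * real c) ^ CARD('n)) * ennreal (g (diameter S)) + ennreal \<epsilon>"
proof -
  let ?n = "CARD('n)" and ?G = "level_gauge TYPE('n) c g"
  have c0: "c > 0" and c1: "real c > 1" using c by auto
  define s where "s = sqrt (real ?n) * real c"
  have s1: "1 \<le> s" unfolding s_def using mult_mono[of 1 "sqrt (real ?n)" 1 "real c"] c1 by (simp add: Suc_leI)
  have cost: "(\<Sum>p\<in>P. ennreal (g (diameter (cube c p)))) \<le> ennreal (3 ^ ?n * ?G j)"
    if P: "card P \<le> 3 ^ ?n" "\<forall>p\<in>P. fst p = j" for P :: "(nat \<times> (int ^ 'n)) set" and j
  proof -
    have "(\<Sum>p\<in>P. ennreal (g (diameter (cube c p)))) = (\<Sum>p\<in>P. ennreal (?G j))"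
      using P(2) by (intro sum.cong) (auto simp: g_diameter_cube[OF c0])
    also have "\<dots> = of_nat (card P) * ennreal (?G j)" by simp
    also have "\<dots> \<le> of_nat (3 ^ ?n) * ennreal (?G j)" using P(1) by (intro mult_right_mono of_nat_mono) auto
    also have "of_nat (3 ^ ?n) = ennreal (3 ^ ?n)" by (simp add: ennreal_of_nat_eq_real_of_nat)
    also have "ennreal (3 ^ ?n) * ennreal (?G j) = ennreal (3 ^ ?n * ?G j)" by (rule ennreal_mult'[symmetric]) simp
    finally show ?thesis .
  qed
  show ?thesis
  proof (cases "diameter S = 0")
    case True
    have "((\<lambda>j. 3 ^ ?n * ?G j) \<longlongrightarrow> 3 ^ ?n * 0) sequentially"
    proof (intro tendsto_mult tendsto_const)
      have "filterlim (\<lambda>j. sqrt (real ?n) / real c ^ j) (at_right 0) sequentially"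
        using diameter_tendsto_0[OF c, of ?n] c0 by (auto simp: filterlim_at)
      then show "?G \<longlonglongrightarrow> 0"
        unfolding level_gauge_def by (rule filterlim_compose[OF gauge_tendsto_0[OF g]])
    qed
    then have "\<forall>\<^sub>F j in sequentially. 3 ^ ?n * ?G j < \<epsilon>" using \<epsilon> by (intro order_tendstoD) simp_all
    then obtain j0 where "\<And>j. j0 \<le> j \<Longrightarrow> 3 ^ ?n * ?G j < \<epsilon>" by (auto simp: eventually_sequentially)
    then have j: "3 ^ ?n * ?G (max j0 J) \<le> \<epsilon>" by (simp add: less_imp_le)
    have "diameter S \<le> 1 / real c ^ max j0 J" using True by simp
    from cover_bounded_by_cubes[OF c0 S(1) this] obtain P where
      P: "finite P" "card P \<le> 3 ^ ?n" "\<forall>p\<in>P. fst p = max j0 J" "S \<subseteq> (\<Union>p\<in>P. cube c p)" by blast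
    have "(\<Sum>p\<in>P. ennreal (g (diameter (cube c p)))) \<le> ennreal \<epsilon>"
      using cost[OF P(2,3)] j by (meson ennreal_leI order_trans)
    then show ?thesis using P by (intro exI[of _ P]) (auto intro: order_trans[OF _ add_increasing])
  next
    case False
    have d0: "0 < diameter S" using False diameter_ge_0[OF S(1)] by simp
    obtain j where j: "J \<le> j" "diameter S \<le> 1 / real c ^ j" "1 \<le> real c ^ Suc j * diameter S"
      using ex_power_bracket[OF c d0 S(2)] by blast
    obtain P where P: "finite P" "card P \<le> 3 ^ ?n" "\<forall>p\<in>P. fst p = j" "S \<subseteq> (\<Union>p\<in>P. cube c p)"
      using cover_bounded_by_cubes[OF c0 S(1) j(2)] by blast
    have sd: "s * diameter S < gauge_threshold ?n g"
    proof -
      have "s * diameter S < s * (1 / real c ^ J)" using S(2) s1 by (intro mult_strict_left_mono) auto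
      then show ?thesis using J by (simp add: s_def)
    qed
    have "sqrt (real ?n) / real c ^ j \<le> s * diameter S"
    proof -
      have "1 / real c ^ j \<le> real c * diameter S" using j(3) c0 by (simp add: divide_le_eq mult_ac)
      then have "sqrt (real ?n) * (1 / real c ^ j) \<le> sqrt (real ?n) * (real c * diameter S)" by (intro mult_left_mono) auto
      then show ?thesis by (simp add: s_def mult.assoc)
    qed
    then have "?G j \<le> g (s * diameter S)"
      unfolding level_gauge_def using sd by (intro gauge_mono[OF g]) auto
    also have "\<dots> \<le> s ^ ?n * g (diameter S)" by (rule gauge_scale[OF g d0 s1 sd])
    finally have "3 ^ ?n * ?G j \<le> (3 ^ ?n * s ^ ?n) * g (diameter S)" by (simp add: mult.assoc)
    then have "(\<Sum>p\<in>P. ennreal (g (diameter (cube c p)))) \<le> ennreal ((3 ^ ?n * s ^ ?n) * g (diameter S))"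
      using cost[OF P(2,3)] by (meson ennreal_leI order_trans)
    also have "\<dots> = ennreal (3 ^ ?n * s ^ ?n) * ennreal (g (diameter S))" using s1 by (intro ennreal_mult') simp
    finally show ?thesis using P j(1) unfolding s_def by (intro exI[of _ P]) (auto intro: add_increasing2)
  qed
qed

text \<open>All cubes of level \<open>J\<close> can be saturated at once if capacities are tested
  only from \<open>J\<close> on: a cube of level at least \<open>J\<close> contains none of them
  unless it is one of them. The total may then exceed the capacity of \<open>q\<close> by
  far.\<close>

lemma flow_subcubes:
  fixes q :: "nat \<times> (int ^ 'n)"
  assumes c: "c \<ge> 2" and J: "fst q \<le> J" and G: "\<And>j. J \<le> j \<Longrightarrow> 0 \<le> G j"
  shows "flow c G J (subcubes c q J) (\<lambda>_. G J)"
  unfolding flow_def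
proof (intro conjI allI impI)
  have c0: "c > 0" using c by simp
  show "finite (subcubes c q J)" by (rule finite_subcubes[OF c0 J])
  show "disjoint_cubes c (subcubes c q J)" by (rule disjoint_subcubes)
  show "\<forall>p\<in>subcubes c q J. 0 \<le> G J \<and> J \<le> fst p" using G by (auto simp: subcubes_def)
  fix \<Lambda> :: "nat \<times> (int ^ 'n)" assume \<Lambda>: "J \<le> fst \<Lambda>"
  let ?F = "{p \<in> subcubes c q J. cube c p \<subseteq> cube c \<Lambda>}"
  have F: "p = \<Lambda> \<and> fst \<Lambda> = J" if p: "p \<in> ?F" for p
  proof -
    have "fst p = J" "cube c p \<subseteq> cube c \<Lambda>" using p by (auto simp: subcubes_def)
    moreover from this have "fst \<Lambda> = J" using cube_subset_level[OF c, of p \<Lambda>] \<Lambda> by simp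
    moreover obtain x where "x \<in> cube c p" using cube_ne[OF c0, of p] by blast
    ultimately show ?thesis using cube_eqI[of p \<Lambda> x c] by auto
  qed
  have "sum (\<lambda>_. G J) ?F \<le> sum (\<lambda>_. G (fst \<Lambda>)) {\<Lambda>}"
  proof (cases "?F = {}")
    case True
    then show ?thesis using G[OF \<Lambda>] by (simp only: sum.empty) simp
  next
    case False
    then have "?F = {\<Lambda>}" "fst \<Lambda> = J" using F by blast+
    then show ?thesis by (simp only:)
  qed
  then show "sum (\<lambda>_. G J) ?F \<le> G (fst \<Lambda>)" by simp
qed

text \<open>Covers by sets of diameter below \<open>1 / c ^ J\<close> lead to cubes of level at
  least \<open>J\<close> only, so coarser capacities impose nothing. Saturating the subcubes of
  \<open>q\<close> at level \<open>J\<close> gives the total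
  \<open>G J * c ^ (n * (J - fst q))\<close>, which becomes arbitrarily large with
  \<open>h r / r\<close>.\<close>

lemma R_set_hausdorff_infinite:
  fixes V :: "(real ^ 'n) set" and c :: nat
  assumes n: "CARD('n) \<ge> 2" and c: "c \<ge> 2" and \<nu>: "\<nu> > real CARD('n) - 1"
    and h: "h \<in> gauges 1" and div: "approx_sum CARD('n) \<nu> h = \<infinity>"
    and V: "open V" "V \<noteq> {}"
  shows "hausdorff_measure (Id_times (CARD('n) - 1) h) (R_set \<nu> \<inter> V) = \<infinity>"
proof -
  let ?n = "CARD('n)"
  define g where "g = Id_times (?n - 1) h"
  let ?G = "level_gauge TYPE('n) c g" and ?J = "level_threshold TYPE('n) c g"
  have c0: "c > 0" and c1: "real c > 1" using c by auto
  have cp: "real c ^ k > 0" for k using c0 by simp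
  have g: "g \<in> gauges ?n" unfolding g_def using n by (intro Id_times_gauge h) simp
  have gh: "r ^ (?n - 1) * h r \<le> 1 * g r" for r by (simp add: g_def Id_times_def)
  have split: "splittable c ?G ?J (R_approx \<nu> (1 / real (Suc k)) :: (real ^ 'n) set)" for k
    by (rule splittable_R_approx[OF n c \<nu> _ h div g zero_less_one zero_less_one gh]) auto
  obtain x where x: "x \<in> V" using V by blast
  obtain Jx where Jx: "\<And>j. Jx \<le> j \<Longrightarrow> cube c (j, index c j x) \<subseteq> V" using open_contains_cubes[OF c V(1) x] by blast
  define q where "q = (Jx, index c Jx x)"
  have qV: "cube c q \<subseteq> V" using Jx by (simp add: q_def)
  define K where "K = 3 ^ ?n * (sqrt (real ?n) * real c) ^ ?n"
  have K0: "K > 0" using c0 by (simp add: K_def)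
  have "ennreal M \<le> hausdorff_measure g (R_set \<nu> \<inter> V)" if M: "0 \<le> M" for M
  proof -
    define d where "d j = sqrt (real ?n) / real c ^ j" for j
    have d0: "0 < d j" for j using cp by (simp add: d_def)
    \<comment> \<open>\<open>K\<close> is the loss in passing from sets to cubes, the 2 exceeds the
      sum 1 of the errors \<open>(1 / 2) ^ Suc p\<close>, and the last factor compensates for the
      volume of \<open>q\<close>.\<close>
    define M' where "M' = (K * M + 2) * (real c ^ fst q) ^ ?n"
    obtain \<delta> where \<delta>: "0 < \<delta>" "\<And>r. 0 < r \<Longrightarrow> r \<le> \<delta> \<Longrightarrow> M' \<le> h r / r"
      using gauge_quotient_unbounded[OF h _ \<nu> div, of M'] by auto
    have "\<forall>\<^sub>F j in sequentially. d j < min \<delta> (gauge_threshold ?n g / real c)"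
      unfolding d_def using \<delta>(1) gauge_threshold_pos[OF g] c0
      by (intro order_tendstoD(2)[OF diameter_tendsto_0[OF c]]) simp
    then obtain j0 where j0: "\<And>j. j0 \<le> j \<Longrightarrow> d j < min \<delta> (gauge_threshold ?n g / real c)"
      by (auto simp: eventually_sequentially)
    define J where "J = max j0 (max (fst q) ?J)"
    have J: "fst q \<le> J" "?J \<le> J" by (auto simp: J_def)
    have dJ: "d J < \<delta>" "d J * real c < gauge_threshold ?n g"
      using j0[of J] c0 by (auto simp: J_def pos_less_divide_eq)
    have total: "K * M + 2 \<le> sum (\<lambda>_. ?G J) (subcubes c q J)"
    proof -
      have dn: "d J * real c ^ J = sqrt (real ?n)" using c0 by (simp add: d_def)
      have "M' * 1 \<le> h (d J) / d J * (d J * real c ^ J) ^ ?n"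
      proof (rule mult_mono)
        show "M' \<le> h (d J) / d J" using \<delta>(2)[OF d0] dJ by simp
        show "1 \<le> (d J * real c ^ J) ^ ?n" unfolding dn by (intro one_le_power) (simp add: Suc_leI)
        have "0 \<le> M'" using K0 M by (simp add: M'_def)
        then show "0 \<le> h (d J) / d J" using \<delta>(2)[OF d0[of J]] dJ by simp
      qed simp
      also have "\<dots> = ?G J * (real c ^ J) ^ ?n"
      proof -
        have "d J ^ ?n = d J * d J ^ (?n - 1)" by (simp add: power_eq_if)
        moreover have "?G J = d J ^ (?n - 1) * h (d J)" by (simp add: level_gauge_def g_def Id_times_def d_def)
        ultimately show ?thesis using d0[of J] by (simp add: power_mult_distrib)
      qed
      also have "(real c ^ J) ^ ?n = (real c ^ (J - fst q)) ^ ?n * (real c ^ fst q) ^ ?n"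
        using J(1) by (simp flip: power_mult_distrib power_add)
      finally have "(K * M + 2) * (real c ^ fst q) ^ ?n \<le> (?G J * (real c ^ (J - fst q)) ^ ?n) * (real c ^ fst q) ^ ?n"
        by (simp add: M'_def mult_ac)
      then have "K * M + 2 \<le> ?G J * (real c ^ (J - fst q)) ^ ?n"
        using c0 by (simp add: mult_le_cancel_right)
      moreover have "real (card (subcubes c q J)) = (real c ^ (J - fst q)) ^ ?n"
        using card_subcubes[OF c0 J(1)] by (simp add: power_mult)
      ultimately show ?thesis by (simp add: mult.commute)
    qed
    have "ennreal M \<le> hausdorff_premeasure g (1 / real c ^ J) (R_set \<nu> \<inter> V)"
      unfolding hausdorff_premeasure_def
    proof (rule Inf_greatest, safe)
      fix U :: "nat \<Rightarrow> (real ^ 'n) set"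
      assume cover: "R_set \<nu> \<inter> V \<subseteq> (\<Union>p. U p)" and U: "\<forall>p. bounded (U p) \<and> diameter (U p) < 1 / real c ^ J"
      define X where "X = (\<Sum>p. ennreal (g (diameter (U p))))"
      have thr: "sqrt (real ?n) * real c / real c ^ J < gauge_threshold ?n g"
        using dJ(2) by (simp add: d_def)
      have "\<exists>P. finite P \<and> (\<forall>q\<in>P. J \<le> fst q) \<and> U p \<subseteq> (\<Union>q\<in>P. cube c q) \<and>
        (\<Sum>q\<in>P. ennreal (g (diameter (cube c q)))) \<le> ennreal K * ennreal (g (diameter (U p))) + ennreal ((1 / 2) ^ Suc p)" for p
        unfolding K_def using U by (intro hausdorff_cover_by_cubes[OF c g _ _ _ thr]) auto
      then obtain \<D> where \<D>: "\<And>p. finite (\<D> p)" "\<And>p q. q \<in> \<D> p \<Longrightarrow> J \<le> fst q" "\<And>p. U p \<subseteq> (\<Union>q\<in>\<D> p. cube c q)"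
        "\<And>p. (\<Sum>q\<in>\<D> p. ennreal (g (diameter (cube c q)))) \<le> ennreal K * ennreal (g (diameter (U p))) + ennreal ((1 / 2) ^ Suc p)"
        by metis
      obtain L where L: "\<forall>i. L i = {} \<or> (\<exists>k. \<exists>D\<in>\<D> k. L i = cube c D)"
        "(\<Union>k. \<Union>D\<in>\<D> k. cube c D) \<subseteq> (\<Union>i. L i)"
        "(\<Sum>i. ennreal (g (diameter (L i)))) = (\<Sum>k. \<Sum>D\<in>\<D> k. ennreal (g (diameter (cube c D))))"
        using enumerate_cover[of \<D> g c, OF \<D>(1) gauge_zero[OF g]] by blast
      have "ennreal (K * M + 2) \<le> ennreal (sum (\<lambda>_. ?G J) (subcubes c q J))" by (rule ennreal_leI[OF total])
      also have "\<dots> \<le> (\<Sum>i. ennreal (g (diameter (L i))))"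
      proof (rule flow_cover[OF c _ splittable_mono[OF split J(2)] flow_subcubes[OF c J(1)]])
        show "0 < ?G j" if "J \<le> j" for j using level_gauge_pos[OF c g] J(2) that by simp
        show "0 \<le> ?G j" if "J \<le> j" for j using level_gauge_pos[OF c g, of j] J(2) that by simp
        have "(\<Union>p. U p) \<subseteq> (\<Union>k. \<Union>D\<in>\<D> k. cube c D)" by (rule UN_mono[OF order_refl \<D>(3)])
        then have "R_set \<nu> \<inter> V \<subseteq> (\<Union>i. L i)" using cover L(2) by (meson order_trans)
        then show "(\<Inter>k. R_approx \<nu> (1 / real (Suc k))) \<inter> (\<Union>p\<in>subcubes c q J. cube c p) \<subseteq> (\<Union>i. L i)"
          unfolding R_set_seq[symmetric] subcubes_UN[OF c0 J(1)] using qV by blast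
        show "L i = {} \<or> (\<exists>p. J \<le> fst p \<and> L i = cube c p \<and> ennreal (?G (fst p)) \<le> ennreal (g (diameter (L i))))" for i
        proof (cases "L i = {}")
          case False
          then obtain k D where "D \<in> \<D> k" "L i = cube c D" using L(1) by blast
          then show ?thesis using \<D>(2)[of D k] g_diameter_cube[OF c0, of g D] by (intro disjI2 exI[of _ D]) simp
        qed simp
      qed
      also have "\<dots> \<le> (\<Sum>p. ennreal K * ennreal (g (diameter (U p))) + ennreal ((1 / 2) ^ Suc p))"
        unfolding L(3) by (intro suminf_le \<D>(4)) auto
      also have "\<dots> = ennreal K * X + (\<Sum>p. ennreal ((1 / 2) ^ Suc p))"
        unfolding X_def by (subst suminf_add[symmetric]) auto
      also have "(\<Sum>p. ennreal ((1 / 2) ^ Suc p)) = 1"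
        by (subst suminf_ennreal_eq[OF _ power_half_series]) (simp_all only: ennreal_1, simp)
      finally have le: "ennreal (K * M + 2) \<le> ennreal K * X + 1" .
      show "ennreal M \<le> (\<Sum>p. ennreal (g (diameter (U p))))"
      proof (cases X rule: ennreal_cases)
        case top
        then show ?thesis by (simp add: X_def)
      next
        case (real y)
        have "ennreal K * ennreal y = ennreal (K * y)" using K0 by (intro ennreal_mult'[symmetric]) simp
        moreover have "ennreal (K * y) + 1 = ennreal (K * y + 1)" using K0 real by simp
        ultimately have "ennreal (K * M + 2) \<le> ennreal (K * y + 1)" using le real by simp
        then have "K * M + 2 \<le> K * y + 1" using K0 real by (subst (asm) ennreal_le_iff) auto
        then have "K * M \<le> K * y" by simp
        then have "M \<le> y" using K0 by simp
        then show ?thesis using real unfolding X_def[symmetric] by (simp add: ennreal_leI)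
      qed
    qed
    also have "\<dots> \<le> hausdorff_measure g (R_set \<nu> \<inter> V)"
      unfolding hausdorff_measure_eq_SUP using cp by (intro SUP_upper) simp
    finally show ?thesis .
  qed
  note unb = this
  show ?thesis
  proof (rule ccontr)
    assume "hausdorff_measure (Id_times (?n - 1) h) (R_set \<nu> \<inter> V) \<noteq> \<infinity>"
    then obtain y where y: "0 \<le> y" "hausdorff_measure g (R_set \<nu> \<inter> V) = ennreal y"
      unfolding g_def by (cases "hausdorff_measure (Id_times (?n - 1) h) (R_set \<nu> \<inter> V)" rule: ennreal_cases) auto
    have "ennreal (y + 1) \<le> ennreal y" using unb[of "y + 1"] y by simp
    then show False using y(1) by (simp add: ennreal_le_iff)
  qed
qed

section \<open>The convergence case\<close>

lemma l1_norm_ge: "\<bar>real_of_int (q $ l)\<bar> \<le> l1_norm (of_int_vec q)"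
  unfolding l1_norm_of_int_vec
  by (rule member_le_sum[of l UNIV "\<lambda>l. \<bar>real_of_int (q $ l)\<bar>"]) simp_all

lemma l1_norm_pos:
  fixes q :: "int ^ 'n"
  assumes "q \<noteq> 0"
  shows "0 < l1_norm (of_int_vec q)"
proof -
  obtain l where "q $ l \<noteq> 0" using assms by (auto simp: vec_eq_iff)
  then have "0 < \<bar>real_of_int (q $ l)\<bar>" by simp
  then show ?thesis using l1_norm_ge[of q l] by linarith
qed

text \<open>Off the rational hyperplanes, the finitely many vectors of height below \<open>N\<close>
  all violate the inequality for some small \<open>\<gamma>\<close>, so a solution for that
  \<open>\<gamma>\<close> is of height at least \<open>N\<close>. On a rational hyperplane the
  multiples of one vector do.\<close>

lemma R_set_large_solutions:
  fixes \<omega> :: "real ^ 'n"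
  assumes "\<omega> \<in> R_set \<nu>"
  shows "\<exists>q l. int N \<le> \<bar>q $ l\<bar> \<and> (\<forall>m. \<bar>q $ m\<bar> \<le> \<bar>q $ l\<bar>) \<and>
    \<bar>of_int_vec q \<bullet> \<omega>\<bar> < 1 / l1_norm (of_int_vec q) powr \<nu>"
proof (cases "\<exists>q :: int ^ 'n. q \<noteq> 0 \<and> of_int_vec q \<bullet> \<omega> = 0")
  case True
  then obtain q0 :: "int ^ 'n" where q0: "q0 \<noteq> 0" "of_int_vec q0 \<bullet> \<omega> = 0" by blast
  define a where "a = int (Suc N)"
  define q where "q = (\<chi> l. a * q0 $ l)"
  obtain l where l: "\<And>m. \<bar>q $ m\<bar> \<le> \<bar>q $ l\<bar>" using ex_max_coordinate[of q] by blast
  obtain l0 where l0: "q0 $ l0 \<noteq> 0" using q0(1) by (auto simp: vec_eq_iff)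
  have "\<bar>q $ l0\<bar> = a * \<bar>q0 $ l0\<bar>" by (simp add: q_def abs_mult a_def)
  also have "\<dots> \<ge> a * 1" using l0 by (intro mult_left_mono) (auto simp: a_def)
  finally have ge: "int N < \<bar>q $ l0\<bar>" by (simp add: a_def)
  have "of_int_vec q \<bullet> \<omega> = real_of_int a * (of_int_vec q0 \<bullet> \<omega>)"
    unfolding inner_of_int_vec by (simp add: q_def sum_distrib_left mult.assoc)
  then have "of_int_vec q \<bullet> \<omega> = 0" using q0(2) by simp
  moreover have "q \<noteq> 0"
  proof
    assume "q = 0"
    then show False using ge by simp
  qed
  ultimately have "\<bar>of_int_vec q \<bullet> \<omega>\<bar> < 1 / l1_norm (of_int_vec q) powr \<nu>"
    using l1_norm_pos[of q] by simp
  moreover have "int N \<le> \<bar>q $ l\<bar>" using ge l[of l0] by simp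
  ultimately show ?thesis using l by blast
next
  case False
  define F where "F = {q :: int ^ 'n. q \<noteq> 0 \<and> (\<forall>m. \<bar>q $ m\<bar> < int N)}"
  define \<phi> where "\<phi> q = \<bar>of_int_vec q \<bullet> \<omega>\<bar> * l1_norm (of_int_vec q) powr \<nu>" for q :: "int ^ 'n"
  have "F \<subseteq> {q. \<forall>m. q $ m \<in> {- int N..int N}}" by (auto simp: F_def abs_less_iff dest: spec intro: less_imp_le) (smt (verit))+
  then have finF: "finite F" using card_vec_box(2)[of "\<lambda>_. {- int N..int N}"] by (auto intro: finite_subset)
  have pos: "0 < \<phi> q" if "q \<noteq> 0" for q using False that l1_norm_pos[OF that] by (auto simp: \<phi>_def)
  \<comment> \<open>Including 1 in the minimum covers the case of empty \<open>F\<close> and gives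
    \<open>\<gamma> \<le> 1\<close>, as the numerator 1 in the conclusion requires.\<close>
  define \<gamma> where "\<gamma> = Min (insert 1 (\<phi> ` F))"
  have \<gamma>: "0 < \<gamma>" "\<gamma> \<le> 1" "\<And>q. q \<in> F \<Longrightarrow> \<gamma> \<le> \<phi> q"
    unfolding \<gamma>_def using finF pos by (auto simp: F_def)
  have "\<omega> \<in> R_approx \<nu> \<gamma>" using assms \<gamma>(1) by (auto simp: R_set_eq)
  then obtain q :: "int ^ 'n" where q: "q \<noteq> 0" "\<bar>of_int_vec q \<bullet> \<omega>\<bar> < \<gamma> / l1_norm (of_int_vec q) powr \<nu>"
    by (auto simp: R_approx_def)
  have "\<phi> q < \<gamma>" using q(2) l1_norm_pos[OF q(1)] by (simp add: \<phi>_def pos_less_divide_eq)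
  then have "q \<notin> F" using \<gamma>(3) by force
  then obtain m where m: "int N \<le> \<bar>q $ m\<bar>" using q(1) by (auto simp: F_def not_less)
  obtain l where l: "\<And>m. \<bar>q $ m\<bar> \<le> \<bar>q $ l\<bar>" using ex_max_coordinate[of q] by blast
  have "\<gamma> / l1_norm (of_int_vec q) powr \<nu> \<le> 1 / l1_norm (of_int_vec q) powr \<nu>"
    using \<gamma>(2) by (intro divide_right_mono) auto
  then have "\<bar>of_int_vec q \<bullet> \<omega>\<bar> < 1 / l1_norm (of_int_vec q) powr \<nu>" using q(2) by linarith
  moreover have "int N \<le> \<bar>q $ l\<bar>" using m l[of m] by linarith
  ultimately show ?thesis using l by blast
qed

text \<open>There are at most a multiple of \<open>c ^ (n * i)\<close> vectors of height between
  \<open>c ^ i\<close> and \<open>c ^ Suc i\<close>. Each yields a slab of thickness about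
  \<open>s i\<close>, covered inside \<open>p\<close> by a multiple of
  \<open>(c ^ lf i) ^ (n - 1)\<close> cubes of about that side. The total cost is a multiple of
  \<open>c ^ (n * i) * h (s i)\<close>, a term of the condensed series.\<close>

lemma converge_cover_cube:
  fixes p :: "nat \<times> (int ^ 'n)"
  assumes n: "CARD('n) \<ge> 2" and c: "c \<ge> 2" and \<nu>: "\<nu> > real CARD('n) - 1"
    and h: "h \<in> gauges 1" and conv: "approx_sum CARD('n) \<nu> h < \<infinity>" and \<epsilon>: "0 < \<epsilon>"
  shows "\<exists>\<D>. (\<forall>k. finite (\<D> k) \<and> (\<forall>D\<in>\<D> k. J \<le> fst D)) \<and>
    R_set \<nu> \<inter> cube c p \<subseteq> (\<Union>k. \<Union>D\<in>\<D> k. cube c D) \<and>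
    (\<Sum>k. \<Sum>D\<in>\<D> k. ennreal (Id_times (CARD('n) - 1) h (diameter (cube c D)))) \<le> ennreal \<epsilon>"
proof -
  let ?n = "CARD('n)"
  define g where "g = Id_times (?n - 1) h"
  have c0: "c > 0" and c1: "real c > 1" using c by auto
  have cp: "real c ^ k > 0" for k using c0 by simp
  have \<nu>1: "0 < \<nu> + 1" "0 < \<nu>" using \<nu> n by auto
  obtain \<eta> where \<eta>: "0 < \<eta>" "\<And>r. 0 < r \<Longrightarrow> r \<le> \<eta> \<Longrightarrow> 0 < h r"
    "\<And>r r'. 0 < r \<Longrightarrow> r \<le> r' \<Longrightarrow> r' \<le> \<eta> \<Longrightarrow> h r' / r' \<le> h r / r" using gauge1E[OF h] by metis
  define s where "s i = real c powr (- ((\<nu> + 1) * real i))" for i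
  \<comment> \<open>Rounding down makes the side \<open>1 / c ^ lf i\<close> at least
    \<open>s i\<close> and at most \<open>c * s i\<close>.\<close>
  define lf where "lf i = nat \<lfloor>(\<nu> + 1) * real i\<rfloor>" for i
  define d where "d i = sqrt (real ?n) / real c ^ lf i" for i
  have s0: "0 < s i" for i using c0 by (simp add: s_def)
  have d0: "0 < d i" for i using cp by (simp add: d_def)
  have lf: "real (lf i) \<le> (\<nu> + 1) * real i" "(\<nu> + 1) * real i \<le> real (lf i) + 1" for i
  proof -
    have "0 \<le> (\<nu> + 1) * real i" using \<nu>1 by simp
    then show "real (lf i) \<le> (\<nu> + 1) * real i" "(\<nu> + 1) * real i \<le> real (lf i) + 1"
      unfolding lf_def by linarith+
  qed
  have side: "1 / real c ^ k = real c powr (- real k)" for k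
    using c0 by (simp add: powr_minus powr_realpow inverse_eq_divide)
  have sl: "s i \<le> 1 / real c ^ lf i" "1 / real c ^ lf i \<le> real c * s i" for i
  proof -
    show "s i \<le> 1 / real c ^ lf i" unfolding side s_def using lf(1)[of i] c1 by (intro powr_mono) auto
    have "1 / real c ^ lf i \<le> real c powr (1 + - ((\<nu> + 1) * real i))"
      unfolding side using lf(2)[of i] c1 by (intro powr_mono) auto
    also have "\<dots> = real c * s i" unfolding s_def powr_add using c0 by simp
    finally show "1 / real c ^ lf i \<le> real c * s i" .
  qed
  \<comment> \<open>The factors come from the number of vectors with entries up to
    \<open>c ^ Suc i\<close>, from \<open>slab_count\<close>, and from comparing the gauge at the
    diameter of a cube with its value at \<open>s i\<close>.\<close>
  define K where "K = (3 * real c) ^ ?n * (2 * real ?n + 3) * (sqrt (real ?n) ^ (?n - 1) * (sqrt (real ?n) * real c))"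
  have K0: "0 \<le> K" by (simp add: K_def)
  define S where "S i = K * (real c ^ (?n * i) * h (s i))" for i
  have summ: "summable S"
    unfolding S_def s_def using approx_sum_condensed[OF h \<nu>1(1) _ c, of ?n 1] conv by (intro summable_mult) simp
  obtain N0 where N0: "\<And>k. N0 \<le> k \<Longrightarrow> norm (\<Sum>i. S (i + k)) < \<epsilon>"
    using suminf_exist_split[OF \<epsilon> summ] by blast
  have lf_top: "filterlim (\<lambda>i. real (lf i)) at_top sequentially"
  proof (rule filterlim_at_top_mono[OF filterlim_real_sequentially], intro always_eventually allI)
    fix i
    have "real i \<le> (\<nu> + 1) * real i" using mult_right_mono[of 1 "\<nu> + 1" "real i"] \<nu>1(2) by simp
    then show "real i \<le> real (lf i)" unfolding lf_def of_nat_le_iff by (rule le_nat_floor)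
  qed
  have "\<forall>\<^sub>F i in sequentially. real (max (fst p) J) \<le> real (lf i)"
    using lf_top unfolding filterlim_at_top by blast
  moreover have "\<forall>\<^sub>F i in sequentially. d i \<le> \<eta>"
  proof -
    have "filterlim lf at_top sequentially"
      using lf_top by (subst (asm) filterlim_sequentially_iff_filterlim_real[symmetric])
    then have "d \<longlonglongrightarrow> 0" unfolding d_def by (rule filterlim_compose[OF diameter_tendsto_0[OF c]])
    from order_tendstoD(2)[OF this \<eta>(1)] show ?thesis by eventually_elim simp
  qed
  ultimately have "\<forall>\<^sub>F i in sequentially. real (max (fst p) J) \<le> real (lf i) \<and> d i \<le> \<eta>" by eventually_elim auto
  then obtain N1 where N1: "\<And>i. N1 \<le> i \<Longrightarrow> real (max (fst p) J) \<le> real (lf i) \<and> d i \<le> \<eta>"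
    unfolding eventually_sequentially by blast
  define i1 where "i1 = max N0 N1"
  define Q where "Q i = {q :: int ^ 'n. \<forall>m. q $ m \<in> {- int (c ^ Suc i)..int (c ^ Suc i)}}" for i
  define T where "T i q l = {D \<in> subcubes c p (lf i). \<bar>of_int_vec q \<bullet> center c D\<bar> \<le> \<bar>real_of_int (q $ l)\<bar> * (1 + real ?n) / real c ^ lf i}" for i q l
  \<comment> \<open>The choice operator fixes one largest coordinate for each vector, so that the
    union runs over vectors alone.\<close>
  define \<E> where "\<E> i = (\<Union>q\<in>Q i - {0}. T i q (SOME l. \<forall>m. \<bar>q $ m\<bar> \<le> \<bar>q $ l\<bar>))" for i
  have lfi: "fst p \<le> lf i" "J \<le> lf i" "d i \<le> \<eta>" if "i1 \<le> i" for i
    using N1[of i] that by (auto simp: i1_def)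
  have finQ: "finite (Q i)" and cardQ: "real (card (Q i)) \<le> (3 * real c) ^ ?n * real c ^ (?n * i)" for i
  proof -
    show "finite (Q i)" unfolding Q_def by (rule card_vec_box(2)) simp
    have "card (Q i) = (\<Prod>m\<in>(UNIV :: 'n set). card {- int (c ^ Suc i)..int (c ^ Suc i)})"
      unfolding Q_def by (rule card_vec_box(1)) simp
    also have "\<dots> = (2 * c ^ Suc i + 1) ^ ?n"
    proof -
      have "card {- int (c ^ Suc i)..int (c ^ Suc i)} = 2 * c ^ Suc i + 1"
        unfolding card_atLeastAtMost_int by (simp only: nat_eq_iff) simp
      then show ?thesis by simp
    qed
    also have "\<dots> \<le> (3 * c ^ Suc i) ^ ?n" using c0 by (intro power_mono) (auto simp: Suc_le_eq)
    finally have "real (card (Q i)) \<le> real ((3 * c ^ Suc i) ^ ?n)" by (simp only: of_nat_le_iff)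
    also have "\<dots> = (3 * real c) ^ ?n * real c ^ (?n * i)"
      by (simp add: power_mult_distrib mult.commute[of ?n i] power_mult)
    finally show "real (card (Q i)) \<le> (3 * real c) ^ ?n * real c ^ (?n * i)" .
  qed
  have mx: "\<forall>m. \<bar>q $ m\<bar> \<le> \<bar>q $ (SOME l. \<forall>m. \<bar>q $ m\<bar> \<le> \<bar>q $ l\<bar>)\<bar>" for q :: "int ^ 'n"
    using someI_ex[OF ex_max_coordinate[of q]] .
  have finT: "finite (T i q l)" if "i1 \<le> i" for i q l
    using finite_subcubes[OF c0 lfi(1)[OF that]] by (simp add: T_def)
  have finE: "finite (\<E> i)" if "i1 \<le> i" for i
    unfolding \<E>_def using finQ finT[OF that] by auto
  have cardT: "real (card (T i q l)) \<le> (real c ^ lf i) ^ (?n - 1) * (2 * real ?n + 3)" if i: "i1 \<le> i" and q: "q $ l \<noteq> 0" for i q l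
  proof -
    have "real (card (T i q l)) \<le> (real c ^ (lf i - fst p)) ^ (?n - 1) *
      (2 * (\<bar>real_of_int (q $ l)\<bar> * (1 + real ?n) / real c ^ lf i) * real c ^ lf i / \<bar>real_of_int (q $ l)\<bar> + 1)"
      unfolding T_def by (rule slab_count[OF c0 lfi(1)[OF i] q]) simp
    also have "2 * (\<bar>real_of_int (q $ l)\<bar> * (1 + real ?n) / real c ^ lf i) * real c ^ lf i / \<bar>real_of_int (q $ l)\<bar> + 1 = 2 * real ?n + 3"
      using q c0 by simp
    also have "(real c ^ (lf i - fst p)) ^ (?n - 1) * (2 * real ?n + 3) \<le> (real c ^ lf i) ^ (?n - 1) * (2 * real ?n + 3)"
      using c1 by (intro mult_right_mono power_mono power_increasing) auto
    finally show ?thesis .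
  qed
  have cost: "(\<Sum>D\<in>\<E> i. ennreal (g (diameter (cube c D)))) \<le> ennreal (S i)" if i: "i1 \<le> i" for i
  proof -
    have lev: "fst D = lf i" if "D \<in> \<E> i" for D using that by (auto simp: \<E>_def T_def subcubes_def)
    have sd: "s i \<le> d i" "d i \<le> sqrt (real ?n) * real c * s i"
    proof -
      have "1 / real c ^ lf i \<le> d i" unfolding d_def by (intro divide_right_mono) (auto simp: Suc_leI)
      then show "s i \<le> d i" using sl(1)[of i] by linarith
      have "d i = sqrt (real ?n) * (1 / real c ^ lf i)" by (simp add: d_def)
      also have "\<dots> \<le> sqrt (real ?n) * (real c * s i)" by (intro mult_left_mono sl(2)) simp
      finally show "d i \<le> sqrt (real ?n) * real c * s i" by (simp add: mult.assoc)
    qed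
    have hs: "0 < h (s i)" using \<eta>(2)[OF s0[of i]] sd lfi(3)[OF i] by simp
    have hd: "0 < h (d i)" using \<eta>(2)[OF d0[of i] lfi(3)[OF i]] .
    have "h (d i) / d i \<le> h (s i) / s i" by (rule \<eta>(3)[OF s0 sd(1) lfi(3)[OF i]])
    then have "h (d i) \<le> h (s i) / s i * d i" using d0 by (simp add: pos_divide_le_eq)
    also have "\<dots> \<le> h (s i) / s i * (sqrt (real ?n) * real c * s i)"
      using sd(2) hs s0[of i] by (intro mult_left_mono) auto
    also have "\<dots> = sqrt (real ?n) * real c * h (s i)" using s0[of i] by simp
    finally have hle: "h (d i) \<le> sqrt (real ?n) * real c * h (s i)" .
    have gd: "g (d i) = (sqrt (real ?n) ^ (?n - 1) / (real c ^ lf i) ^ (?n - 1)) * h (d i)"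
      by (simp add: g_def Id_times_def d_def power_divide)
    have gd0: "0 \<le> g (d i)" unfolding gd using hd by simp
    have "card (\<E> i) \<le> (\<Sum>q\<in>Q i - {0}. card (T i q (SOME l. \<forall>m. \<bar>q $ m\<bar> \<le> \<bar>q $ l\<bar>)))"
      unfolding \<E>_def using finQ by (intro card_UN_le) simp
    then have "real (card (\<E> i)) \<le> (\<Sum>q\<in>Q i - {0}. real (card (T i q (SOME l. \<forall>m. \<bar>q $ m\<bar> \<le> \<bar>q $ l\<bar>))))"
      unfolding of_nat_sum[symmetric] of_nat_le_iff .
    also have "\<dots> \<le> (\<Sum>q\<in>Q i - {0}. (real c ^ lf i) ^ (?n - 1) * (2 * real ?n + 3))"
    proof (rule sum_mono)
      fix q assume q: "q \<in> Q i - {0}"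
      then obtain m where "q $ m \<noteq> 0" by (auto simp: vec_eq_iff)
      then have "q $ (SOME l. \<forall>m. \<bar>q $ m\<bar> \<le> \<bar>q $ l\<bar>) \<noteq> 0" using mx[of q] by (metis abs_0 abs_le_zero_iff)
      then show "real (card (T i q (SOME l. \<forall>m. \<bar>q $ m\<bar> \<le> \<bar>q $ l\<bar>))) \<le> (real c ^ lf i) ^ (?n - 1) * (2 * real ?n + 3)"
        by (rule cardT[OF i])
    qed
    also have "\<dots> = real (card (Q i - {0})) * ((real c ^ lf i) ^ (?n - 1) * (2 * real ?n + 3))" by simp
    also have "\<dots> \<le> real (card (Q i)) * ((real c ^ lf i) ^ (?n - 1) * (2 * real ?n + 3))"
      using finQ by (intro mult_right_mono of_nat_mono card_mono) auto
    also have "\<dots> \<le> ((3 * real c) ^ ?n * real c ^ (?n * i)) * ((real c ^ lf i) ^ (?n - 1) * (2 * real ?n + 3))"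
      by (intro mult_right_mono cardQ) simp
    finally have cE: "real (card (\<E> i)) \<le> ((3 * real c) ^ ?n * real c ^ (?n * i)) * ((real c ^ lf i) ^ (?n - 1) * (2 * real ?n + 3))" .
    have "real (card (\<E> i)) * g (d i) \<le> ((3 * real c) ^ ?n * real c ^ (?n * i)) * ((real c ^ lf i) ^ (?n - 1) * (2 * real ?n + 3)) *
       ((sqrt (real ?n) ^ (?n - 1) / (real c ^ lf i) ^ (?n - 1)) * (sqrt (real ?n) * real c * h (s i)))"
    proof (rule mult_mono[OF cE])
      show "g (d i) \<le> (sqrt (real ?n) ^ (?n - 1) / (real c ^ lf i) ^ (?n - 1)) * (sqrt (real ?n) * real c * h (s i))"
        unfolding gd by (intro mult_left_mono hle) simp
    qed (use gd0 in auto)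
    also have "\<dots> = S i"
    proof -
      have "(real c ^ lf i) ^ (?n - 1) * (1 / (real c ^ lf i) ^ (?n - 1)) = 1" using c0 by simp
      moreover have "((3 * real c) ^ ?n * real c ^ (?n * i)) * ((real c ^ lf i) ^ (?n - 1) * (2 * real ?n + 3)) *
         ((sqrt (real ?n) ^ (?n - 1) / (real c ^ lf i) ^ (?n - 1)) * (sqrt (real ?n) * real c * h (s i))) =
         S i * ((real c ^ lf i) ^ (?n - 1) * (1 / (real c ^ lf i) ^ (?n - 1)))"
        by (simp only: S_def K_def mult_ac times_divide_eq_right times_divide_eq_left mult_1 mult_1_right)
      ultimately show ?thesis by simp
    qed
    finally have le: "real (card (\<E> i)) * g (d i) \<le> S i" .
    have "(\<Sum>D\<in>\<E> i. ennreal (g (diameter (cube c D)))) = (\<Sum>D\<in>\<E> i. ennreal (g (d i)))"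
      using lev by (intro sum.cong) (auto simp: diameter_cube[OF c0] d_def)
    also have "\<dots> = ennreal (real (card (\<E> i)) * g (d i))"
      by (simp add: ennreal_of_nat_eq_real_of_nat ennreal_mult')
    also have "\<dots> \<le> ennreal (S i)" by (rule ennreal_leI[OF le])
    finally show ?thesis .
  qed
  have S0: "0 \<le> S i" if "i1 \<le> i" for i
  proof -
    have "s i \<le> d i"
      using sl(1)[of i] divide_right_mono[of 1 "sqrt (real ?n)" "real c ^ lf i"] by (simp add: d_def Suc_leI)
    then have "0 < h (s i)" using \<eta>(2)[OF s0[of i]] lfi(3)[OF that] by simp
    then show ?thesis using K0 by (simp add: S_def)
  qed
  show ?thesis
  proof (intro exI[of _ "\<lambda>k. \<E> (k + i1)"] conjI allI ballI)
    show "finite (\<E> (k + i1))" for k by (rule finE) simp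
    show "J \<le> fst D" if "D \<in> \<E> (k + i1)" for k D
      using that lfi(2)[of "k + i1"] by (auto simp: \<E>_def T_def subcubes_def)
    show "R_set \<nu> \<inter> cube c p \<subseteq> (\<Union>k. \<Union>D\<in>\<E> (k + i1). cube c D)"
    proof
      fix \<omega> assume \<omega>: "\<omega> \<in> R_set \<nu> \<inter> cube c p"
      then obtain q l where q: "int (c ^ i1) \<le> \<bar>q $ l\<bar>" "\<And>m. \<bar>q $ m\<bar> \<le> \<bar>q $ l\<bar>"
        "\<bar>of_int_vec q \<bullet> \<omega>\<bar> < 1 / l1_norm (of_int_vec q) powr \<nu>"
        using R_set_large_solutions[of \<omega> \<nu> "c ^ i1"] by blast
      define a where "a = nat \<bar>q $ l\<bar>"
      have a: "int a = \<bar>q $ l\<bar>" "real a = \<bar>real_of_int (q $ l)\<bar>" by (auto simp: a_def)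
      have ca: "c ^ i1 \<le> a" using q(1) unfolding a(1)[symmetric] by (simp only: of_nat_le_iff)
      moreover have "1 \<le> c ^ i1" using c0 by simp
      ultimately have a1: "1 \<le> a" by linarith
      \<comment> \<open>This is the block with \<open>c ^ i \<le> a < c ^ Suc i\<close>. In it the
        product of \<open>q\<close> and \<open>\<omega>\<close> is below
        \<open>a powr (- \<nu>) = a * a powr (- (\<nu> + 1))\<close>, which is at most
        \<open>a / c ^ lf i\<close>.\<close>
      define i where "i = (LEAST i. a < c ^ Suc i)"
      have "a < c ^ Suc a" using power_gt_expt[of c "Suc a"] c by simp
      then have iu: "a < c ^ Suc i" unfolding i_def by (rule LeastI)
      have i1i: "i1 \<le> i"
      proof -
        have "c ^ i1 < c ^ Suc i" using ca iu by simp
        then have "i1 < Suc i" using c by (simp add: power_strict_increasing_iff del: power_Suc)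
        then show ?thesis by simp
      qed
      have il: "c ^ i \<le> a"
      proof (cases i)
        case 0
        then show ?thesis using a1 by simp
      next
        case (Suc k)
        then have "\<not> a < c ^ Suc k" unfolding i_def by (intro not_less_Least) simp
        then show ?thesis using Suc by simp
      qed
      define l' where "l' = (SOME l. \<forall>m. \<bar>q $ m\<bar> \<le> \<bar>q $ l\<bar>)"
      have l': "\<bar>q $ l'\<bar> = \<bar>q $ l\<bar>" using mx[of q] q(2)[of l'] unfolding l'_def by (meson antisym)
      define D where "D = (lf i, index c (lf i) \<omega>)"
      have \<omega>D: "\<omega> \<in> cube c D" by (simp add: D_def mem_cube_index)
      have Dsub: "D \<in> subcubes c p (lf i)"
        using cube_nested[OF c0, of p D \<omega>] \<omega> \<omega>D lfi(1)[OF i1i] by (simp add: subcubes_def D_def)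
      have q0: "q \<noteq> 0" using a1 a(1) by auto
      have l1ge: "real a \<le> l1_norm (of_int_vec q)" using l1_norm_ge[of q l] a(2) by simp
      have l1le: "l1_norm (of_int_vec q) \<le> real ?n * real a" using l1_norm_le[of q "\<bar>q $ l\<bar>"] q(2) a(2) by simp
      have "\<bar>of_int_vec q \<bullet> \<omega>\<bar> \<le> real a / real c ^ lf i"
      proof -
        have ap: "0 < real a" using a1 by simp
        have "1 / l1_norm (of_int_vec q) powr \<nu> \<le> 1 / real a powr \<nu>"
          using l1ge ap \<nu>1 by (intro divide_left_mono powr_mono2) auto
        also have "\<dots> = real a * (real a powr (- (\<nu> + 1)))"
        proof -
          have "real a * real a powr (- (\<nu> + 1)) = real a powr (1 + - (\<nu> + 1))" by (rule powr_mult_base) simp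
          also have "\<dots> = real a powr (- \<nu>)" by simp
          also have "\<dots> = 1 / real a powr \<nu>" by (rule powr_minus_divide)
          finally show ?thesis by simp
        qed
        also have "\<dots> \<le> real a * (1 / real c ^ lf i)"
        proof (rule mult_left_mono)
          have "real a powr (- (\<nu> + 1)) \<le> real (c ^ i) powr (- (\<nu> + 1))"
          proof (rule powr_mono2')
            show "real (c ^ i) \<le> real a" using il by (simp only: of_nat_le_iff)
          qed (use c0 \<nu>1 in auto)
          also have "\<dots> = s i"
          proof -
            have "real (c ^ i) = real c powr real i" using c0 by (simp add: powr_realpow)
            then have "real (c ^ i) powr (- (\<nu> + 1)) = real c powr (real i * (- (\<nu> + 1)))" by (simp only: powr_powr)
            also have "real i * (- (\<nu> + 1)) = - ((\<nu> + 1) * real i)" by (simp only: mult_minus_right mult.commute)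
            finally show ?thesis by (simp only: s_def)
          qed
          also have "\<dots> \<le> 1 / real c ^ lf i" by (rule sl(1))
          finally show "real a powr (- (\<nu> + 1)) \<le> 1 / real c ^ lf i" .
        qed simp
        finally show ?thesis using q(3) by simp
      qed
      moreover have "\<bar>of_int_vec q \<bullet> (center c D - \<omega>)\<bar> \<le> real a * real ?n / real c ^ lf i"
      proof -
        have "\<bar>(center c D - \<omega>) $ m\<bar> \<le> 1 / (2 * real c ^ lf i)" for m
          using center_close[OF c0, of \<omega> D m] closure_subset \<omega>D by (auto simp: abs_minus_commute D_def)
        then have "\<bar>of_int_vec q \<bullet> (center c D - \<omega>)\<bar> \<le> l1_norm (of_int_vec q) * (1 / (2 * real c ^ lf i))"
          by (rule inner_of_int_vec_le)
        also have "\<dots> \<le> (real ?n * real a) * (1 / real c ^ lf i)"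
          using l1le cp by (intro mult_mono divide_left_mono) auto
        finally show ?thesis by (simp add: mult_ac)
      qed
      ultimately have "\<bar>of_int_vec q \<bullet> center c D\<bar> \<le> real a * (1 + real ?n) / real c ^ lf i"
        by (simp add: inner_diff_right distrib_left add_divide_distrib)
      moreover have "\<bar>real_of_int (q $ l')\<bar> = real a" using l' a(2) by (metis of_int_abs)
      ultimately have "D \<in> T i q l'" using Dsub by (simp add: T_def)
      moreover have "q \<in> Q i"
      proof -
        have "\<bar>q $ m\<bar> \<le> int (c ^ Suc i)" for m
          using q(2)[of m] iu unfolding a(1)[symmetric] by (meson less_imp_le of_nat_le_iff order_trans)
        then have "q $ m \<in> {- int (c ^ Suc i)..int (c ^ Suc i)}" for m
          unfolding atLeastAtMost_iff by (meson abs_le_D1 abs_le_D2 minus_le_iff)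
        then show ?thesis unfolding Q_def by blast
      qed
      ultimately have "D \<in> \<E> i" using q0 unfolding \<E>_def l'_def by blast
      moreover have "i = (i - i1) + i1" using i1i by simp
      ultimately show "\<omega> \<in> (\<Union>k. \<Union>D\<in>\<E> (k + i1). cube c D)" using \<omega>D by (metis UN_I UNIV_I)
    qed
    have "(\<Sum>k. \<Sum>D\<in>\<E> (k + i1). ennreal (g (diameter (cube c D)))) \<le> (\<Sum>k. ennreal (S (k + i1)))"
      by (intro suminf_le cost) auto
    also have "\<dots> = ennreal (\<Sum>k. S (k + i1))"
      using summ S0 by (intro suminf_ennreal2) (auto simp: summable_iff_shift)
    also have "\<dots> \<le> ennreal \<epsilon>"
      using N0[of i1] by (intro ennreal_leI) (simp add: i1_def)
    finally show "(\<Sum>k. \<Sum>D\<in>\<E> (k + i1). ennreal (Id_times (?n - 1) h (diameter (cube c D)))) \<le> ennreal \<epsilon>"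
      by (simp add: g_def)
  qed
qed

text \<open>Space is the union of the countably many unit cubes, listed through
  \<open>from_nat\<close>; the \<open>k\<close>-th one is covered within the budget
  \<open>\<epsilon> / 2 ^ (k + 1)\<close>.\<close>

lemma converge_cover:
  assumes n: "CARD('n :: finite) \<ge> 2" and c: "c \<ge> 2" and \<nu>: "\<nu> > real CARD('n) - 1"
    and h: "h \<in> gauges 1" and conv: "approx_sum CARD('n) \<nu> h < \<infinity>" and \<epsilon>: "0 < \<epsilon>"
  shows "\<exists>L. (\<forall>i. L i = {} \<or> (\<exists>D. J \<le> fst D \<and> L i = cube c D)) \<and> (R_set \<nu> :: (real ^ 'n) set) \<subseteq> (\<Union>i :: nat. L i) \<and>
    (\<Sum>i. ennreal (Id_times (CARD('n) - 1) h (diameter (L i)))) \<le> ennreal \<epsilon>"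
proof -
  define g where "g = Id_times (CARD('n) - 1) h"
  have g0: "g 0 = 0" using gauge_zero[OF Id_times_gauge[OF h, of "CARD('n)"]] n by (simp add: g_def)
  define p where "p k = (0 :: nat, from_nat k :: int ^ 'n)" for k
  define good where "good k \<D> \<longleftrightarrow> (\<forall>i. finite (\<D> i) \<and> (\<forall>D\<in>\<D> i. J \<le> fst D)) \<and>
    R_set \<nu> \<inter> cube c (p k) \<subseteq> (\<Union>i. \<Union>D\<in>\<D> i. cube c D) \<and>
    (\<Sum>i. \<Sum>D\<in>\<D> i. ennreal (g (diameter (cube c D)))) \<le> ennreal (\<epsilon> * (1 / 2) ^ Suc k)"
    for k and \<D> :: "nat \<Rightarrow> (nat \<times> (int ^ 'n)) set"
  have "\<exists>\<D>. good k \<D>" for k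
    unfolding good_def g_def using \<epsilon> by (intro converge_cover_cube[OF n c \<nu> h conv]) simp
  then obtain \<D> where \<D>: "\<And>k. good k (\<D> k)" by metis
  define \<E> where "\<E> m = (case prod_decode m of (k, i) \<Rightarrow> \<D> k i)" for m
  have finE: "finite (\<E> m)" for m using \<D> by (auto simp: \<E>_def good_def split: prod.split)
  obtain L where L: "\<forall>i. L i = {} \<or> (\<exists>k. \<exists>D\<in>\<E> k. L i = cube c D)"
    "(\<Union>k. \<Union>D\<in>\<E> k. cube c D) \<subseteq> (\<Union>i. L i)"
    "(\<Sum>i. ennreal (g (diameter (L i)))) = (\<Sum>k. \<Sum>D\<in>\<E> k. ennreal (g (diameter (cube c D))))"
    using enumerate_cover[of \<E> g c, OF finE g0] by blast
  show ?thesis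
  proof (intro exI[of _ L] conjI allI)
    fix i
    show "L i = {} \<or> (\<exists>D. J \<le> fst D \<and> L i = cube c D)"
    proof (cases "L i = {}")
      case False
      then obtain k D where D: "D \<in> \<E> k" "L i = cube c D" using L(1) by blast
      have "J \<le> fst D" using D(1) \<D>[of "fst (prod_decode k)"] by (auto simp: \<E>_def good_def split_beta)
      then show ?thesis using D(2) by blast
    qed simp
  next
    show "R_set \<nu> \<subseteq> (\<Union>i. L i)"
    proof
      fix \<omega> :: "real ^ 'n" assume \<omega>: "\<omega> \<in> R_set \<nu>"
      obtain k where k: "from_nat k = index c 0 \<omega>" using surj_from_nat by (metis surjD)
      have "\<omega> \<in> cube c (p k)" using k by (simp add: mem_cube_index p_def)
      then have "\<omega> \<in> (\<Union>i. \<Union>D\<in>\<D> k i. cube c D)" using \<D>[of k] \<omega> unfolding good_def by blast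
      then obtain i D where D: "D \<in> \<D> k i" "\<omega> \<in> cube c D" by blast
      have "\<D> k i = \<E> (prod_encode (k, i))" by (simp add: \<E>_def)
      then have "\<omega> \<in> (\<Union>k. \<Union>D\<in>\<E> k. cube c D)" using D by blast
      then show "\<omega> \<in> (\<Union>i. L i)" using L(2) by blast
    qed
  next
    define f where "f = (\<lambda>(k, i). \<Sum>D\<in>\<D> k i. ennreal (g (diameter (cube c D))))"
    have "(\<Sum>k. \<Sum>D\<in>\<E> k. ennreal (g (diameter (cube c D)))) = (\<Sum>m. f (prod_decode m))"
      by (simp add: f_def \<E>_def split_beta)
    also have "\<dots> = (\<Sum>k. \<Sum>i. f (k, i))" by (rule suminf_ennreal_2dimen) simp
    also have "\<dots> \<le> (\<Sum>k. ennreal (\<epsilon> * (1 / 2) ^ Suc k))"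
      using \<D> by (intro suminf_le) (auto simp: f_def good_def)
    also have "\<dots> = ennreal (\<epsilon> * 1)"
      using \<epsilon> by (intro suminf_ennreal_eq sums_mult power_half_series) simp
    finally show "(\<Sum>i. ennreal (Id_times (CARD('n) - 1) h (diameter (L i)))) \<le> ennreal \<epsilon>"
      using L(3) by (simp add: g_def)
  qed
qed

lemma R_set_hausdorff_zero:
  assumes n: "CARD('n :: finite) \<ge> 2" and \<nu>: "\<nu> > real CARD('n) - 1"
    and h: "h \<in> gauges 1" and conv: "approx_sum CARD('n) \<nu> h < \<infinity>"
  shows "hausdorff_measure (Id_times (CARD('n) - 1) h) (R_set \<nu> \<inter> V :: (real ^ 'n) set) = 0"
proof -
  let ?g = "Id_times (CARD('n) - 1) h"
  \<comment> \<open>Hausdorff measures involve no base, so dyadic cubes will do.\<close>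
  have c: "2 \<le> (2 :: nat)" by simp
  have "hausdorff_premeasure ?g \<delta> (R_set \<nu> \<inter> V) \<le> 0" if \<delta>: "0 < \<delta>" for \<delta>
  proof (rule ennreal_le_epsilon)
    fix \<epsilon> :: real assume \<epsilon>: "0 < \<epsilon>"
    obtain J where J: "\<And>j. sqrt (real CARD('n)) / real 2 ^ j < \<delta> \<longleftrightarrow> J \<le> j"
      using ex_level_diameter[OF c \<delta>, where 'n = 'n] by blast
    obtain L :: "nat \<Rightarrow> (real ^ 'n) set" where L: "\<forall>i. L i = {} \<or> (\<exists>D. J \<le> fst D \<and> L i = cube 2 D)" "R_set \<nu> \<subseteq> (\<Union>i. L i)"
      "(\<Sum>i. ennreal (?g (diameter (L i)))) \<le> ennreal \<epsilon>"
      using converge_cover[where 'n = 'n, OF n c \<nu> h conv \<epsilon>, of J] by blast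
    have "bounded (L i) \<and> diameter (L i) < \<delta>" for i
    proof (cases "L i = {}")
      case True
      then show ?thesis using \<delta> by (simp add: diameter_def)
    next
      case False
      then obtain D where "J \<le> fst D" "L i = cube 2 D" using L(1) by blast
      then show ?thesis using J[of "fst D"] bounded_cube[of 2 D] by (simp add: diameter_cube)
    qed
    then have "hausdorff_premeasure ?g \<delta> (R_set \<nu> \<inter> V) \<le> (\<Sum>i. ennreal (?g (diameter (L i))))"
      unfolding hausdorff_premeasure_def using L(2) by (intro Inf_lower CollectI exI[of _ L]) blast
    then show "hausdorff_premeasure ?g \<delta> (R_set \<nu> \<inter> V) \<le> 0 + ennreal \<epsilon>" using L(3) by (simp add: order_trans)
  qed
  then have "hausdorff_measure ?g (R_set \<nu> \<inter> V) \<le> 0"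
    unfolding hausdorff_measure_eq_SUP by (intro SUP_least) simp
  then show ?thesis by simp
qed

lemma R_set_net_measure_zero:
  assumes n: "CARD('n :: finite) \<ge> 2" and c: "c \<ge> 2" and \<nu>: "\<nu> > real CARD('n) - 1"
    and h: "h \<in> gauges 1" and conv: "approx_sum CARD('n) \<nu> h < \<infinity>"
  shows "net_measure c (Id_times (CARD('n) - 1) h) (R_set \<nu> \<inter> V :: (real ^ 'n) set) = 0"
proof -
  let ?g = "Id_times (CARD('n) - 1) h"
  have c0: "c > 0" using c by simp
  have g: "?g \<in> gauges CARD('n)" using n by (intro Id_times_gauge h) simp
  have "net_measure c ?g (R_set \<nu> \<inter> V) \<le> 0"
  proof (rule ennreal_le_epsilon)
    fix \<epsilon> :: real assume \<epsilon>: "0 < \<epsilon>"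
    obtain L :: "nat \<Rightarrow> (real ^ 'n) set" where
      L: "\<forall>i. L i = {} \<or> (\<exists>D. level_threshold TYPE('n) c ?g \<le> fst D \<and> L i = cube c D)" "R_set \<nu> \<subseteq> (\<Union>i. L i)"
      "(\<Sum>i. ennreal (?g (diameter (L i)))) \<le> ennreal \<epsilon>"
      using converge_cover[where 'n = 'n, OF n c \<nu> h conv \<epsilon>, of "level_threshold TYPE('n) c ?g"] by blast
    have "L i = {} \<or> L i \<in> adic_cubes c \<and> diameter (L i) < gauge_threshold CARD('n) ?g" for i
    proof (cases "L i = {}")
      case False
      then obtain D where D: "level_threshold TYPE('n) c ?g \<le> fst D" "L i = cube c D" using L(1) by blast
      then show ?thesis
        using level_threshold[OF c g, of "fst D"] cube_adic[OF c0, of D] by (simp add: diameter_cube[OF c0])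
    qed simp
    then have "net_measure c ?g (R_set \<nu> \<inter> V) \<le> (\<Sum>i. ennreal (?g (diameter (L i))))"
      using L(2) by (intro net_measure_le) blast+
    then show "net_measure c ?g (R_set \<nu> \<inter> V) \<le> 0 + ennreal \<epsilon>" using L(3) by (simp add: order_trans)
  qed
  then show ?thesis by simp
qed

text \<open>The half-open cube is squeezed between its open and its closed box, which have the same
  volume, so Lebesgue measure is needed on boxes only.\<close>

lemma
  fixes \<kappa> :: "int ^ 'n" and j :: nat
  assumes c: "c > 0"
  defines "a \<equiv> (\<chi> i. real_of_int (\<kappa> $ i) / real c ^ j)" and "b \<equiv> (\<chi> i. (real_of_int (\<kappa> $ i) + 1) / real c ^ j)"
  shows box_subset_cube: "box a b \<subseteq> cube c (j, \<kappa>)"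
    and cube_subset_cbox: "cube c (j, \<kappa>) \<subseteq> cbox a b"
    and emeasure_cube_cbox: "emeasure lborel (cbox a b) = ennreal (1 / (real c ^ j) ^ CARD('n))"
    and emeasure_cube_box: "emeasure lborel (box a b) = ennreal (1 / (real c ^ j) ^ CARD('n))"
proof -
  have cp: "real c ^ j > 0" using c by simp
  show "box a b \<subseteq> cube c (j, \<kappa>)"
    unfolding subset_iff mem_cube_iff[OF c] mem_box_cart a_def b_def by (auto intro: less_imp_le)
  show "cube c (j, \<kappa>) \<subseteq> cbox a b"
    using cbox_closed_cube[OF c, of j \<kappa>] closure_subset unfolding a_def b_def by blast
  have diff: "b $ i - a $ i = 1 / real c ^ j" for i
    by (simp add: a_def b_def add_divide_distrib)
  have le: "a $ i \<le> b $ i" for i using diff[of i] cp by (simp add: algebra_simps)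
  have le': "a \<bullet> x \<le> b \<bullet> x" if "x \<in> Basis" for x
    using that le by (auto simp: Basis_vec_def inner_axis)
  have "a \<in> cbox a b" using le by (simp add: mem_box_cart)
  then have ne: "cbox a b \<noteq> {}" by blast
  have "emeasure lborel (cbox a b) = ennreal (measure lborel (cbox a b))"
    by (intro emeasure_eq_ennreal_measure) (simp add: emeasure_lborel_cbox_eq)
  also have "measure lborel (cbox a b) = (\<Prod>i\<in>UNIV. b $ i - a $ i)" by (rule content_cbox_cart[OF ne])
  also have "\<dots> = 1 / (real c ^ j) ^ CARD('n)" by (simp add: diff power_one_over power_divide)
  finally show eq: "emeasure lborel (cbox a b) = ennreal (1 / (real c ^ j) ^ CARD('n))" .
  have "emeasure lborel (box a b) = emeasure lborel (cbox a b)"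
    using emeasure_lborel_box[of a b] emeasure_lborel_cbox[of a b] le' by simp
  then show "emeasure lborel (box a b) = ennreal (1 / (real c ^ j) ^ CARD('n))" using eq by simp
qed

text \<open>As \<open>g r / r ^ n\<close> is nonincreasing, an admissible cube costs at least
  \<open>C0\<close> times its volume; the net measure therefore dominates a multiple of Lebesgue
  measure.\<close>

lemma net_measure_open_pos:
  fixes U :: "(real ^ 'n) set"
  assumes c: "c \<ge> 2" and g: "g \<in> gauges CARD('n)" and U: "open U" "U \<noteq> {}"
  shows "0 < net_measure c g U"
proof -
  let ?n = "CARD('n)" and ?G = "level_gauge TYPE('n) c g" and ?J = "level_threshold TYPE('n) c g"
  have c0: "c > 0" using c by simp
  have cp: "real c ^ k > 0" for k using c0 by simp
  obtain x where x: "x \<in> U" using U by blast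
  obtain j where j: "cube c (j, index c j x) \<subseteq> U" using open_contains_cubes[OF c U(1) x] by blast
  define C0 where "C0 = ?G ?J * (real c ^ ?J) ^ ?n"
  have C0: "0 < C0" using level_gauge_pos[OF c g order_refl] cp by (simp add: C0_def)
  define v where "v = 1 / (real c ^ j) ^ ?n"
  have v: "0 < v" using cp by (simp add: v_def)
  define lo hi where "lo p = (\<chi> i. real_of_int (snd p $ i) / real c ^ fst p)"
    and "hi p = (\<chi> i. (real_of_int (snd p $ i) + 1) / real c ^ fst p)" for p :: "nat \<times> (int ^ 'n)"
  have "ennreal (C0 * v) \<le> net_measure c g U"
    unfolding net_measure_def
  proof (rule Inf_greatest, safe)
    fix \<Lambda> :: "nat \<Rightarrow> (real ^ 'n) set"
    assume cover: "U \<subseteq> (\<Union>i. \<Lambda> i)" and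
      \<Lambda>: "\<forall>p. \<Lambda> p = {} \<or> (\<Lambda> p \<in> adic_cubes c \<and> diameter (\<Lambda> p) < gauge_threshold ?n g)"
    have "\<exists>E. \<Lambda> i \<subseteq> E \<and> E \<in> sets lborel \<and> ennreal C0 * emeasure lborel E \<le> ennreal (g (diameter (\<Lambda> i)))" for i
    proof (cases "\<Lambda> i = {}")
      case True
      then show ?thesis by (intro exI[of _ "{}"]) simp
    next
      case False
      then obtain p where p: "?J \<le> fst p" "\<Lambda> i = cube c p" "ennreal (?G (fst p)) = ennreal (g (diameter (\<Lambda> i)))"
        using \<Lambda> net_cover_cube[OF c g, of "\<Lambda> i"] by blast
      have "C0 \<le> ?G (fst p) * (real c ^ fst p) ^ ?n"
        using level_gauge_mono[OF c g order_refl p(1)] by (simp add: C0_def power_mult)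
      then have "C0 * (1 / (real c ^ fst p) ^ ?n) \<le> ?G (fst p)" using cp by (simp add: pos_divide_le_eq)
      then have "ennreal C0 * ennreal (1 / (real c ^ fst p) ^ ?n) \<le> ennreal (g (diameter (\<Lambda> i)))"
        unfolding p(3)[symmetric] using C0 by (subst ennreal_mult'[symmetric]) (auto intro: ennreal_leI)
      moreover have "\<Lambda> i \<subseteq> cbox (lo p) (hi p)"
        using cube_subset_cbox[OF c0, where j = "fst p" and \<kappa> = "snd p"] unfolding p(2) lo_def hi_def by simp
      moreover have "emeasure lborel (cbox (lo p) (hi p)) = ennreal (1 / (real c ^ fst p) ^ ?n)"
        unfolding lo_def hi_def by (rule emeasure_cube_cbox[OF c0])
      ultimately show ?thesis by (intro exI[of _ "cbox (lo p) (hi p)"]) simp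
    qed
    then obtain E where E: "\<And>i. \<Lambda> i \<subseteq> E i" "\<And>i. E i \<in> sets lborel"
      "\<And>i. ennreal C0 * emeasure lborel (E i) \<le> ennreal (g (diameter (\<Lambda> i)))" by metis
    let ?q = "(j, index c j x)"
    have "box (lo ?q) (hi ?q) \<subseteq> cube c ?q"
      using box_subset_cube[OF c0, where j = j and \<kappa> = "index c j x"] unfolding lo_def hi_def by simp
    moreover have "(\<Union>i. \<Lambda> i) \<subseteq> (\<Union>i. E i)" by (rule UN_mono[OF order_refl E(1)])
    ultimately have sub: "box (lo ?q) (hi ?q) \<subseteq> (\<Union>i. E i)" using j cover by (meson order_trans)
    have "ennreal (C0 * v) = ennreal C0 * emeasure lborel (box (lo ?q) (hi ?q))"
      using emeasure_cube_box[OF c0, where j = j and \<kappa> = "index c j x"] ennreal_mult'[of C0 v] C0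
      unfolding lo_def hi_def v_def by simp
    also have "\<dots> \<le> ennreal C0 * emeasure lborel (\<Union>i. E i)"
      using sub E(2) by (intro mult_left_mono emeasure_mono) auto
    also have "\<dots> \<le> ennreal C0 * (\<Sum>i. emeasure lborel (E i))"
      using E(2) by (intro mult_left_mono emeasure_subadditive_countably) auto
    also have "\<dots> = (\<Sum>i. ennreal C0 * emeasure lborel (E i))" by simp
    also have "\<dots> \<le> (\<Sum>i. ennreal (g (diameter (\<Lambda> i))))" by (intro suminf_le E(3)) auto
    finally show "ennreal (C0 * v) \<le> (\<Sum>i. ennreal (g (diameter (\<Lambda> i))))" .
  qed
  moreover have "0 < ennreal (C0 * v)" using C0 v by simp
  ultimately show ?thesis by (rule less_le_trans[rotated])
qed

section \<open>A slightly larger gauge with convergent sum\<close>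

text \<open>A tail of the series stays below \<open>e / 2\<close> without truncation, and on the
  finitely many other terms a small cap \<open>b\<close> gives \<open>e / 2\<close> as well.\<close>

lemma truncation_small:
  fixes a :: "nat \<Rightarrow> real"
  assumes a: "summable a" "\<And>m. 0 < a m" and e: "0 < e"
  shows "\<exists>b. 0 < b \<and> b \<le> e \<and> (\<forall>N. (\<Sum>m<N. min (a m) b) \<le> e)"
proof -
  obtain M where M: "norm (\<Sum>i. a (i + M)) < e / 2"
    using suminf_exist_split[of "e / 2" a] a(1) e by auto
  define b where "b = min e (e / (2 * (real M + 1)))"
  have b: "0 < b" "b \<le> e" using e by (auto simp: b_def)
  have "real M * b \<le> e / 2"
  proof -
    have "real M * b \<le> (real M + 1) * (e / (2 * (real M + 1)))" using b e by (intro mult_mono) (auto simp: b_def)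
    also have "\<dots> = e / 2" by (simp add: field_simps)
    finally show ?thesis .
  qed
  have "(\<Sum>m<N. min (a m) b) \<le> e" for N
  proof -
    have "(\<Sum>m<N. min (a m) b) \<le> (\<Sum>m<N + M. min (a m) b)"
      using a(2) b by (intro sum_mono2) (auto intro: less_imp_le)
    also have "\<dots> = (\<Sum>m<M. min (a m) b) + (\<Sum>i<N. min (a (i + M)) b)"
      using sum.nat_group[of "\<lambda>m. min (a m) b"] by (induction N) (simp_all add: add.commute add.left_commute)
    also have "\<dots> \<le> (\<Sum>m<M. b) + (\<Sum>i<N. a (i + M))" by (intro add_mono sum_mono) auto
    also have "(\<Sum>i<N. a (i + M)) \<le> (\<Sum>i. a (i + M))"
      using a by (intro sum_le_suminf) (auto simp: summable_iff_shift intro: less_imp_le)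
    also have "\<dots> \<le> e / 2" using M by simp
    finally show ?thesis using \<open>real M * b \<le> e / 2\<close> by simp
  qed
  then show ?thesis using b by blast
qed

text \<open>The gauge \<open>\<Sum>i. min h (b\<^sub>i)\<close> inherits both monotonicity conditions from \<open>h\<close>, and its quotient by \<open>h\<close> is at least
  \<open>N\<close> wherever \<open>h < b\<^sub>i\<close> for all \<open>i < N\<close>.\<close>

lemma slower_gauge:
  assumes h: "h \<in> gauges 1" and \<nu>: "0 < \<nu> + 1" and n: "0 < n" and conv: "approx_sum n \<nu> h < \<infinity>"
  shows "\<exists>h'. h' \<in> gauges 1 \<and> approx_sum n \<nu> h' < \<infinity> \<and> Id_times k h' \<prec>\<^sub>0 Id_times k h"
proof -
  define \<beta> where "\<beta> = (\<nu> + 1) / real n"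
  have \<beta>: "0 < \<beta>" using \<nu> n by (simp add: \<beta>_def)
  obtain \<eta> where \<eta>: "0 < \<eta>" "\<And>r. 0 < r \<Longrightarrow> r \<le> \<eta> \<Longrightarrow> 0 < h r"
    "\<And>r r'. 0 \<le> r \<Longrightarrow> r \<le> r' \<Longrightarrow> r' \<le> \<eta> \<Longrightarrow> h r \<le> h r'"
    "\<And>r r'. 0 < r \<Longrightarrow> r \<le> r' \<Longrightarrow> r' \<le> \<eta> \<Longrightarrow> h r' / r' \<le> h r / r"
    "continuous_on {0..\<eta>} h" using gauge1E[OF h] by metis
  have h0: "h 0 = 0" by (rule gauge_zero[OF h])
  obtain m0 where m0: "m0 \<ge> 1" "\<And>k. m0 \<le> k \<Longrightarrow> 0 < real k powr (- \<beta>) \<and> real k powr (- \<beta>) \<le> \<eta>"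
    using powr_minus_small[OF \<beta> \<eta>(1)] by metis
  define a where "a m = h (real (m + m0) powr (- \<beta>))" for m
  have a0: "0 < a m" for m unfolding a_def using m0(2)[of "m + m0"] by (intro \<eta>(2)) auto
  have "summable (\<lambda>k. h (real k powr (- \<beta>)))"
    using conv approx_sum_finite_iff[OF h \<nu> n] by (simp add: \<beta>_def)
  then have suma: "summable a" unfolding a_def by (subst summable_iff_shift)
  \<comment> \<open>The caps do two jobs: \<open>b i \<le> (1 / 2) ^ i\<close> makes the series for
    \<open>h'\<close> converge uniformly, hence to a continuous function, and the bound on the
    truncated sums makes the approximation sum of \<open>h'\<close> converge once the order of
    summation is exchanged.\<close>
  have "\<exists>b. 0 < b \<and> b \<le> (1 / 2) ^ i \<and> (\<forall>N. (\<Sum>m<N. min (a m) b) \<le> (1 / 2) ^ i)" for i :: nat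
    by (rule truncation_small[OF suma a0]) simp
  then obtain b where b: "\<And>i. 0 < b i" "\<And>i. b i \<le> (1 / 2) ^ i" "\<And>i N. (\<Sum>m<N. min (a m) (b i)) \<le> (1 / 2 :: real) ^ i"
    by metis
  define h' where "h' r = (\<Sum>i. min (h r) (b i))" for r
  have geo: "summable (\<lambda>i. (1 / 2 :: real) ^ i)" by (rule summable_geometric) simp
  have hn: "0 \<le> h r" if "0 \<le> r" "r \<le> \<eta>" for r using \<eta>(3)[of 0 r] that h0 by simp
  have tb: "0 \<le> min (h r) (b i)" "\<bar>min (h r) (b i)\<bar> \<le> (1 / 2) ^ i" if "0 \<le> r" "r \<le> \<eta>" for r i
    using hn[OF that] b(1,2)[of i] by (auto simp: min_def)
  have sm: "summable (\<lambda>i. min (h r) (b i))" if "0 \<le> r" "r \<le> \<eta>" for r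
    by (rule summable_comparison_test'[OF geo]) (use tb(2)[OF that] in auto)
  have pos: "0 < h' r" if "0 < r" "r \<le> \<eta>" for r
    unfolding h'_def using that \<eta>(2) b(1) by (intro suminf_pos sm) auto
  have mono: "h' r \<le> h' r'" if "0 \<le> r" "r \<le> r'" "r' \<le> \<eta>" for r r'
    unfolding h'_def using that \<eta>(3)[OF that] by (intro suminf_le sm) auto
  \<comment> \<open>Both quotients, \<open>h' r / r\<close> and \<open>h' r / h r\<close>, are
    treated at once. For \<open>x \<le> y\<close> the cross-multiplied inequality for
    \<open>h\<close> passes to each \<open>min (h r) (b i)\<close>; it is used for the pair
    \<open>r\<close>, \<open>r'\<close> and for the pair \<open>h r\<close>,
    \<open>h r'\<close>.\<close>
  have cross: "h' r' * x \<le> h' r * y" if r: "0 \<le> r" "r \<le> \<eta>" "0 \<le> r'" "r' \<le> \<eta>"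
    and xy: "0 \<le> x" "x \<le> y" "h r' * x \<le> h r * y" for r r' x y
  proof -
    have "h' r' * x = (\<Sum>i. min (h r') (b i) * x)" unfolding h'_def by (rule suminf_mult2[OF sm[OF r(3,4)]])
    also have "\<dots> \<le> (\<Sum>i. min (h r) (b i) * y)"
    proof (rule suminf_le)
      fix i
      have "b i * x \<le> b i * y" using b(1)[of i] xy by (intro mult_left_mono) auto
      then have "min (h r' * x) (b i * x) \<le> min (h r * y) (b i * y)" using xy(3) by linarith
      then show "min (h r') (b i) * x \<le> min (h r) (b i) * y"
        using xy(1,2) by (simp add: min_mult_distrib_right)
    qed (intro summable_mult2 sm r)+
    also have "\<dots> = h' r * y" unfolding h'_def by (rule suminf_mult2[OF sm[OF r(1,2)], symmetric])
    finally show ?thesis .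
  qed
  have "continuous_on {0..\<eta>} h'"
  proof (rule uniform_limit_theorem)
    show "uniform_limit {0..\<eta>} (\<lambda>N r. \<Sum>i<N. min (h r) (b i)) h' sequentially"
      unfolding h'_def by (rule Weierstrass_m_test[OF _ geo]) (use tb(2) in auto)
    show "\<forall>\<^sub>F N in sequentially. continuous_on {0..\<eta>} (\<lambda>r. \<Sum>i<N. min (h r) (b i))"
      by (intro always_eventually allI continuous_intros \<eta>(5))
  qed simp
  moreover have "h' 0 = 0" using b(1) by (simp add: h'_def h0 min_def less_imp_le)
  moreover have "h' r' / r' \<le> h' r / r" if "0 < r" "r \<le> r'" "r' \<le> \<eta>" for r r'
  proof -
    have "h r' * r \<le> h r * r'" using \<eta>(4)[OF that] that by (simp add: field_simps)
    then have "h' r' * r \<le> h' r * r'" using that by (intro cross) auto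
    then show ?thesis using that by (simp add: field_simps)
  qed
  ultimately have gauge: "h' \<in> gauges 1"
    unfolding gauges_def using \<eta>(1) pos mono by (auto intro!: exI[of _ \<eta>] simp: monotone_on_def)
  have "summable (\<lambda>m. h' (real (m + m0) powr (- \<beta>)))"
  proof (rule summableI_nonneg_bounded)
    have r: "0 < real (m + m0) powr (- \<beta>)" "real (m + m0) powr (- \<beta>) \<le> \<eta>" for m using m0(2)[of "m + m0"] by auto
    show "0 \<le> h' (real (m + m0) powr (- \<beta>))" for m using pos[OF r] by (rule less_imp_le)
    fix N
    have sa: "summable (\<lambda>i. min (a m) (b i))" for m unfolding a_def using r by (intro sm) (auto intro: less_imp_le)
    have "(\<Sum>m<N. h' (real (m + m0) powr (- \<beta>))) = (\<Sum>m<N. \<Sum>i. min (a m) (b i))" by (simp add: h'_def a_def)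
    also have "\<dots> = (\<Sum>i. \<Sum>m<N. min (a m) (b i))" by (rule suminf_sum[symmetric]) (rule sa)
    also have "\<dots> \<le> (\<Sum>i. (1 / 2) ^ i)" using b(3) by (intro suminf_le geo summable_sum sa)
    finally show "(\<Sum>m<N. h' (real (m + m0) powr (- \<beta>))) \<le> (\<Sum>i. (1 / 2) ^ i)" .
  qed
  then have "summable (\<lambda>k. h' (real k powr (- \<beta>)))" by (subst (asm) summable_iff_shift)
  then have conv': "approx_sum n \<nu> h' < \<infinity>" using approx_sum_finite_iff[OF gauge \<nu> n] by (simp add: \<beta>_def)
  have ratio: "Id_times k h' r / Id_times k h r = h' r / h r" if "0 < r" for r
    using that by (simp add: Id_times_def)
  have "filterlim (\<lambda>r. Id_times k h' r / Id_times k h r) at_top (at_right 0)"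
    unfolding filterlim_at_top
  proof
    fix Z :: real
    obtain N where N: "Z \<le> real N" using real_arch_simple by blast
    have "\<forall>\<^sub>F r in at_right 0. \<forall>i\<in>{..<N}. h r < b i"
      using order_tendstoD(2)[OF gauge_tendsto_0[OF h] b(1)] by (intro eventually_ball_finite) auto
    moreover have "\<forall>\<^sub>F r in at_right 0. 0 < r \<and> r \<le> \<eta>"
      using eventually_at_right_less[of "0 :: real"] eventually_at_right_field[of "\<lambda>r. r \<le> \<eta>" 0] \<eta>(1)
      by (auto simp: eventually_conj_iff intro: less_imp_le)
    ultimately show "\<forall>\<^sub>F r in at_right 0. Z \<le> Id_times k h' r / Id_times k h r"
    proof eventually_elim
      case (elim r)
      have "real N * h r = (\<Sum>i<N. min (h r) (b i))" using elim(1) by (simp add: min_def less_imp_le)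
      also have "\<dots> \<le> h' r" unfolding h'_def using elim(2) by (intro sum_le_suminf sm tb) auto
      finally have "real N \<le> h' r / h r" using \<eta>(2) elim(2) by (simp add: pos_le_divide_eq)
      then show ?case using ratio elim(2) N by simp
    qed
  qed
  moreover have "antimono_on {0<..\<eta>} (\<lambda>r. Id_times k h' r / Id_times k h r)"
  proof (rule monotone_onI)
    fix r r' assume r: "r \<in> {0<..\<eta>}" "r' \<in> {0<..\<eta>}" "r \<le> r'"
    have hp: "0 < h r" "0 < h r'" using \<eta>(2) r by auto
    have "h' r' * h r \<le> h' r * h r'" using r hp \<eta>(3)[of r r'] by (intro cross) (auto simp: mult.commute)
    then have "h' r' / h r' \<le> h' r / h r" using hp by (simp add: field_simps)
    then show "Id_times k h' r' / Id_times k h r' \<le> Id_times k h' r / Id_times k h r" using ratio r by simp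
  qed
  ultimately have "Id_times k h' \<prec>\<^sub>0 Id_times k h" unfolding gauge_prec_def using \<eta>(1) by blast
  then show ?thesis using gauge conv' by blast
qed

text \<open>The class tests only gauges whose quotient by \<open>Id_times (n - 1) h\<close> tends to
  infinity, so a null net measure for this gauge itself is no contradiction.
  \<open>slower_gauge\<close> supplies a tested gauge with convergent sum, for which
  \<open>V\<close> has positive net measure.\<close>

lemma R_set_not_large_intersection:
  fixes V :: "(real ^ 'n) set"
  assumes n: "CARD('n) \<ge> 2" and c: "c \<ge> 2" and \<nu>: "\<nu> > real CARD('n) - 1"
    and h: "h \<in> gauges 1" and conv: "approx_sum CARD('n) \<nu> h < \<infinity>"
    and V: "open V" "V \<noteq> {}"
  shows "R_set \<nu> \<notin> large_intersection_class c (Id_times (CARD('n) - 1) h) V"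
proof
  assume R: "R_set \<nu> \<in> large_intersection_class c (Id_times (CARD('n) - 1) h) V"
  have \<nu>1: "0 < \<nu> + 1" "0 < CARD('n)" using \<nu> by auto
  obtain h' where h': "h' \<in> gauges 1" "approx_sum CARD('n) \<nu> h' < \<infinity>"
    "Id_times (CARD('n) - 1) h' \<prec>\<^sub>0 Id_times (CARD('n) - 1) h"
    using slower_gauge[OF h \<nu>1 conv] by blast
  have g': "Id_times (CARD('n) - 1) h' \<in> gauges CARD('n)" using n by (intro Id_times_gauge h') simp
  then have "net_measure c (Id_times (CARD('n) - 1) h') (R_set \<nu> \<inter> V) = net_measure c (Id_times (CARD('n) - 1) h') V"
    using R h'(3) V unfolding large_intersection_class_def by blast
  then show False
    using R_set_net_measure_zero[OF n c \<nu> h'(1,2), of V] net_measure_open_pos[OF c g' V] by simp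
qed

theorem theorem9:
  fixes V :: "(real ^ 'n) set" and h :: "real \<Rightarrow> real" and \<nu> :: real and c :: nat
  assumes "CARD('n) \<ge> 2"
    and "h \<in> gauges 1"
    and "open V" and "V \<noteq> {}"
    and "\<nu> > real CARD('n) - 1"
    and "c \<ge> 2"
  shows "(approx_sum CARD('n) \<nu> h = \<infinity> \<longrightarrow>
            hausdorff_measure (Id_times (CARD('n) - 1) h) (R_set \<nu> \<inter> V) = \<infinity>) \<and>
         (approx_sum CARD('n) \<nu> h < \<infinity> \<longrightarrow>
            hausdorff_measure (Id_times (CARD('n) - 1) h) (R_set \<nu> \<inter> V) = 0) \<and>
         (R_set \<nu> \<in> large_intersection_class c (Id_times (CARD('n) - 1) h) V \<longleftrightarrow>
            approx_sum CARD('n) \<nu> h = \<infinity>)"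
proof (cases "approx_sum CARD('n) \<nu> h = \<infinity>")
  case True
  then show ?thesis
    using R_set_hausdorff_infinite[OF assms(1,6,5,2) True assms(3,4)]
      R_set_large_intersection[OF assms(1,6,5,2) True, of V] by simp
next
  case False
  then have conv: "approx_sum CARD('n) \<nu> h < \<infinity>" by (simp add: less_top)
  show ?thesis
    using False R_set_hausdorff_zero[OF assms(1,5,2) conv, of V]
      R_set_not_large_intersection[OF assms(1,6,5,2) conv assms(3,4)] by simp
qed

end
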